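(* Let $F:\mathcal H_{\mathbf 1}\to W\text{-mod}$ and $G:W\text{-mod}\to\mathcal H_{\mathbf 1}$ be the functors defined in the context. Then $FG\cong\mathrm{id}_{W\text{-mod}}$ and $GF\cong\mathrm{id}_{\mathcal H_{\mathbf 1}}$. Consequently $\mathcal H_{\mathbf 1}$ is equivalent to $W\text{-mod}$.
   Context: Everything is over $\mathbb{C}$. Fix $n\ge 2$. Let $e_{ij}$, $0\le i,j\le n$, be the matrix units of $\mathfrak{gl}_{n+1}$; $\mathfrak h_n$ is the Cartan subalgebra of diagonal matrices of $\mathfrak{sl}_{n+1}$, and $\mathfrak m_n=\bigoplus_{i=1}^n\mathbb{C}e_{0i}$. $U_S$ is the localization of $U(\mathfrak{sl}_{n+1})$ with respect to the Ore subset $S=\{e_{01}^{i_1}\cdots e_{0n}^{i_n}\mid i_j\in\mathbb{Z}_{\ge0}\}$, and $W=\{u\in U_S\mid [\mathfrak h_n,u]=[\mathfrak m_n,u]=0\}$. $W\text{-mod}$ is the category of finite dimensional $W$-modules. $\mathcal H_{\mathbf 1}$ is the category of $\mathfrak{sl}_{n+1}$-modules $M$ such that $e_{0i}-1$ acts locally nilpotently on $M$ for all $1\le i\le n$ and $\mathrm{wh}_{\mathbf 1}(M)=\{v\in M\mid e_{0i}v=v,\ i=1,\dots,n\}$ is finite dimensional. On such $M$ each $e_{0i}$ acts bijectively, so $M$ is a $U_S$-module, and since $[W,e_{0i}]=0$ the space $\mathrm{wh}_{\mathbf 1}(M)$ is $W$-stable. Functors: $F(M)=\mathrm{wh}_{\mathbf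 1}(M)$ as a $W$-module. For $V\in W\text{-mod}$, let each $e_{0i}$ act on $V$ as the identity, making $V$ a module over the subalgebra $U(\mathfrak m_n)_SW$ of $U_S$ (where $U(\mathfrak m_n)_S$ is generated by all $e_{0i}^{\pm1}$), and put $G(V)=U_S\otimes_{U(\mathfrak m_n)_SW}V$, regarded as an $\mathfrak{sl}_{n+1}$-module; as a vector space $G(V)=U(\mathfrak h_n)\otimes V$. *)

theory Defs
  imports "HOL-Algebra.QuotRing" "HOL-Algebra.Generated_Rings" "HOL-Algebra.Free_Abelian_Groups"
    "Jordan_Normal_Form.VS_Connect"
begin

section \<open>The Lie algebra\<close>

abbreviation cfield :: "complex ring" where
  "cfield \<equiv> class_ring"

definition sl :: "nat \<Rightarrow> complex mat set" where
  "sl n = {A \<in> carrier_mat (n+1) (n+1). (\<Sum>i<n+1. A $$ (i,i)) = 0}"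

definition lie_bracket :: "complex mat \<Rightarrow> complex mat \<Rightarrow> complex mat" where
  "lie_bracket x y = x * y - y * x"

definition mat_unit :: "nat \<Rightarrow> nat \<Rightarrow> nat \<Rightarrow> complex mat" where
  "mat_unit n i j = mat (n+1) (n+1) (\<lambda>(a,b). if a = i \<and> b = j then 1 else 0)"

definition cartan :: "nat \<Rightarrow> complex mat set" where
  "cartan n = {A \<in> sl n. diagonal_mat A}"

definition m_sub :: "nat \<Rightarrow> complex mat set" where
  "m_sub n = {A \<in> carrier_mat (n+1) (n+1).
     \<forall>i<n+1. \<forall>j<n+1. A $$ (i,j) \<noteq> 0 \<longrightarrow> i = 0 \<and> j \<noteq> 0}"


section \<open>The universal enveloping algebra\<close>

text \<open>The free associative algebra on a set \<open>X\<close> is the complex monoid algebra of the free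
  monoid of words in \<open>X\<close>; its product is the convolution product of \<^theory>\<open>HOL-Library.Poly_Mapping\<close>.\<close>

datatype 'x free_word = Word (letters: "'x list")

instantiation free_word :: (type) monoid_add
begin

definition zero_free_word :: "'x free_word" where
  "zero_free_word = Word []"

definition plus_free_word :: "'x free_word \<Rightarrow> 'x free_word \<Rightarrow> 'x free_word" where
  "plus_free_word u v = Word (letters u @ letters v)"

instance
  by standard (simp_all add: zero_free_word_def plus_free_word_def)

end

definition free_algebra :: "'x set \<Rightarrow> ('x free_word \<Rightarrow>\<^sub>0 complex) ring" where
  "free_algebra X =
     \<lparr>carrier = {p. \<forall>w \<in> Poly_Mapping.keys p. set (letters w) \<subseteq> X},
      monoid.mult = (*), one = 1, ring.zero = 0, add = (+)\<rparr>"

definition fa_gen :: "'x \<Rightarrow> 'x free_word \<Rightarrow>\<^sub>0 complex" where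
  "fa_gen x = Poly_Mapping.single (Word [x]) 1"

definition fa_const :: "complex \<Rightarrow> 'x free_word \<Rightarrow>\<^sub>0 complex" where
  "fa_const c = Poly_Mapping.single 0 c"

text \<open>The first two families of relations turn the free algebra on the set \<open>sl n\<close> into the
  tensor algebra of the vector space \<open>sl n\<close>.\<close>

definition env_relations :: "nat \<Rightarrow> (complex mat free_word \<Rightarrow>\<^sub>0 complex) set" where
  "env_relations n =
     {fa_gen (x + y) - (fa_gen x + fa_gen y) | x y. x \<in> sl n \<and> y \<in> sl n} \<union>
     {fa_gen (c \<cdot>\<^sub>m x) - fa_const c * fa_gen x | c x. x \<in> sl n} \<union>
     {fa_gen x * fa_gen y - fa_gen y * fa_gen x - fa_gen (lie_bracket x y) | x y.
        x \<in> sl n \<and> y \<in> sl n}"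

definition env_ideal :: "nat \<Rightarrow> (complex mat free_word \<Rightarrow>\<^sub>0 complex) set" where
  "env_ideal n = Idl\<^bsub>free_algebra (sl n)\<^esub> (env_relations n)"

type_synonym env = "(complex mat free_word \<Rightarrow>\<^sub>0 complex) set"

definition U_alg :: "nat \<Rightarrow> env ring" where
  "U_alg n = free_algebra (sl n) Quot env_ideal n"

definition U_gen :: "nat \<Rightarrow> complex mat \<Rightarrow> env" where
  "U_gen n x = env_ideal n +>\<^bsub>free_algebra (sl n)\<^esub> fa_gen x"

definition U_const :: "nat \<Rightarrow> complex \<Rightarrow> env" where
  "U_const n c = env_ideal n +>\<^bsub>free_algebra (sl n)\<^esub> fa_const c"

definition ore_set :: "nat \<Rightarrow> env set" where
  "ore_set n = {foldr (\<lambda>j u. (U_gen n (mat_unit n 0 j) [^]\<^bsub>U_alg n\<^esub> k j) \<otimes>\<^bsub>U_alg n\<^esub> u)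
                      [1..<n+1] \<one>\<^bsub>U_alg n\<^esub> | k :: nat \<Rightarrow> nat. True}"


section \<open>Localization\<close>

text \<open>\<open>(Q, \<phi>)\<close> is a ring of right fractions of \<open>R\<close> with respect to \<open>S\<close>. For a two-sided Ore set
  it is also a ring of left fractions, and it is unique up to a unique isomorphism under \<open>R\<close>.\<close>

definition is_localization ::
  "('r, 'a) ring_scheme \<Rightarrow> 'r set \<Rightarrow> ('q, 'b) ring_scheme \<Rightarrow> ('r \<Rightarrow> 'q) \<Rightarrow> bool" where
  "is_localization R S Q \<phi> \<longleftrightarrow>
     ring Q \<and> \<phi> \<in> Ring.ring_hom R Q \<and> \<phi> ` S \<subseteq> Units Q \<and>
     (\<forall>q \<in> carrier Q. \<exists>r \<in> carrier R. \<exists>s \<in> S. q = \<phi> r \<otimes>\<^bsub>Q\<^esub> inv\<^bsub>Q\<^esub> (\<phi> s)) \<and>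
     (\<forall>r \<in> carrier R. \<phi> r = \<zero>\<^bsub>Q\<^esub> \<longleftrightarrow> (\<exists>s \<in> S. r \<otimes>\<^bsub>R\<^esub> s = \<zero>\<^bsub>R\<^esub>))"

text \<open>From here on \<open>(Q, \<phi>)\<close> stands for the localization \<open>U\<^sub>S\<close> with its canonical map from \<open>U_alg n\<close>.\<close>

definition q_gen :: "nat \<Rightarrow> (env \<Rightarrow> 'q) \<Rightarrow> complex mat \<Rightarrow> 'q" where
  "q_gen n \<phi> x = \<phi> (U_gen n x)"

definition q_const :: "nat \<Rightarrow> (env \<Rightarrow> 'q) \<Rightarrow> complex \<Rightarrow> 'q" where
  "q_const n \<phi> c = \<phi> (U_const n c)"

definition W_alg :: "nat \<Rightarrow> 'q ring \<Rightarrow> (env \<Rightarrow> 'q) \<Rightarrow> 'q set" where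
  "W_alg n Q \<phi> = {u \<in> carrier Q. \<forall>x \<in> cartan n \<union> m_sub n.
      (q_gen n \<phi> x \<otimes>\<^bsub>Q\<^esub> u) \<ominus>\<^bsub>Q\<^esub> (u \<otimes>\<^bsub>Q\<^esub> q_gen n \<phi> x) = \<zero>\<^bsub>Q\<^esub>}"

definition Um_S :: "nat \<Rightarrow> 'q ring \<Rightarrow> (env \<Rightarrow> 'q) \<Rightarrow> 'q set" where
  "Um_S n Q \<phi> = generate_ring Q
     (range (q_const n \<phi>) \<union>
      {q_gen n \<phi> (mat_unit n 0 i) | i. i \<in> {1..n}} \<union>
      {inv\<^bsub>Q\<^esub> (q_gen n \<phi> (mat_unit n 0 i)) | i. i \<in> {1..n}})"

text \<open>Since \<open>W_alg\<close> commutes with \<open>Um_S\<close>, the product \<open>Um_S W_alg\<close> is the subalgebra generated by both.\<close>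

definition Um_S_W :: "nat \<Rightarrow> 'q ring \<Rightarrow> (env \<Rightarrow> 'q) \<Rightarrow> 'q set" where
  "Um_S_W n Q \<phi> = generate_ring Q (Um_S n Q \<phi> \<union> W_alg n Q \<phi>)"


section \<open>Representations\<close>

text \<open>A complex vector space with operators indexed by \<open>'x\<close>. The fields \<open>mult\<close> and \<open>one\<close> that
  every \<open>module\<close> record inherits from \<open>ring\<close> play no role.\<close>

record ('x, 'm) rep = "(complex, 'm) module" +
  act :: "'x \<Rightarrow> 'm \<Rightarrow> 'm"

definition with_act :: "('x, 'm) rep \<Rightarrow> ('y \<Rightarrow> 'm \<Rightarrow> 'm) \<Rightarrow> ('y, 'm) rep" where
  "with_act M \<alpha> =
     \<lparr>carrier = carrier M, monoid.mult = monoid.mult M, one = one M, ring.zero = ring.zero M,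
      add = add M, smult = smult M, act = \<alpha>\<rparr>"

definition sl_module :: "nat \<Rightarrow> (complex mat, 'm) rep \<Rightarrow> bool" where
  "sl_module n M \<longleftrightarrow>
     vectorspace cfield M \<and>
     (\<forall>x \<in> sl n. act M x \<in> module_hom cfield M M) \<and>
     (\<forall>x \<in> sl n. \<forall>y \<in> sl n. \<forall>v \<in> carrier M.
        act M (x + y) v = act M x v \<oplus>\<^bsub>M\<^esub> act M y v) \<and>
     (\<forall>c. \<forall>x \<in> sl n. \<forall>v \<in> carrier M. act M (c \<cdot>\<^sub>m x) v = c \<odot>\<^bsub>M\<^esub> act M x v) \<and>
     (\<forall>x \<in> sl n. \<forall>y \<in> sl n. \<forall>v \<in> carrier M.
        act M (lie_bracket x y) v = act M x (act M y v) \<ominus>\<^bsub>M\<^esub> act M y (act M x v))"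

text \<open>Left modules over a subalgebra \<open>A\<close> of \<open>Q\<close>. The complex structure of \<open>Q\<close> is given by
  \<open>q_const\<close>, and the last clause makes it agree with that of the underlying space.\<close>

definition alg_module ::
  "nat \<Rightarrow> 'q ring \<Rightarrow> (env \<Rightarrow> 'q) \<Rightarrow> 'q set \<Rightarrow> ('q, 'm) rep \<Rightarrow> bool" where
  "alg_module n Q \<phi> A M \<longleftrightarrow>
     vectorspace cfield M \<and>
     (\<forall>a \<in> A. act M a \<in> module_hom cfield M M) \<and>
     (\<forall>a \<in> A. \<forall>b \<in> A. \<forall>v \<in> carrier M. act M (a \<oplus>\<^bsub>Q\<^esub> b) v = act M a v \<oplus>\<^bsub>M\<^esub> act M b v) \<and>
     (\<forall>a \<in> A. \<forall>b \<in> A. \<forall>v \<in> carrier M. act M (a \<otimes>\<^bsub>Q\<^esub> b) v = act M a (act M b v)) \<and>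
     (\<forall>v \<in> carrier M. act M \<one>\<^bsub>Q\<^esub> v = v) \<and>
     (\<forall>c. \<forall>v \<in> carrier M. act M (q_const n \<phi> c) v = c \<odot>\<^bsub>M\<^esub> v)"

text \<open>Morphisms are extensional functions, so that equality of morphisms is equality of functions.\<close>

definition rep_hom :: "'x set \<Rightarrow> ('x, 'a) rep \<Rightarrow> ('x, 'b) rep \<Rightarrow> ('a \<Rightarrow> 'b) set" where
  "rep_hom X M N = {f \<in> module_hom cfield M N. f \<in> extensional (carrier M) \<and>
     (\<forall>x \<in> X. \<forall>v \<in> carrier M. f (act M x v) = act N x (f v))}"

definition rep_iso :: "'x set \<Rightarrow> ('x, 'a) rep \<Rightarrow> ('x, 'b) rep \<Rightarrow> ('a \<Rightarrow> 'b) set" where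
  "rep_iso X M N = {f \<in> rep_hom X M N. bij_betw f (carrier M) (carrier N)}"


section \<open>The two categories\<close>

definition wh :: "nat \<Rightarrow> (complex mat, 'm) rep \<Rightarrow> 'm set" where
  "wh n M = {v \<in> carrier M. \<forall>i \<in> {1..n}. act M (mat_unit n 0 i) v = v}"

definition H1 :: "nat \<Rightarrow> (complex mat, 'm) rep set" where
  "H1 n = {M. sl_module n M \<and>
     (\<forall>i \<in> {1..n}. \<forall>v \<in> carrier M. \<exists>k.
        ((\<lambda>w. act M (mat_unit n 0 i) w \<ominus>\<^bsub>M\<^esub> w) ^^ k) v = \<zero>\<^bsub>M\<^esub>) \<and>
     vectorspace.fin_dim cfield (M\<lparr>carrier := wh n M\<rparr>)}"

definition W_mod :: "nat \<Rightarrow> 'q ring \<Rightarrow> (env \<Rightarrow> 'q) \<Rightarrow> ('q, 'm) rep set" where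
  "W_mod n Q \<phi> = {V. alg_module n Q \<phi> (W_alg n Q \<phi>) V \<and> vectorspace.fin_dim cfield V}"


section \<open>The functor F\<close>

text \<open>For \<open>M\<close> in \<open>H1 n\<close>, where every \<open>e\<^sub>0\<^sub>i\<close> acts bijectively, the \<open>Q\<close>-module structure
  extending the \<open>sl n\<close>-action exists and is unique on the carrier, so \<open>SOME\<close> involves no choice
  there.\<close>

definition loc_module ::
  "nat \<Rightarrow> 'q ring \<Rightarrow> (env \<Rightarrow> 'q) \<Rightarrow> (complex mat, 'm) rep \<Rightarrow> ('q, 'm) rep" where
  "loc_module n Q \<phi> M = with_act M (SOME \<alpha>.
     alg_module n Q \<phi> (carrier Q) (with_act M \<alpha>) \<and>
     (\<forall>x \<in> sl n. \<forall>v \<in> carrier M. \<alpha> (q_gen n \<phi> x) v = act M x v))"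

definition F_obj ::
  "nat \<Rightarrow> 'q ring \<Rightarrow> (env \<Rightarrow> 'q) \<Rightarrow> (complex mat, 'm) rep \<Rightarrow> ('q, 'm) rep" where
  "F_obj n Q \<phi> M = (loc_module n Q \<phi> M)\<lparr>carrier := wh n M\<rparr>"

definition F_mor ::
  "nat \<Rightarrow> (complex mat, 'a) rep \<Rightarrow> (complex mat, 'b) rep \<Rightarrow> ('a \<Rightarrow> 'b) \<Rightarrow> ('a \<Rightarrow> 'b)" where
  "F_mor n M N f = restrict f (wh n M)"


section \<open>The functor G\<close>

text \<open>The extension of a \<open>W_alg\<close>-module to \<open>Um_S_W\<close> on which every \<open>e\<^sub>0\<^sub>i\<close> (hence also its inverse)
  acts as the identity; again it exists and is unique on the carrier.\<close>

definition triv_ext ::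
  "nat \<Rightarrow> 'q ring \<Rightarrow> (env \<Rightarrow> 'q) \<Rightarrow> ('q, 'v) rep \<Rightarrow> ('q, 'v) rep" where
  "triv_ext n Q \<phi> V = with_act V (SOME \<beta>.
     alg_module n Q \<phi> (Um_S_W n Q \<phi>) (with_act V \<beta>) \<and>
     (\<forall>w \<in> W_alg n Q \<phi>. \<forall>v \<in> carrier V. \<beta> w v = act V w v) \<and>
     (\<forall>i \<in> {1..n}. \<forall>v \<in> carrier V. \<beta> (q_gen n \<phi> (mat_unit n 0 i)) v = v))"

text \<open>The tensor product \<open>Q \<otimes>\<^sub>B V\<close> of the right \<open>B\<close>-module \<open>Q\<close> and the left \<open>B\<close>-module \<open>V\<close>, as a
  quotient of the free abelian group on \<open>carrier Q \<times> carrier V\<close>.\<close>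

definition tensor_free :: "'q ring \<Rightarrow> ('q, 'v) rep \<Rightarrow> ('q \<times> 'v \<Rightarrow>\<^sub>0 int) monoid" where
  "tensor_free Q V = free_Abelian_group (carrier Q \<times> carrier V)"

definition tensor_relations ::
  "'q ring \<Rightarrow> 'q set \<Rightarrow> ('q, 'v) rep \<Rightarrow> ('q \<times> 'v \<Rightarrow>\<^sub>0 int) set" where
  "tensor_relations Q B V =
     {frag_of (a \<oplus>\<^bsub>Q\<^esub> b, v) - (frag_of (a, v) + frag_of (b, v)) | a b v.
        a \<in> carrier Q \<and> b \<in> carrier Q \<and> v \<in> carrier V} \<union>
     {frag_of (a, v \<oplus>\<^bsub>V\<^esub> w) - (frag_of (a, v) + frag_of (a, w)) | a v w.
        a \<in> carrier Q \<and> v \<in> carrier V \<and> w \<in> carrier V} \<union>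
     {frag_of (a \<otimes>\<^bsub>Q\<^esub> b, v) - frag_of (a, act V b v) | a b v.
        a \<in> carrier Q \<and> b \<in> B \<and> v \<in> carrier V}"

definition tensor_null ::
  "'q ring \<Rightarrow> 'q set \<Rightarrow> ('q, 'v) rep \<Rightarrow> ('q \<times> 'v \<Rightarrow>\<^sub>0 int) set" where
  "tensor_null Q B V = generate (tensor_free Q V) (tensor_relations Q B V)"

definition tensor_class ::
  "'q ring \<Rightarrow> 'q set \<Rightarrow> ('q, 'v) rep \<Rightarrow> ('q \<times> 'v \<Rightarrow>\<^sub>0 int) \<Rightarrow> ('q \<times> 'v \<Rightarrow>\<^sub>0 int) set" where
  "tensor_class Q B V z = tensor_null Q B V #>\<^bsub>tensor_free Q V\<^esub> z"

text \<open>\<open>a \<cdot> (b \<otimes> v) = ab \<otimes> v\<close>. On a coset, all members of the union are the same coset.\<close>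

definition tensor_lmult ::
  "'q ring \<Rightarrow> 'q set \<Rightarrow> ('q, 'v) rep \<Rightarrow> 'q
     \<Rightarrow> ('q \<times> 'v \<Rightarrow>\<^sub>0 int) set \<Rightarrow> ('q \<times> 'v \<Rightarrow>\<^sub>0 int) set" where
  "tensor_lmult Q B V a X =
     (\<Union>z \<in> X. tensor_class Q B V (frag_extend (\<lambda>(b, v). frag_of (a \<otimes>\<^bsub>Q\<^esub> b, v)) z))"

definition tensor ::
  "nat \<Rightarrow> 'q ring \<Rightarrow> (env \<Rightarrow> 'q) \<Rightarrow> 'q set \<Rightarrow> ('q, 'v) rep
     \<Rightarrow> ('q, ('q \<times> 'v \<Rightarrow>\<^sub>0 int) set) rep" where
  "tensor n Q \<phi> B V =
     \<lparr>carrier = carrier (tensor_free Q V Mod tensor_null Q B V),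
      monoid.mult = undefined, one = undefined,
      ring.zero = \<one>\<^bsub>tensor_free Q V Mod tensor_null Q B V\<^esub>,
      add = monoid.mult (tensor_free Q V Mod tensor_null Q B V),
      smult = (\<lambda>c. tensor_lmult Q B V (q_const n \<phi> c)),
      act = tensor_lmult Q B V\<rparr>"

definition G_obj ::
  "nat \<Rightarrow> 'q ring \<Rightarrow> (env \<Rightarrow> 'q) \<Rightarrow> ('q, 'v) rep
     \<Rightarrow> (complex mat, ('q \<times> 'v \<Rightarrow>\<^sub>0 int) set) rep" where
  "G_obj n Q \<phi> V =
     (let T = tensor n Q \<phi> (Um_S_W n Q \<phi>) (triv_ext n Q \<phi> V)
      in with_act T (\<lambda>x. act T (q_gen n \<phi> x)))"

definition G_mor ::
  "nat \<Rightarrow> 'q ring \<Rightarrow> (env \<Rightarrow> 'q) \<Rightarrow> ('q, 'v) rep \<Rightarrow> ('q, 'w) rep \<Rightarrow> ('v \<Rightarrow> 'w)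
     \<Rightarrow> (('q \<times> 'v \<Rightarrow>\<^sub>0 int) set \<Rightarrow> ('q \<times> 'w \<Rightarrow>\<^sub>0 int) set)" where
  "G_mor n Q \<phi> V V' f =
     (\<lambda>X \<in> carrier (G_obj n Q \<phi> V).
        \<Union>z \<in> X. tensor_class Q (Um_S_W n Q \<phi>) (triv_ext n Q \<phi> V')
          (frag_extend (\<lambda>(b, v). frag_of (b, f v)) z))"


section \<open>Functors, natural isomorphisms and equivalences\<close>

text \<open>A set \<open>C\<close> of representations over the index set \<open>X\<close> is regarded as a full subcategory, with
  morphisms \<open>rep_hom X\<close>.\<close>

definition is_functor ::
  "'x set \<Rightarrow> ('x, 'a) rep set \<Rightarrow> 'y set \<Rightarrow> ('y, 'b) rep set
     \<Rightarrow> (('x, 'a) rep \<Rightarrow> ('y, 'b) rep)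
     \<Rightarrow> (('x, 'a) rep \<Rightarrow> ('x, 'a) rep \<Rightarrow> ('a \<Rightarrow> 'a) \<Rightarrow> ('b \<Rightarrow> 'b)) \<Rightarrow> bool" where
  "is_functor X C Y D Fo Fm \<longleftrightarrow>
     (\<forall>M \<in> C. Fo M \<in> D) \<and>
     (\<forall>M \<in> C. \<forall>N \<in> C. \<forall>f \<in> rep_hom X M N. Fm M N f \<in> rep_hom Y (Fo M) (Fo N)) \<and>
     (\<forall>M \<in> C. Fm M M (\<lambda>v \<in> carrier M. v) = (\<lambda>v \<in> carrier (Fo M). v)) \<and>
     (\<forall>L \<in> C. \<forall>M \<in> C. \<forall>N \<in> C. \<forall>f \<in> rep_hom X L M. \<forall>g \<in> rep_hom X M N.
        Fm L N (compose (carrier L) g f) = compose (carrier (Fo L)) (Fm M N g) (Fm L M f))"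

text \<open>The two functors start at \<open>C\<close> and take values in representations over \<open>Y\<close>. Their values may
  have carriers in different types, as is the case for \<open>FG\<close> and the identity.\<close>

definition nat_iso ::
  "'x set \<Rightarrow> ('x, 'a) rep set \<Rightarrow> 'y set
     \<Rightarrow> (('x, 'a) rep \<Rightarrow> ('y, 'b) rep)
     \<Rightarrow> (('x, 'a) rep \<Rightarrow> ('x, 'a) rep \<Rightarrow> ('a \<Rightarrow> 'a) \<Rightarrow> ('b \<Rightarrow> 'b))
     \<Rightarrow> (('x, 'a) rep \<Rightarrow> ('y, 'c) rep)
     \<Rightarrow> (('x, 'a) rep \<Rightarrow> ('x, 'a) rep \<Rightarrow> ('a \<Rightarrow> 'a) \<Rightarrow> ('c \<Rightarrow> 'c)) \<Rightarrow> bool" where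
  "nat_iso X C Y Fo Fm Go Gm \<longleftrightarrow>
     (\<exists>\<eta>. (\<forall>M \<in> C. \<eta> M \<in> rep_iso Y (Fo M) (Go M)) \<and>
          (\<forall>M \<in> C. \<forall>N \<in> C. \<forall>f \<in> rep_hom X M N.
             compose (carrier (Fo M)) (\<eta> N) (Fm M N f) =
             compose (carrier (Fo M)) (Gm M N f) (\<eta> M)))"

text \<open>For carriers in an arbitrary type. Every module in \<open>H1 n\<close> has countable dimension, so a type
  with at least continuum many elements already carries isomorphic copies of all objects of
  \<open>H1 n\<close> and \<open>W_mod n Q \<phi>\<close>, and a smaller type carries only zero modules.\<close>

definition equivalent_categories ::
  "'x set \<Rightarrow> ('x, 'a) rep set \<Rightarrow> 'y set \<Rightarrow> ('y, 'b) rep set \<Rightarrow> bool" where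
  "equivalent_categories X C Y D \<longleftrightarrow>
     (\<exists>Fo Fm Go Gm.
        is_functor X C Y D Fo Fm \<and> is_functor Y D X C Go Gm \<and>
        nat_iso Y D Y (\<lambda>V. Fo (Go V)) (\<lambda>V V' f. Fm (Go V) (Go V') (Gm V V' f))
          (\<lambda>V. V) (\<lambda>V V' f. f) \<and>
        nat_iso X C X (\<lambda>M. Go (Fo M)) (\<lambda>M N f. Gm (Fo M) (Fo N) (Fm M N f))
          (\<lambda>M. M) (\<lambda>M N f. f))"

end

theory Submission
  imports Defs
begin

text \<open>
  Let \<open>t\<^sub>i\<close> be the image of \<open>e\<^sub>0\<^sub>i\<close> in the localization \<open>Q\<close>, and let \<open>h\<^sub>i\<close> be that of the traceless part of \<open>e\<^sub>i\<^sub>i\<close>.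
  Then \<open>t\<^sub>i h\<^sub>j t\<^sub>i\<^sup>-\<^sup>1 = h\<^sub>j + \<delta>\<^sub>i\<^sub>j\<close>: the \<open>t\<^sub>i\<close> shift the variables \<open>h\<^sub>i\<close>. Suppose that commuting operators \<open>T\<^sub>i\<close>
  and \<open>H\<^sub>i\<close> on a complex vector space satisfy these relations and that all \<open>T\<^sub>i - 1\<close> are locally
  nilpotent (the locale \<open>shift_ops\<close>). The \<open>T\<^sub>i - 1\<close> then work as difference operators, and the space consists of
  polynomials in the \<open>H\<^sub>i\<close> with coefficients in the invariants of the \<open>T\<^sub>i\<close>. Four consequences carry the
  proof: a subspace that is stable under the \<open>H\<^sub>i\<close> and contains the invariants is everything
  (\<open>inv_generates\<close>); the whole space is the sum of the invariants and the ranges of the \<open>H\<^sub>i\<close>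
  (\<open>inv_plus_H_span\<close>); this sum is direct (\<open>inv_inter_H_span\<close>); and a nonzero subspace that is
  stable under the \<open>T\<^sub>i\<close> contains a nonzero invariant vector (\<open>inv_meets\<close>). They are applied to three spaces.

  The first is \<open>Q\<close> itself, with conjugation by \<open>t\<^sub>i\<close> and left multiplication by \<open>h\<^sub>i\<close>. Conjugation is
  locally unipotent because \<open>ad e\<^sub>0\<^sub>i\<close> is nilpotent on the Lie algebra. So \<open>Q\<close> is the direct sum of the
  centralizer \<open>C\<close> of the \<open>t\<^sub>i\<close> and \<open>\<Sum> h\<^sub>i Q\<close>, and taking the constant term is a right \<open>C\<close>-linear retraction
  of \<open>Q\<close> onto \<open>C\<close>. Decomposing \<open>C\<close> into weight spaces of the Cartan subalgebra shows that it is the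
  direct sum of the \<open>t\<^sup>m W\<close>, where \<open>m\<close> runs over the integral exponents. Hence \<open>C\<close> is the subalgebra
  from which \<open>G\<close> induces (\<open>Um_S_W_eq\<close>), and it has an augmentation \<open>aug\<close> onto \<open>W\<close> that sends the \<open>t\<^sub>i\<close> to \<open>1\<close>;
  this makes every \<open>W\<close>-module a \<open>C\<close>-module with trivial action of the \<open>t\<^sub>i\<close>.

  The second space is \<open>G V\<close>. Here \<open>t\<^sub>i\<close> acts by conjugation on the left tensor factor. The constant term
  shows that \<open>v \<mapsto> 1 \<otimes> v\<close> is injective, and the invariants are exactly the vectors
  \<open>1 \<otimes> v\<close> (\<open>whit_T\<close>). So \<open>F (G V)\<close> is a copy of \<open>V\<close>, and \<open>G V\<close> lies in \<open>H1 n\<close>.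

  The third is a module \<open>M\<close> in \<open>H1 n\<close>, on which the \<open>t\<^sub>i\<close> are bijective because they are locally unipotent,
  so that the localization acts (\<open>ex_loc_action\<close>). The map \<open>q \<otimes> v \<mapsto> q v\<close> from \<open>G (F M)\<close> to \<open>M\<close> is surjective
  since \<open>M\<close> is generated by its Whittaker vectors, and injective since its kernel would
  otherwise contain a Whittaker vector \<open>1 \<otimes> v\<close> with \<open>v \<noteq> 0\<close>.

  For the equivalence on one carrier type, \<open>G V\<close> is transported to the type of \<open>V\<close>, which is large
  enough because a nonzero complex space is infinite (\<open>induced_module_embeds\<close>).
\<close>

section \<open>Complex vector spaces and commuting shift operators\<close>

lemma vectorspace_smult_simps:
  assumes "vectorspace cfield M"
  shows "v \<in> carrier M \<Longrightarrow> c \<odot>\<^bsub>M\<^esub> v \<in> carrier M"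
    and "v \<in> carrier M \<Longrightarrow> (c + d) \<odot>\<^bsub>M\<^esub> v = c \<odot>\<^bsub>M\<^esub> v \<oplus>\<^bsub>M\<^esub> d \<odot>\<^bsub>M\<^esub> v"
    and "v \<in> carrier M \<Longrightarrow> w \<in> carrier M \<Longrightarrow> c \<odot>\<^bsub>M\<^esub> (v \<oplus>\<^bsub>M\<^esub> w) = c \<odot>\<^bsub>M\<^esub> v \<oplus>\<^bsub>M\<^esub> c \<odot>\<^bsub>M\<^esub> w"
    and "v \<in> carrier M \<Longrightarrow> (c * d) \<odot>\<^bsub>M\<^esub> v = c \<odot>\<^bsub>M\<^esub> (d \<odot>\<^bsub>M\<^esub> v)"
    and "v \<in> carrier M \<Longrightarrow> 1 \<odot>\<^bsub>M\<^esub> v = v"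
    and "v \<in> carrier M \<Longrightarrow> 0 \<odot>\<^bsub>M\<^esub> v = \<zero>\<^bsub>M\<^esub>"
    and "c \<odot>\<^bsub>M\<^esub> \<zero>\<^bsub>M\<^esub> = \<zero>\<^bsub>M\<^esub>"
    and "v \<in> carrier M \<Longrightarrow> (- c) \<odot>\<^bsub>M\<^esub> v = \<ominus>\<^bsub>M\<^esub> (c \<odot>\<^bsub>M\<^esub> v)"
proof -
  interpret vectorspace cfield M by fact
  show "v \<in> carrier M \<Longrightarrow> c \<odot>\<^bsub>M\<^esub> v \<in> carrier M"
    using smult_closed[of c v] by simp
  show "v \<in> carrier M \<Longrightarrow> (c + d) \<odot>\<^bsub>M\<^esub> v = c \<odot>\<^bsub>M\<^esub> v \<oplus>\<^bsub>M\<^esub> d \<odot>\<^bsub>M\<^esub> v"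
    using smult_l_distr[of c d v] by simp
  show "v \<in> carrier M \<Longrightarrow> w \<in> carrier M \<Longrightarrow> c \<odot>\<^bsub>M\<^esub> (v \<oplus>\<^bsub>M\<^esub> w) = c \<odot>\<^bsub>M\<^esub> v \<oplus>\<^bsub>M\<^esub> c \<odot>\<^bsub>M\<^esub> w"
    using smult_r_distr[of c v w] by simp
  show "v \<in> carrier M \<Longrightarrow> (c * d) \<odot>\<^bsub>M\<^esub> v = c \<odot>\<^bsub>M\<^esub> (d \<odot>\<^bsub>M\<^esub> v)"
    using smult_assoc1[of c d v] by simp
  show "v \<in> carrier M \<Longrightarrow> 1 \<odot>\<^bsub>M\<^esub> v = v"
    using smult_one[of v] by simp
  show z: "v \<in> carrier M \<Longrightarrow> 0 \<odot>\<^bsub>M\<^esub> v = \<zero>\<^bsub>M\<^esub>" for v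
    using smult_l_null[of v] by simp
  show "c \<odot>\<^bsub>M\<^esub> \<zero>\<^bsub>M\<^esub> = \<zero>\<^bsub>M\<^esub>"
    using smult_r_null[of c] by simp
  show "v \<in> carrier M \<Longrightarrow> (- c) \<odot>\<^bsub>M\<^esub> v = \<ominus>\<^bsub>M\<^esub> (c \<odot>\<^bsub>M\<^esub> v)"
  proof -
    assume v: "v \<in> carrier M"
    have "(- c) \<odot>\<^bsub>M\<^esub> v \<oplus>\<^bsub>M\<^esub> c \<odot>\<^bsub>M\<^esub> v = \<zero>\<^bsub>M\<^esub>"
      using smult_l_distr[of "- c" c v] v z[OF v] by simp
    then show ?thesis
      using v smult_closed[of c v] smult_closed[of "- c" v] by (simp add: M.minus_equality)
  qed
qed

lemma vectorspace_abelian_group: "vectorspace cfield M \<Longrightarrow> abelian_group M"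
  by (simp add: vectorspace_def module_def)

lemma field_cfield: "field cfield"
proof -
  show ?thesis by (rule class_field.field_axioms)
qed

lemma vectorspaceI:
  fixes M :: "(complex, 'm, 'z) module_scheme"
  assumes "abelian_group M"
    and "\<And>c v. v \<in> carrier M \<Longrightarrow> c \<odot>\<^bsub>M\<^esub> v \<in> carrier M"
    and "\<And>c d v. v \<in> carrier M \<Longrightarrow> (c + d) \<odot>\<^bsub>M\<^esub> v = c \<odot>\<^bsub>M\<^esub> v \<oplus>\<^bsub>M\<^esub> d \<odot>\<^bsub>M\<^esub> v"
    and "\<And>c v w. v \<in> carrier M \<Longrightarrow> w \<in> carrier M \<Longrightarrow>
      c \<odot>\<^bsub>M\<^esub> (v \<oplus>\<^bsub>M\<^esub> w) = c \<odot>\<^bsub>M\<^esub> v \<oplus>\<^bsub>M\<^esub> c \<odot>\<^bsub>M\<^esub> w"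
    and "\<And>c d v. v \<in> carrier M \<Longrightarrow> (c * d) \<odot>\<^bsub>M\<^esub> v = c \<odot>\<^bsub>M\<^esub> (d \<odot>\<^bsub>M\<^esub> v)"
    and "\<And>v. v \<in> carrier M \<Longrightarrow> 1 \<odot>\<^bsub>M\<^esub> v = v"
  shows "vectorspace cfield M"
proof -
  have "field cfield" by (rule field_cfield)
  then have "cring cfield" by (simp add: field_def domain_def)
  then have "module cfield M"
    using assms by (intro moduleI) auto
  with \<open>field cfield\<close> show ?thesis by (simp add: vectorspace_def)
qed

lemma (in abelian_group) add_diff_cancel:
  assumes "a \<in> carrier G" "b \<in> carrier G"
  shows "(a \<oplus> b) \<ominus> a = b" "(a \<ominus> b) \<oplus> b = a" "a \<oplus> (b \<ominus> a) = b"
proof -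
  show 1: "(a \<oplus> b) \<ominus> a = b" using assms by (metis a_comm a_minus_def minus_closed r_neg2 a_inv_closed)
  show 2: "(a \<ominus> b) \<oplus> b = a" using assms by (simp add: a_minus_def a_assoc l_neg)
  show "a \<oplus> (b \<ominus> a) = b"
    using assms by (metis 1 a_minus_def a_inv_closed a_assoc)
qed

text \<open>The linear operators between two complex spaces, with the scalar ring unfolded.\<close>

lemma module_hom_iff:
  "f \<in> module_hom cfield M N \<longleftrightarrow>
    (\<forall>v \<in> carrier M. f v \<in> carrier N) \<and>
    (\<forall>v \<in> carrier M. \<forall>w \<in> carrier M. f (v \<oplus>\<^bsub>M\<^esub> w) = f v \<oplus>\<^bsub>N\<^esub> f w) \<and>
    (\<forall>c. \<forall>v \<in> carrier M. f (c \<odot>\<^bsub>M\<^esub> v) = c \<odot>\<^bsub>N\<^esub> f v)"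
  by (auto simp: module_hom_def)

locale linear_op = M: vectorspace cfield M + N: vectorspace cfield N
  for M (structure) and N (structure) +
  fixes f
  assumes hom: "f \<in> module_hom cfield M N"
begin

lemma closed [simp]: "v \<in> carrier M \<Longrightarrow> f v \<in> carrier N"
  and add: "v \<in> carrier M \<Longrightarrow> w \<in> carrier M \<Longrightarrow> f (v \<oplus>\<^bsub>M\<^esub> w) = f v \<oplus>\<^bsub>N\<^esub> f w"
  and smult: "v \<in> carrier M \<Longrightarrow> f (c \<odot>\<^bsub>M\<^esub> v) = c \<odot>\<^bsub>N\<^esub> f v"
  using hom by (auto simp: module_hom_iff)

lemma zero: "f \<zero>\<^bsub>M\<^esub> = \<zero>\<^bsub>N\<^esub>"
  using smult[of "\<zero>\<^bsub>M\<^esub>" 0] vectorspace_smult_simps(6)[OF M.vectorspace_axioms]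
    vectorspace_smult_simps(6)[OF N.vectorspace_axioms] by simp

lemma neg: "v \<in> carrier M \<Longrightarrow> f (\<ominus>\<^bsub>M\<^esub> v) = \<ominus>\<^bsub>N\<^esub> f v"
  using smult[of v "-1"] vectorspace_smult_simps(5,8)[OF M.vectorspace_axioms]
    vectorspace_smult_simps(5,8)[OF N.vectorspace_axioms] by simp

lemma diff: "v \<in> carrier M \<Longrightarrow> w \<in> carrier M \<Longrightarrow> f (v \<ominus>\<^bsub>M\<^esub> w) = f v \<ominus>\<^bsub>N\<^esub> f w"
  by (simp add: a_minus_def add neg)

end

text \<open>The model is a space of polynomials in variables \<open>i \<in> J\<close>, where \<open>H i\<close> multiplies by the
  variable \<open>i\<close> and \<open>T i\<close> shifts it by one. Then \<open>D i = T i - 1\<close> is a difference operator, and the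
  vectors invariant under all \<open>T i\<close> are the constants. The results below say that
  every instance looks like this model.\<close>

locale shift_ops = vectorspace cfield M
  for M :: "(complex, 'm, 'z) module_scheme" (structure) +
  fixes J :: "'i set" and T H :: "'i \<Rightarrow> 'm \<Rightarrow> 'm"
  assumes finite_J: "finite J"
    and T_hom: "i \<in> J \<Longrightarrow> T i \<in> module_hom cfield M M"
    and H_hom: "i \<in> J \<Longrightarrow> H i \<in> module_hom cfield M M"
    and T_T: "i \<in> J \<Longrightarrow> j \<in> J \<Longrightarrow> v \<in> carrier M \<Longrightarrow> T i (T j v) = T j (T i v)"
    and H_H: "i \<in> J \<Longrightarrow> j \<in> J \<Longrightarrow> v \<in> carrier M \<Longrightarrow> H i (H j v) = H j (H i v)"
    and T_H: "i \<in> J \<Longrightarrow> j \<in> J \<Longrightarrow> i \<noteq> j \<Longrightarrow> v \<in> carrier M \<Longrightarrow> T i (H j v) = H j (T i v)"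
    and T_H_same: "i \<in> J \<Longrightarrow> v \<in> carrier M \<Longrightarrow> T i (H i v) = H i (T i v) \<oplus> T i v"
    and nilp: "i \<in> J \<Longrightarrow> v \<in> carrier M \<Longrightarrow> \<exists>k. ((\<lambda>w. T i w \<ominus> w) ^^ k) v = \<zero>"
begin

abbreviation D :: "'i \<Rightarrow> 'm \<Rightarrow> 'm" where "D i v \<equiv> T i v \<ominus> v"

lemma T_op: "i \<in> J \<Longrightarrow> linear_op M M (T i)"
  by (simp add: linear_op_def linear_op_axioms_def vectorspace_axioms T_hom)

lemma H_op: "i \<in> J \<Longrightarrow> linear_op M M (H i)"
  by (simp add: linear_op_def linear_op_axioms_def vectorspace_axioms H_hom)

lemmas T_simps = linear_op.closed[OF T_op] linear_op.add[OF T_op] linear_op.smult[OF T_op]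
  linear_op.zero[OF T_op] linear_op.neg[OF T_op] linear_op.diff[OF T_op]
lemmas H_simps = linear_op.closed[OF H_op] linear_op.add[OF H_op] linear_op.smult[OF H_op]
  linear_op.zero[OF H_op] linear_op.neg[OF H_op] linear_op.diff[OF H_op]
lemmas sm = vectorspace_smult_simps[OF vectorspace_axioms]

lemma sm_neg: "v \<in> carrier M \<Longrightarrow> c \<odot> (\<ominus> v) = \<ominus> (c \<odot> v)"
  using sm(4)[of v c "- 1"] sm(8)[of v 1] sm(8)[of v c] sm(5)[of v] by simp

lemma D_hom: assumes "i \<in> J" shows "linear_op M M (D i)"
  unfolding linear_op_def linear_op_axioms_def module_hom_iff
  using assms
  by (auto simp: vectorspace_axioms T_simps sm sm_neg M.minus_eq M.minus_add M.a_ac)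

lemmas D_simps = linear_op.closed[OF D_hom] linear_op.add[OF D_hom] linear_op.smult[OF D_hom]
  linear_op.zero[OF D_hom] linear_op.neg[OF D_hom] linear_op.diff[OF D_hom]

lemma Dk_closed: "i \<in> J \<Longrightarrow> v \<in> carrier M \<Longrightarrow> (D i ^^ k) v \<in> carrier M"
  by (induction k) (auto simp: T_simps)

lemma Dk_hom: assumes "i \<in> J" shows "linear_op M M (D i ^^ k)"
proof (induction k)
  case 0
  then show ?case
    by (simp add: linear_op_def linear_op_axioms_def module_hom_iff vectorspace_axioms)
next
  case (Suc k)
  show ?case
    using Suc D_hom[OF assms]
    unfolding linear_op_def linear_op_axioms_def module_hom_iff by simp
qed

lemmas Dk_simps = linear_op.closed[OF Dk_hom] linear_op.add[OF Dk_hom] linear_op.smult[OF Dk_hom]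
  linear_op.zero[OF Dk_hom] linear_op.neg[OF Dk_hom] linear_op.diff[OF Dk_hom]

lemma D_eq_zero_iff: "i \<in> J \<Longrightarrow> v \<in> carrier M \<Longrightarrow> D i v = \<zero> \<longleftrightarrow> T i v = v"
  by (simp add: T_simps)

lemma D_T: "i \<in> J \<Longrightarrow> j \<in> J \<Longrightarrow> v \<in> carrier M \<Longrightarrow> D i (T j v) = T j (D i v)"
  by (simp add: T_simps T_T)

lemma D_H_same: "i \<in> J \<Longrightarrow> v \<in> carrier M \<Longrightarrow> D i (H i v) = H i (D i v) \<oplus> T i v"
  by (simp add: T_simps H_simps T_H_same M.minus_eq M.a_ac)

lemma Dk_T: "i \<in> J \<Longrightarrow> j \<in> J \<Longrightarrow> v \<in> carrier M \<Longrightarrow> (D i ^^ k) (T j v) = T j ((D i ^^ k) v)"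
  by (induction k) (simp_all add: D_T Dk_closed)


lemma Dk_D: "(D i ^^ k) (D i v) = (D i ^^ Suc k) v"
  by (simp only: funpow_Suc_right o_apply)

lemma of_nat_add_smult: "v \<in> carrier M \<Longrightarrow> of_nat (Suc k) \<odot> v = of_nat k \<odot> v \<oplus> v"
  using sm(2)[of v "of_nat k" 1] sm(5)[of v] by (simp add: add.commute)

text \<open>The discrete counterpart of the rule for the \<open>k\<close>-th derivative of a product with a variable.\<close>

lemma Dk_H_same:
  "i \<in> J \<Longrightarrow> v \<in> carrier M \<Longrightarrow>
    (D i ^^ Suc k) (H i v) = H i ((D i ^^ Suc k) v) \<oplus> of_nat (Suc k) \<odot> T i ((D i ^^ k) v)"
proof (induction k arbitrary: v)
  case 0
  then show ?case by (simp add: D_H_same T_simps H_simps sm)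
next
  case (Suc k)
  note v = \<open>v \<in> carrier M\<close> and i = \<open>i \<in> J\<close>
  have Dv: "D i v \<in> carrier M" using v i by (simp add: T_simps)
  have "(D i ^^ Suc (Suc k)) (H i v) = (D i ^^ Suc k) (H i (D i v) \<oplus> T i v)"
    using D_H_same[OF i v] by (simp only: Dk_D[symmetric])
  also have "\<dots> = (D i ^^ Suc k) (H i (D i v)) \<oplus> (D i ^^ Suc k) (T i v)"
    using i v Dv by (intro Dk_simps(2)) (simp_all add: H_simps T_simps del: funpow.simps)
  also have "(D i ^^ Suc k) (T i v) = T i ((D i ^^ Suc k) v)"
    using i v by (intro Dk_T) auto
  also have "(D i ^^ Suc k) (H i (D i v)) =
      H i ((D i ^^ Suc k) (D i v)) \<oplus> of_nat (Suc k) \<odot> T i ((D i ^^ k) (D i v))"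
    using Suc.IH[OF i Dv] .
  finally show ?case
    using i v by (simp add: Dk_D M.a_assoc H_simps T_simps Dk_closed sm(1)
        of_nat_add_smult[of _ "Suc k"] del: funpow.simps of_nat_Suc)
qed

text \<open>On a polynomial of degree \<open>k\<close> in one variable the operator \<open>H D\<close> multiplies the leading term by
  \<open>k\<close>, so subtracting \<open>H (D x) / k\<close> cancels it. The division is possible in characteristic zero.\<close>

lemma lower_degree:
  assumes i: "i \<in> J" and x: "x \<in> carrier M" and k: "k \<noteq> 0" and Dx: "(D i ^^ Suc k) x = \<zero>"
  shows "(D i ^^ k) (x \<ominus> inverse (of_nat k) \<odot> H i (D i x)) = \<zero>"
proof -
  obtain l where l: "k = Suc l" using k not0_implies_Suc by blast
  have c: "D i x \<in> carrier M" "(D i ^^ k) x \<in> carrier M" using i x by (auto simp: T_simps Dk_closed)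
  have "(D i ^^ k) (H i (D i x)) = H i ((D i ^^ Suc k) x) \<oplus> of_nat k \<odot> T i ((D i ^^ k) x)"
    using Dk_H_same[OF i c(1), of l] by (simp only: l Dk_D)
  moreover have "T i ((D i ^^ k) x) = (D i ^^ k) x"
    using Dx D_eq_zero_iff[OF i c(2)] by simp
  ultimately have "(D i ^^ k) (H i (D i x)) = of_nat k \<odot> (D i ^^ k) x"
    using Dx i c by (simp add: H_simps sm del: funpow.simps)
  then show ?thesis
    using i x c k sm(4)[of "(D i ^^ k) x" "inverse (of_nat k)" "of_nat k"]
    by (simp add: Dk_simps H_simps sm)
qed

text \<open>Multiplication by a variable raises the degree, so a constant \<open>H v\<close> forces \<open>v = 0\<close>: if \<open>D\<^sup>k\<^sup>+\<^sup>1 v = 0\<close>,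
  then \<open>Dk_H_same\<close> gives \<open>D\<^sup>k\<^sup>+\<^sup>1 (H v) = (k + 1) T (D\<^sup>k v) = (k + 1) D\<^sup>k v\<close>. The left side is
  zero, so that \<open>D\<^sup>k v = 0\<close>.\<close>

lemma ker_D_inter_range_H:
  assumes i: "i \<in> J" and v: "v \<in> carrier M" and z: "T i (H i v) = H i v"
  shows "v = \<zero>"
proof -
  have "D i (H i v) = \<zero>" using i v z by (simp add: H_simps)
  then have DH: "(D i ^^ Suc k) (H i v) = \<zero>" for k
    by (induction k) (use D_simps(4)[OF i] in auto)
  have "(D i ^^ k) v = \<zero> \<Longrightarrow> v = \<zero>" for k
  proof (induction k)
    case (Suc k)
    let ?w = "(D i ^^ k) v"
    have w: "?w \<in> carrier M" using i v by (simp add: Dk_closed)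
    have "of_nat (Suc k) \<odot> T i ?w = \<zero>"
      using Dk_H_same[OF i v, of k] DH[of k] Suc.prems i w by (simp add: H_simps T_simps sm del: funpow.simps of_nat_Suc)
    moreover have "T i ?w = ?w" using Suc.prems D_eq_zero_iff[OF i w] by simp
    ultimately have "inverse (of_nat (Suc k)) \<odot> (of_nat (Suc k) \<odot> ?w) = \<zero>"
      by (simp add: sm(7) del: of_nat_Suc)
    then have "?w = \<zero>"
      using sm(4)[OF w, of "inverse (of_nat (Suc k))" "of_nat (Suc k)"] sm(5)[OF w]
      by (simp del: of_nat_Suc)
    then show ?case by (rule Suc.IH)
  qed simp
  then show ?thesis using nilp[OF i v] by blast
qed

definition inv_on :: "'i set \<Rightarrow> 'm set" where
  "inv_on I = {v \<in> carrier M. \<forall>i \<in> I. T i v = v}"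

lemma inv_on_H: "I \<subseteq> J \<Longrightarrow> j \<in> J \<Longrightarrow> j \<notin> I \<Longrightarrow> v \<in> inv_on I \<Longrightarrow> H j v \<in> inv_on I"
  unfolding inv_on_def by (auto simp: H_simps) (metis T_H subsetD)

lemma inv_on_D:
  assumes "I \<subseteq> J" "j \<in> J" "v \<in> inv_on I"
  shows "D j v \<in> inv_on I"
proof -
  have v: "v \<in> carrier M" "\<And>i. i \<in> I \<Longrightarrow> T i v = v" using assms(3) by (auto simp: inv_on_def)
  have "T i (D j v) = D j v" if "i \<in> I" for i
    using D_T[of j i v] v that assms(1,2) by auto
  then show ?thesis using v assms(2) by (simp add: inv_on_def D_simps(1))
qed

text \<open>Peeling off the variables one at a time, \<open>lower_degree\<close> writes every vector as a polynomial
  in the operators \<open>H i\<close> applied to invariant vectors.\<close>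

theorem inv_generates:
  assumes N: "inv_on J \<subseteq> N" "N \<subseteq> carrier M"
    and add: "\<And>v w. v \<in> N \<Longrightarrow> w \<in> N \<Longrightarrow> v \<oplus> w \<in> N"
    and smult: "\<And>c v. v \<in> N \<Longrightarrow> c \<odot> v \<in> N"
    and H: "\<And>i v. i \<in> J \<Longrightarrow> v \<in> N \<Longrightarrow> H i v \<in> N"
  shows "carrier M \<subseteq> N"
proof -
  have "finite I \<Longrightarrow> I \<subseteq> J \<Longrightarrow> inv_on (J - I) \<subseteq> N" for I
  proof (induction rule: finite_induct)
    case empty
    then show ?case using N by simp
  next
    case (insert j I)
    let ?K = "inv_on (J - insert j I)"
    have j: "j \<in> J" and KJ: "J - insert j I \<subseteq> J" using insert by auto
    have step: "x \<in> ?K \<Longrightarrow> (D j ^^ Suc k) x = \<zero> \<Longrightarrow> x \<in> N" for k x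
    proof (induction k arbitrary: x)
      case 0
      then have "T j x = x" using j by (auto simp: inv_on_def T_simps)
      with 0(1) have "x \<in> inv_on (J - I)" by (auto simp: inv_on_def)
      then show ?case using insert by auto
    next
      case (Suc k)
      have x: "x \<in> carrier M" using Suc.prems by (simp add: inv_on_def)
      let ?y = "inverse (of_nat (Suc k)) \<odot> H j (D j x)"
      have Dx: "D j x \<in> ?K" using inv_on_D[OF KJ j Suc.prems(1)] .
      have "D j x \<in> N"
        using Suc.IH[OF Dx] Suc.prems(2) by (simp only: Dk_D)
      then have yN: "?y \<in> N" using H j smult by blast
      have HK: "H j (D j x) \<in> ?K" using inv_on_H[OF KJ j _ Dx] by simp
      then have yK: "?y \<in> ?K" using KJ by (auto simp: inv_on_def sm T_simps subset_iff simp del: of_nat_Suc)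
      have xy: "x \<ominus> ?y \<in> ?K"
        using Suc.prems(1) yK KJ by (auto simp: inv_on_def T_simps subset_iff simp del: of_nat_Suc)
      have "(D j ^^ Suc k) (x \<ominus> ?y) = \<zero>"
        using lower_degree[OF j x _ Suc.prems(2)] by (simp only: nat.distinct not_False_eq_True)
      then have "x \<ominus> ?y \<in> N" using Suc.IH[OF xy] by simp
      from add[OF this yN] show ?case
        using x yN N by (simp add: M.minus_eq M.a_assoc M.l_neg subset_iff del: of_nat_Suc)
    qed
    show ?case
    proof
      fix x assume xK: "x \<in> ?K"
      then obtain k where "(D j ^^ k) x = \<zero>" using nilp[OF j] by (auto simp: inv_on_def)
      then have "(D j ^^ Suc k) x = \<zero>" using D_simps(4)[OF j] by simp
      then show "x \<in> N" using step xK by blast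
    qed
  qed
  from this[OF finite_J] show ?thesis by (auto simp: inv_on_def)
qed

text \<open>Applying the difference operators to a nonzero vector as long as the result is nonzero ends in a
  nonzero invariant vector.\<close>

lemma inv_meets:
  assumes K: "K \<subseteq> carrier M" "\<And>i v. i \<in> J \<Longrightarrow> v \<in> K \<Longrightarrow> D i v \<in> K"
    and inv: "K \<inter> inv_on J \<subseteq> {\<zero>}"
  shows "K \<subseteq> {\<zero>}"
proof -
  have "finite I \<Longrightarrow> I \<subseteq> J \<Longrightarrow> K \<inter> inv_on (J - I) \<subseteq> {\<zero>}" for I
  proof (induction rule: finite_induct)
    case empty
    then show ?case using inv by simp
  next
    case (insert j I)
    let ?K = "K \<inter> inv_on (J - insert j I)"
    have j: "j \<in> J" and KJ: "J - insert j I \<subseteq> J" using insert by auto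
    have step: "x \<in> ?K \<Longrightarrow> (D j ^^ k) x = \<zero> \<Longrightarrow> x = \<zero>" for k x
    proof (induction k arbitrary: x)
      case (Suc k)
      have "D j x \<in> ?K" using Suc.prems(1) K(2)[OF j] inv_on_D[OF KJ j] by blast
      then have "D j x = \<zero>" using Suc by (simp only: Dk_D)
      then have "T j x = x" using j Suc.prems(1) by (auto simp: inv_on_def T_simps)
      then have "x \<in> K \<inter> inv_on (J - I)" using Suc.prems(1) by (auto simp: inv_on_def)
      then show ?case using insert by auto
    qed simp
    show ?case
    proof
      fix x assume xK: "x \<in> ?K"
      then obtain k where "(D j ^^ k) x = \<zero>" using nilp[OF j] by (auto simp: inv_on_def)
      then show "x \<in> {\<zero>}" using step xK by blast
    qed
  qed
  from this[OF finite_J] show ?thesis using K(1) by (auto simp: inv_on_def)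
qed

text \<open>The finite sums of vectors \<open>H i y\<close> with \<open>i \<in> I\<close>, in a form that is suited to induction.\<close>

inductive_set H_span :: "'i set \<Rightarrow> 'm set" for I where
  zero: "\<zero> \<in> H_span I"
| step: "i \<in> I \<Longrightarrow> y \<in> carrier M \<Longrightarrow> s \<in> H_span I \<Longrightarrow> H i y \<oplus> s \<in> H_span I"

lemma H_span_closed: "s \<in> H_span I \<Longrightarrow> I \<subseteq> J \<Longrightarrow> s \<in> carrier M"
  by (induction rule: H_span.induct) (auto simp: H_simps)

lemma H_span_add:
  "s \<in> H_span I \<Longrightarrow> I \<subseteq> J \<Longrightarrow> r \<in> H_span I \<Longrightarrow> s \<oplus> r \<in> H_span I"
proof (induction rule: H_span.induct)
  case zero
  then show ?case by (simp add: H_span_closed)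
next
  case (step i y s)
  have "(H i y \<oplus> s) \<oplus> r = H i y \<oplus> (s \<oplus> r)"
    using step H_span_closed by (auto simp: M.a_assoc H_simps subset_iff)
  then show ?case using step by (simp add: H_span.step)
qed

lemma H_span_hom:
  assumes f: "linear_op M M f" and fH: "\<And>i v. i \<in> I \<Longrightarrow> v \<in> carrier M \<Longrightarrow> f (H i v) = H i (f v)"
    and I: "I \<subseteq> J" and s: "s \<in> H_span I"
  shows "f s \<in> H_span I"
  using s
proof (induction rule: H_span.induct)
  case zero
  then show ?case by (simp add: linear_op.zero[OF f] H_span.zero)
next
  case (step i y s)
  have "f (H i y \<oplus> s) = H i (f y) \<oplus> f s"
    using step I H_span_closed[OF step(3) I]
    by (auto simp: linear_op.add[OF f] H_simps fH)
  then show ?case using step by (simp add: H_span.step linear_op.closed[OF f])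
qed

text \<open>A polynomial is its constant term plus multiples of the variables: the right-hand sides are
  stable under the \<open>H i\<close> and contain the invariants, so \<open>inv_generates\<close> applies.\<close>

theorem inv_plus_H_span:
  assumes "x \<in> carrier M"
  shows "\<exists>a \<in> inv_on J. \<exists>s \<in> H_span J. x = a \<oplus> s"
proof -
  let ?N = "{a \<oplus> s | a s. a \<in> inv_on J \<and> s \<in> H_span J}"
  have cl: "a \<in> inv_on J \<Longrightarrow> a \<in> carrier M" "s \<in> H_span J \<Longrightarrow> s \<in> carrier M" for a s
    by (auto simp: inv_on_def H_span_closed)
  have "carrier M \<subseteq> ?N"
  proof (rule inv_generates)
    show "inv_on J \<subseteq> ?N"
    proof
      fix a assume "a \<in> inv_on J"
      then have "a = a \<oplus> \<zero>" "a \<in> inv_on J" by (auto simp: cl)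
      then show "a \<in> ?N" using H_span.zero by blast
    qed
    show "?N \<subseteq> carrier M" by (auto simp: cl)
  next
    fix v w assume "v \<in> ?N" "w \<in> ?N"
    then obtain a s b r where *: "v = a \<oplus> s" "w = b \<oplus> r" "a \<in> inv_on J" "b \<in> inv_on J"
      "s \<in> H_span J" "r \<in> H_span J" by blast
    have "a \<oplus> b \<in> inv_on J" using * by (auto simp: inv_on_def T_simps)
    moreover have "v \<oplus> w = (a \<oplus> b) \<oplus> (s \<oplus> r)" using * by (simp add: cl M.a_ac)
    ultimately show "v \<oplus> w \<in> ?N" using * H_span_add by blast
  next
    fix c v assume "v \<in> ?N"
    then obtain a s where *: "v = a \<oplus> s" "a \<in> inv_on J" "s \<in> H_span J" by blast
    have "c \<odot> a \<in> inv_on J" using * by (auto simp: inv_on_def T_simps sm)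
    moreover have "linear_op M M (\<lambda>v. c \<odot> v)"
      unfolding linear_op_def linear_op_axioms_def module_hom_iff
      by (auto simp: vectorspace_axioms sm) (metis mult.commute sm(4))
    then have "c \<odot> s \<in> H_span J"
      by (rule H_span_hom) (use * in \<open>auto simp: H_simps\<close>)
    moreover have "c \<odot> v = c \<odot> a \<oplus> c \<odot> s" using * by (simp add: cl sm)
    ultimately show "c \<odot> v \<in> ?N" by blast
  next
    fix i v assume i: "i \<in> J" and "v \<in> ?N"
    then obtain a s where *: "v = a \<oplus> s" "a \<in> inv_on J" "s \<in> H_span J" by blast
    have "v \<in> carrier M" using * by (simp add: cl)
    then have "H i v \<oplus> \<zero> \<in> H_span J" using i by (intro H_span.intros)
    moreover have "\<zero> \<in> inv_on J" by (auto simp: inv_on_def T_simps)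
    moreover have "H i v = \<zero> \<oplus> (H i v \<oplus> \<zero>)" using \<open>v \<in> carrier M\<close> i by (simp add: H_simps)
    ultimately show "H i v \<in> ?N" by blast
  qed
  then show ?thesis using assms by blast
qed

text \<open>One variable \<open>j\<close> is removed from a sum \<open>\<Sum> H i y\<^sub>i\<close> by splitting every coefficient into a
  \<open>T j\<close>-invariant part and a part in the range of \<open>H j\<close>.\<close>

lemma H_span_split:
  assumes s: "s \<in> H_span (insert j I)" and I: "insert j I \<subseteq> J" and j: "j \<notin> I"
  shows "\<exists>a \<in> H_span I \<inter> inv_on {j}. \<exists>b \<in> carrier M. s = a \<oplus> H j b"
proof -
  \<comment> \<open>The same operators with \<open>j\<close> as the only variable.\<close>
  interpret one: shift_ops M "{j}" T H
  proof (unfold_locales, goal_cases)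
    case 1 show ?case by simp
  next
    case (2 i) then show ?case using I T_hom by simp
  next
    case (3 i) then show ?case using I H_hom by simp
  next
    case (4 i k v) then show ?case by simp
  next
    case (5 i k v) then show ?case by simp
  next
    case (6 i k v) then show ?case by simp
  next
    case (7 i v) then show ?case using I T_H_same by simp
  next
    case (8 i v) then show ?case using I nilp by simp
  qed
  have jJ: "j \<in> J" using I by simp
  have split1: "\<exists>a \<in> inv_on {j}. \<exists>b \<in> carrier M. y = a \<oplus> H j b" if y: "y \<in> carrier M" for y
  proof -
    have range1: "s \<in> one.H_span {j} \<Longrightarrow> \<exists>b \<in> carrier M. s = H j b" for s
    proof (induction rule: one.H_span.induct)
      case zero
      show ?case using H_simps(4)[OF jJ] by (metis M.zero_closed)
    next
      case (step i y s)
      then obtain b where "b \<in> carrier M" "s = H j b" by blast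
      then have "H i y \<oplus> s = H j (y \<oplus> b)" "y \<oplus> b \<in> carrier M" using step jJ by (auto simp: H_simps)
      then show ?case by blast
    qed
    obtain a s where "a \<in> inv_on {j}" "s \<in> one.H_span {j}" "y = a \<oplus> s"
      using one.inv_plus_H_span[OF y] by (auto simp: one.inv_on_def inv_on_def)
    then show ?thesis using range1[of s] by blast
  qed
  have lin: "linear_op M M (H j)" using H_op jJ .
  show ?thesis using s
  proof (induction rule: H_span.induct)
    case zero
    have "\<zero> = \<zero> \<oplus> H j \<zero>" using jJ by (simp add: H_simps)
    moreover have "\<zero> \<in> H_span I \<inter> inv_on {j}" using jJ by (auto simp: inv_on_def T_simps H_span.zero)
    ultimately show ?case by (meson M.zero_closed)
  next
    case (step i y s)
    then obtain a b where ab: "a \<in> H_span I" "a \<in> inv_on {j}" "b \<in> carrier M" "s = a \<oplus> H j b"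
      by blast
    have a: "a \<in> carrier M" using ab by (simp add: inv_on_def)
    show ?case
    proof (cases "i = j")
      case True
      have "H i y \<oplus> s = a \<oplus> H j (y \<oplus> b)"
        using True a ab step jJ by (simp add: H_simps M.a_ac)
      then show ?thesis using ab step by (metis IntI M.a_closed)
    next
      case False
      then have i: "i \<in> I" "i \<in> J" using step I by auto
      obtain c d where cd: "c \<in> inv_on {j}" "d \<in> carrier M" "y = c \<oplus> H j d"
        using split1[OF step(2)] by blast
      have c: "c \<in> carrier M" using cd by (simp add: inv_on_def)
      have 1: "H i c \<oplus> a \<in> H_span I" using ab i c by (intro H_span.step)
      have 2: "H i c \<oplus> a \<in> inv_on {j}"
        using ab c i jJ cd False by (auto simp: inv_on_def H_simps T_simps T_H)
      have "H i y \<oplus> s = (H i c \<oplus> a) \<oplus> H j (H i d \<oplus> b)"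
        using ab c cd i jJ a by (simp add: H_simps M.a_ac H_H[of i j])
      moreover have "H i d \<oplus> b \<in> carrier M" using ab cd i by (simp add: H_simps)
      ultimately show ?thesis using 1 2 by blast
    qed
  qed
qed

text \<open>By \<open>H_span_split\<close>, an invariant vector in \<open>H_span (insert j I)\<close> differs from an element of
  \<open>H_span I\<close> by an invariant vector in the range of \<open>H j\<close>, which is zero.\<close>

theorem inv_inter_H_span:
  assumes "x \<in> inv_on J" "x \<in> H_span J"
  shows "x = \<zero>"
proof -
  have "finite I \<Longrightarrow> I \<subseteq> J \<Longrightarrow> x \<in> H_span I \<Longrightarrow> x = \<zero>" for I
  proof (induction rule: finite_induct)
    case empty
    then show ?case by (auto elim: H_span.cases)
  next
    case (insert j I)
    have j: "j \<in> J" using insert by simp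
    obtain a b where ab: "a \<in> H_span I" "a \<in> inv_on {j}" "b \<in> carrier M" "x = a \<oplus> H j b"
      using H_span_split[OF insert.prems(2) insert.prems(1) insert.hyps(2)] by blast
    have x: "x \<in> carrier M" "T j x = x" and a: "a \<in> carrier M" "T j a = a"
      using assms(1) ab j by (auto simp: inv_on_def)
    have Hb: "H j b = x \<ominus> a" using ab a j by (simp add: H_simps M.add_diff_cancel)
    then have "T j (H j b) = H j b" using x a j by (simp add: T_simps)
    then have "b = \<zero>" using ker_D_inter_range_H[OF j ab(3)] by simp
    then have "x = a" using ab j a by (simp add: H_simps)
    then show ?case using insert ab by blast
  qed
  then show ?thesis using finite_J assms(2) by blast
qed

end

section \<open>The Lie algebra of traceless matrices\<close>

lemma mat_unit_index [simp]:
  "a < n + 1 \<Longrightarrow> b < n + 1 \<Longrightarrow> mat_unit n i j $$ (a, b) = (if a = i \<and> b = j then 1 else 0)"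
  and mat_unit_carrier [simp]: "mat_unit n i j \<in> carrier_mat (n + 1) (n + 1)"
  by (simp_all add: mat_unit_def)

lemmas mat_unit_Suc [simp] = mat_unit_index[unfolded Suc_eq_plus1[symmetric]]
  mat_unit_carrier[unfolded Suc_eq_plus1[symmetric]]

lemma mat_unit_dim [simp]: "dim_row (mat_unit n i j) = Suc n" "dim_col (mat_unit n i j) = Suc n"
  by (simp_all add: mat_unit_def)

lemma sl_carrier: "x \<in> sl n \<Longrightarrow> x \<in> carrier_mat (n + 1) (n + 1)"
  by (simp add: sl_def)

lemma sl_add: "x \<in> sl n \<Longrightarrow> y \<in> sl n \<Longrightarrow> x + y \<in> sl n"
  by (auto simp: sl_def sum.distrib simp del: sum.lessThan_Suc)

lemma sl_smult: "x \<in> sl n \<Longrightarrow> c \<cdot>\<^sub>m x \<in> sl n"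
  by (auto simp: sl_def simp flip: sum_distrib_left simp del: sum.lessThan_Suc)

lemma mat_mult_index:
  assumes "x \<in> carrier_mat (n + 1) (n + 1)" "y \<in> carrier_mat (n + 1) (n + 1)" "a < n + 1" "b < n + 1"
  shows "(x * y) $$ (a, b) = (\<Sum>k<n + 1. x $$ (a, k) * y $$ (k, b))"
  using assms by (auto simp: scalar_prod_def atLeast0LessThan)

lemma lie_bracket_carrier:
  "x \<in> carrier_mat (n + 1) (n + 1) \<Longrightarrow> y \<in> carrier_mat (n + 1) (n + 1) \<Longrightarrow>
    lie_bracket x y \<in> carrier_mat (n + 1) (n + 1)"
  unfolding lie_bracket_def by (rule minus_carrier_mat, rule mult_carrier_mat)

lemma sl_bracket:
  assumes "x \<in> sl n" "y \<in> sl n"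
  shows "lie_bracket x y \<in> sl n"
proof -
  note c = assms[THEN sl_carrier]
  have "(\<Sum>i<n + 1. lie_bracket x y $$ (i, i)) =
      (\<Sum>i<n + 1. (\<Sum>k<n + 1. x $$ (i, k) * y $$ (k, i)) - (\<Sum>k<n + 1. y $$ (i, k) * x $$ (k, i)))"
    using c by (intro sum.cong refl) (simp add: lie_bracket_def mat_mult_index[where n = n] del: index_mult_mat(1))
  also have "\<dots> = 0"
    unfolding sum_subtractf
    by (subst (2) sum.swap) (simp add: mult.commute)
  finally show ?thesis using lie_bracket_carrier[OF c] by (simp add: sl_def)
qed

lemma mat_unit_sl: "i \<le> n \<Longrightarrow> j \<le> n \<Longrightarrow> i \<noteq> j \<Longrightarrow> mat_unit n i j \<in> sl n"
  by (auto simp: sl_def intro!: sum.neutral)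

lemma cartan_sl: "x \<in> cartan n \<Longrightarrow> x \<in> sl n"
  by (simp add: cartan_def)

lemma cartan_index: "x \<in> cartan n \<Longrightarrow> a < n + 1 \<Longrightarrow> b < n + 1 \<Longrightarrow> a \<noteq> b \<Longrightarrow> x $$ (a, b) = 0"
  by (auto simp: cartan_def sl_def diagonal_mat_def)

lemma m_sub_sl: "x \<in> m_sub n \<Longrightarrow> x \<in> sl n"
  unfolding m_sub_def sl_def by (force intro!: sum.neutral)

lemma mat_unit_m_sub: "j \<in> {1..n} \<Longrightarrow> mat_unit n 0 j \<in> m_sub n"
  by (auto simp: m_sub_def split: if_splits)

text \<open>The traceless part of \<open>e\<^sub>i\<^sub>i\<close>. It has bracket \<open>- e\<^sub>0\<^sub>i\<close> with \<open>e\<^sub>0\<^sub>i\<close> and commutes with the other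
  \<open>e\<^sub>0\<^sub>j\<close>, which makes it the variable on which \<open>e\<^sub>0\<^sub>i\<close> acts as a shift.\<close>

definition cartan_dual :: "nat \<Rightarrow> nat \<Rightarrow> complex mat" where
  "cartan_dual n i = mat (n + 1) (n + 1)
    (\<lambda>(a, b). if a = b then (if a = i then 1 else 0) - 1 / of_nat (n + 1) else 0)"

lemma cartan_dual_index:
  "a < n + 1 \<Longrightarrow> cartan_dual n i $$ (a, a) = (if a = i then 1 else 0) - 1 / of_nat (n + 1)"
  by (simp add: cartan_dual_def)

lemma cartan_dual_cartan: assumes "i \<le> n" shows "cartan_dual n i \<in> cartan n"
proof -
  have "(\<Sum>a<n + 1. (if a = i then 1 else 0) - 1 / of_nat (n + 1)) = (0 :: complex)"
    unfolding sum_subtractf using assms by (simp del: of_nat_Suc of_nat_add)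
  then show ?thesis
    by (auto simp: cartan_def sl_def diagonal_mat_def cartan_dual_def)
qed

lemma cartan_bracket_unit:
  assumes "x \<in> cartan n" "i \<le> n" "j \<le> n"
  shows "lie_bracket x (mat_unit n i j) = (x $$ (i, i) - x $$ (j, j)) \<cdot>\<^sub>m mat_unit n i j"
proof -
  have c: "x \<in> carrier_mat (n + 1) (n + 1)" using assms cartan_sl sl_carrier by blast
  show ?thesis
  proof (rule eq_matI)
    fix a b assume "a < dim_row ((x $$ (i, i) - x $$ (j, j)) \<cdot>\<^sub>m mat_unit n i j)"
      "b < dim_col ((x $$ (i, i) - x $$ (j, j)) \<cdot>\<^sub>m mat_unit n i j)"
    then have ab: "a < n + 1" "b < n + 1" by (auto simp: mat_unit_def)
    have "(\<Sum>k<n + 1. x $$ (a, k) * mat_unit n i j $$ (k, b)) =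
        (\<Sum>k<n + 1. if k = i then (if b = j then x $$ (a, i) else 0) else 0)"
      using ab by (intro sum.cong) auto
    then have "(\<Sum>k<n + 1. x $$ (a, k) * mat_unit n i j $$ (k, b)) = (if b = j then x $$ (a, i) else 0)"
      using assms by (simp del: sum.lessThan_Suc)
    moreover have "(\<Sum>k<n + 1. mat_unit n i j $$ (a, k) * x $$ (k, b)) =
        (\<Sum>k<n + 1. if k = j then (if a = i then x $$ (j, b) else 0) else 0)"
      using ab by (intro sum.cong) auto
    then have "(\<Sum>k<n + 1. mat_unit n i j $$ (a, k) * x $$ (k, b)) = (if a = i then x $$ (j, b) else 0)"
      using assms by (simp del: sum.lessThan_Suc)
    moreover note mat_mult_index[OF c mat_unit_carrier ab] mat_mult_index[OF mat_unit_carrier c ab]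
    ultimately show "lie_bracket x (mat_unit n i j) $$ (a, b) =
        ((x $$ (i, i) - x $$ (j, j)) \<cdot>\<^sub>m mat_unit n i j) $$ (a, b)"
      using ab c assms cartan_index[OF assms(1)] unfolding lie_bracket_def
      by (auto simp del: index_mult_mat(1) sum.lessThan_Suc)
  qed (use c in \<open>auto simp: lie_bracket_def\<close>)
qed

lemma cartan_bracket_cartan:
  assumes "x \<in> cartan n" "y \<in> cartan n"
  shows "lie_bracket x y = 0 \<cdot>\<^sub>m x"
proof -
  have c: "x \<in> carrier_mat (n + 1) (n + 1)" "y \<in> carrier_mat (n + 1) (n + 1)"
    using assms cartan_sl sl_carrier by blast+
  have p: "(x * y) $$ (a, b) = (if a = b then x $$ (a, a) * y $$ (a, a) else 0)"
    if "a < n + 1" "b < n + 1" "x \<in> cartan n" "y \<in> cartan n" for a b x y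
  proof -
    have "(x * y) $$ (a, b) = (\<Sum>k<n + 1. x $$ (a, k) * y $$ (k, b))"
      using that cartan_sl sl_carrier by (intro mat_mult_index) blast+
    also have "\<dots> = (\<Sum>k<n + 1. if k = a then (if a = b then x $$ (a, a) * y $$ (a, a) else 0) else 0)"
      using that by (intro sum.cong) (auto simp: cartan_index)
    finally show ?thesis using that by simp
  qed
  show ?thesis
  proof (rule eq_matI)
    fix a b assume "a < dim_row (0 \<cdot>\<^sub>m x)" "b < dim_col (0 \<cdot>\<^sub>m x)"
    then show "lie_bracket x y $$ (a, b) = (0 \<cdot>\<^sub>m x) $$ (a, b)"
      using c assms unfolding lie_bracket_def by (auto simp: p simp del: index_mult_mat(1))
  qed (use c in \<open>auto simp: lie_bracket_def\<close>)
qed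

lemma unit_mult_zero:
  assumes "i \<in> {1..n}" "j \<in> {1..n}"
  shows "mat_unit n 0 i * mat_unit n 0 j = 0\<^sub>m (n + 1) (n + 1)"
proof (rule eq_matI)
  fix a b assume "a < dim_row (0\<^sub>m (n + 1) (n + 1) :: complex mat)" "b < dim_col (0\<^sub>m (n + 1) (n + 1) :: complex mat)"
  then have ab: "a < n + 1" "b < n + 1" by auto
  then have "(mat_unit n 0 i * mat_unit n 0 j) $$ (a, b) =
      (\<Sum>k<n + 1. mat_unit n 0 i $$ (a, k) * mat_unit n 0 j $$ (k, b))"
    by (intro mat_mult_index) auto
  also have "\<dots> = 0" using assms ab by (intro sum.neutral) auto
  finally show "(mat_unit n 0 i * mat_unit n 0 j) $$ (a, b) = 0\<^sub>m (n + 1) (n + 1) $$ (a, b)"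
    using ab by simp
qed auto

lemma unit_bracket_zero:
  assumes "i \<in> {1..n}" "j \<in> {1..n}"
  shows "lie_bracket (mat_unit n 0 i) (mat_unit n 0 j) = 0 \<cdot>\<^sub>m mat_unit n 0 i"
  unfolding lie_bracket_def unit_mult_zero[OF assms] unit_mult_zero[OF assms(2,1)]
  by (rule eq_matI) auto

text \<open>A matrix of square zero is ad-nilpotent: \<open>ad E\<close> applied twice to \<open>x\<close> gives \<open>- 2 E x E\<close>.\<close>

lemma unit_bracket_cubed:
  assumes i: "i \<in> {1..n}" and x: "x \<in> sl n"
  defines "E \<equiv> mat_unit n 0 i"
  shows "lie_bracket E (lie_bracket E (lie_bracket E x)) = 0 \<cdot>\<^sub>m x"
proof -
  let ?C = "carrier_mat (n + 1) (n + 1)"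
  have c: "E \<in> ?C" "x \<in> ?C" "E * E = 0\<^sub>m (n + 1) (n + 1)"
    using assms sl_carrier unit_mult_zero by (auto simp: E_def)
  define X where "X = E * x * E"
  let ?Z = "0\<^sub>m (n + 1) (n + 1) :: complex mat"
  have m: "E * x \<in> ?C" "x * E \<in> ?C" "X \<in> ?C" using c by (auto simp: X_def)
  note assoc = assoc_mult_mat[of _ "n + 1" "n + 1" _ "n + 1" _ "n + 1"]
  note left = mult_minus_distrib_mat[of _ "n + 1" "n + 1" _ "n + 1"]
  note right = minus_mult_distrib_mat[of _ "n + 1" "n + 1" _ _ "n + 1"]
  have EEx: "E * (E * x) = ?Z" using assoc[OF c(1,1,2)] c by simp
  have xEE: "x * E * E = ?Z" using assoc[OF c(2,1,1)] c by simp
  have ExE: "E * (x * E) = X" using assoc[OF c(1,2,1)] by (simp add: X_def)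
  have EX: "E * X = ?Z" unfolding X_def using assoc[OF c(1) m(1) c(1)] EEx c by simp
  have XE: "X * E = ?Z" unfolding X_def using assoc[OF m(1) c(1,1)] c m by simp
  have 2: "lie_bracket E (lie_bracket E x) = (?Z - X) - (X - ?Z)"
    unfolding lie_bracket_def left[OF c(1) m(1,2)] right[OF m(1,2) c(1)]
    by (simp add: EEx xEE ExE X_def)
  have Y: "?Z - X \<in> ?C" "X - ?Z \<in> ?C" using m by auto
  have "E * (?Z - X) = ?Z" "(?Z - X) * E = ?Z" "E * (X - ?Z) = ?Z" "(X - ?Z) * E = ?Z"
    using c m left[OF c(1) zero_carrier_mat m(3)] right[OF zero_carrier_mat m(3) c(1)]
      left[OF c(1) m(3) zero_carrier_mat] right[OF m(3) zero_carrier_mat c(1)]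
    by (simp_all add: EX XE)
  then have "E * ((?Z - X) - (X - ?Z)) = ?Z" "((?Z - X) - (X - ?Z)) * E = ?Z"
    using left[OF c(1) Y] right[OF Y c(1)] by simp_all
  then have "lie_bracket E ((?Z - X) - (X - ?Z)) = ?Z - ?Z" by (simp only: lie_bracket_def)
  also have "\<dots> = 0 \<cdot>\<^sub>m x" using c by (intro eq_matI) auto
  finally show ?thesis unfolding 2 .
qed

text \<open>Off-diagonal entries are removed one at a time.\<close>

lemma offdiagonal_induct:
  assumes x: "x \<in> sl n"
    and add: "\<And>y z. y \<in> sl n \<Longrightarrow> z \<in> sl n \<Longrightarrow> P y \<Longrightarrow> P z \<Longrightarrow> P (y + z)"
    and smult: "\<And>c y. y \<in> sl n \<Longrightarrow> P y \<Longrightarrow> P (c \<cdot>\<^sub>m y)"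
    and unit: "\<And>i j. i \<le> n \<Longrightarrow> j \<le> n \<Longrightarrow> i \<noteq> j \<Longrightarrow> x $$ (i, j) \<noteq> 0 \<Longrightarrow> P (mat_unit n i j)"
    and diag: "P (mat (n + 1) (n + 1) (\<lambda>(a, b). if a = b then x $$ (a, a) else 0))"
  shows "P x"
proof -
  define part where
    "part A = mat (n + 1) (n + 1) (\<lambda>(a, b). if a = b \<or> (a, b) \<in> A then x $$ (a, b) else 0)" for A
  let ?I = "{..n} \<times> {..n} - {(a, b). a = b} - {(a, b). x $$ (a, b) = 0}"
  have part_sl: "part A \<in> sl n" for A
    using x by (auto simp: part_def sl_def)
  have "finite A \<Longrightarrow> A \<subseteq> ?I \<Longrightarrow> P (part A)" for A
  proof (induction rule: finite_induct)
    case empty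
    have "part {} = mat (n + 1) (n + 1) (\<lambda>(a, b). if a = b then x $$ (a, a) else 0)"
      by (auto simp: part_def)
    then show ?case using diag by simp
  next
    case (insert p A)
    obtain i j where p: "p = (i, j)" by (cases p)
    have ij: "i \<le> n" "j \<le> n" "i \<noteq> j" "x $$ (i, j) \<noteq> 0" using insert.prems p by auto
    have "part (insert p A) = part A + x $$ (i, j) \<cdot>\<^sub>m mat_unit n i j"
      by (rule eq_matI) (use insert ij p in \<open>auto simp: part_def mat_unit_def\<close>)
    moreover have "P (part A)" using insert by simp
    moreover have "P (x $$ (i, j) \<cdot>\<^sub>m mat_unit n i j)"
      using smult[OF mat_unit_sl] unit ij by blast
    ultimately show ?case
      using add[OF part_sl sl_smult[OF mat_unit_sl]] ij by simp
  qed
  moreover have "part ?I = x"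
    by (rule eq_matI) (use sl_carrier[OF x] in \<open>auto simp: part_def\<close>)
  ultimately show ?thesis by (metis finite_Diff finite_SigmaI finite_atMost order_refl)
qed

lemma sl_induct:
  assumes x: "x \<in> sl n"
    and add: "\<And>y z. y \<in> sl n \<Longrightarrow> z \<in> sl n \<Longrightarrow> P y \<Longrightarrow> P z \<Longrightarrow> P (y + z)"
    and smult: "\<And>c y. y \<in> sl n \<Longrightarrow> P y \<Longrightarrow> P (c \<cdot>\<^sub>m y)"
    and unit: "\<And>i j. i \<le> n \<Longrightarrow> j \<le> n \<Longrightarrow> i \<noteq> j \<Longrightarrow> P (mat_unit n i j)"
    and diag: "\<And>y. y \<in> cartan n \<Longrightarrow> P y"
  shows "P x"
proof (rule offdiagonal_induct[OF x add smult unit])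
  show "P (mat (n + 1) (n + 1) (\<lambda>(a, b). if a = b then x $$ (a, a) else 0))"
    using x by (intro diag) (auto simp: cartan_def sl_def diagonal_mat_def)
qed

lemma m_sub_induct:
  assumes x: "x \<in> m_sub n"
    and add: "\<And>y z. y \<in> sl n \<Longrightarrow> z \<in> sl n \<Longrightarrow> P y \<Longrightarrow> P z \<Longrightarrow> P (y + z)"
    and smult: "\<And>c y. y \<in> sl n \<Longrightarrow> P y \<Longrightarrow> P (c \<cdot>\<^sub>m y)"
    and unit: "\<And>j. j \<in> {1..n} \<Longrightarrow> P (mat_unit n 0 j)"
    and zero: "P (0\<^sub>m (n + 1) (n + 1))"
  shows "P x"
proof (rule offdiagonal_induct[OF m_sub_sl[OF x] add smult])
  fix i j assume "i \<le> n" "j \<le> n" "i \<noteq> j" "x $$ (i, j) \<noteq> 0"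
  then have "i = 0" "j \<in> {1..n}" using x by (force simp: m_sub_def less_Suc_eq_le Suc_le_eq)+
  then show "P (mat_unit n i j)" using unit by simp
next
  have "mat (n + 1) (n + 1) (\<lambda>(a, b). if a = b then x $$ (a, a) else 0) = 0\<^sub>m (n + 1) (n + 1)"
    by (rule eq_matI) (use x in \<open>auto simp: m_sub_def\<close>)
  then show "P (mat (n + 1) (n + 1) (\<lambda>(a, b). if a = b then x $$ (a, a) else 0))"
    using zero by simp
qed

section \<open>The enveloping algebra and its action on modules\<close>

lemma free_algebra_simps [simp]:
  "p \<in> carrier (free_algebra X) \<longleftrightarrow> (\<forall>w \<in> Poly_Mapping.keys p. set (letters w) \<subseteq> X)"
  "p \<otimes>\<^bsub>free_algebra X\<^esub> q = p * q" "p \<oplus>\<^bsub>free_algebra X\<^esub> q = p + q"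
  "\<one>\<^bsub>free_algebra X\<^esub> = 1" "\<zero>\<^bsub>free_algebra X\<^esub> = 0"
  by (simp_all add: free_algebra_def)

lemma letters_simps [simp]: "letters (u + v) = letters u @ letters v" "letters 0 = []"
  by (simp_all add: plus_free_word_def zero_free_word_def)

lemma free_algebra_ring: "ring (free_algebra X)"
proof (rule ringI)
  show "abelian_group (free_algebra X)"
  proof (rule abelian_groupI)
    fix p q assume "p \<in> carrier (free_algebra X)" "q \<in> carrier (free_algebra X)"
    then show "p \<oplus>\<^bsub>free_algebra X\<^esub> q \<in> carrier (free_algebra X)"
      using Poly_Mapping.keys_add[of p q] by auto
  next
    fix p assume "p \<in> carrier (free_algebra X)"
    then show "\<exists>q \<in> carrier (free_algebra X). q \<oplus>\<^bsub>free_algebra X\<^esub> p = \<zero>\<^bsub>free_algebra X\<^esub>"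
      by (intro bexI[of _ "- p"]) (auto simp: in_keys_iff)
  qed (auto simp: algebra_simps)
  show "monoid (free_algebra X)"
  proof (rule monoidI)
    fix p q assume "p \<in> carrier (free_algebra X)" "q \<in> carrier (free_algebra X)"
    then show "p \<otimes>\<^bsub>free_algebra X\<^esub> q \<in> carrier (free_algebra X)"
      using Poly_Mapping.keys_mult[of p q] by fastforce
  qed (auto simp: algebra_simps)
qed (auto simp: algebra_simps)

lemma free_algebra_minus:
  assumes "p \<in> carrier (free_algebra X)"
  shows "\<ominus>\<^bsub>free_algebra X\<^esub> p = - p"
proof -
  interpret ring "free_algebra X" by (rule free_algebra_ring)
  have "- p \<in> carrier (free_algebra X)" using assms by (auto simp: in_keys_iff)
  then show ?thesis using assms by (intro minus_equality) auto
qed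

lemma free_algebra_const: "fa_const c \<in> carrier (free_algebra X)"
  and free_algebra_gen: "x \<in> X \<Longrightarrow> fa_gen x \<in> carrier (free_algebra X)"
  by (auto simp: fa_const_def fa_gen_def in_keys_iff lookup_single when_def)

lemma free_algebra_monomial_induct [consumes 1, case_names add single]:
  assumes p: "p \<in> carrier (free_algebra X)"
    and add: "\<And>p q. p \<in> carrier (free_algebra X) \<Longrightarrow> q \<in> carrier (free_algebra X) \<Longrightarrow>
      P p \<Longrightarrow> P q \<Longrightarrow> P (p + q)"
    and single: "\<And>w c. set (letters w) \<subseteq> X \<Longrightarrow> P (Poly_Mapping.single w c)"
  shows "P p"
  using p
proof (induction "Poly_Mapping.keys p" arbitrary: p rule: infinite_finite_induct)
  case (insert w A)
  let ?s = "Poly_Mapping.single w (Poly_Mapping.lookup p w)"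
  have k: "Poly_Mapping.keys (p - ?s) = A"
    using insert(2,4) by (auto simp: in_keys_iff set_eq_iff lookup_minus lookup_single when_def)
  have w: "set (letters w) \<subseteq> X" using insert by (metis free_algebra_simps(1) insertI1)
  have c: "p - ?s \<in> carrier (free_algebra X)" using k insert(4,5) by (metis free_algebra_simps(1) insertI2)
  have "?s \<in> carrier (free_algebra X)" using w by (auto simp: in_keys_iff lookup_single when_def)
  from add[OF c this insert.hyps(3)[OF k[symmetric] c] single[OF w]] show ?case by simp
next
  case empty
  then have "p = 0" using keys_eq_empty[of p] by simp
  then show ?case using single[of 0 0] by simp
qed simp

lemma free_algebra_induct [consumes 1, case_names add mult const gen]:
  assumes p: "p \<in> carrier (free_algebra X)"
    and add: "\<And>p q. p \<in> carrier (free_algebra X) \<Longrightarrow> q \<in> carrier (free_algebra X) \<Longrightarrow>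
      P p \<Longrightarrow> P q \<Longrightarrow> P (p + q)"
    and mult: "\<And>p q. p \<in> carrier (free_algebra X) \<Longrightarrow> q \<in> carrier (free_algebra X) \<Longrightarrow>
      P p \<Longrightarrow> P q \<Longrightarrow> P (p * q)"
    and const: "\<And>c. P (fa_const c)"
    and gen: "\<And>x. x \<in> X \<Longrightarrow> P (fa_gen x)"
  shows "P p"
proof (rule free_algebra_monomial_induct[where P = P, OF p])
  fix w :: "'a free_word" and c
  have "set xs \<subseteq> X \<Longrightarrow> P (Poly_Mapping.single (Word xs) c)" for xs
  proof (induction xs)
    case Nil
    then show ?case using const by (simp add: fa_const_def zero_free_word_def)
  next
    case (Cons x xs)
    have "Poly_Mapping.single (Word (x # xs)) c = fa_gen x * Poly_Mapping.single (Word xs) c"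
      by (simp add: fa_gen_def mult_single plus_free_word_def)
    moreover have "Poly_Mapping.single (Word xs) c \<in> carrier (free_algebra X)"
      using Cons by (auto simp: in_keys_iff lookup_single when_def)
    ultimately show ?case using Cons mult gen free_algebra_gen by (metis list.set_intros(1) set_subset_Cons subset_iff)
  qed
  then show "set (letters w) \<subseteq> X \<Longrightarrow> P (Poly_Mapping.single w c)" by (cases w) simp
qed (rule add)

lemma env_relations_carrier: "env_relations n \<subseteq> carrier (free_algebra (sl n))"
proof -
  interpret ring "free_algebra (sl n)" by (rule free_algebra_ring)
  note g = free_algebra_gen[of _ "sl n"]
  have m: "p - q \<in> carrier (free_algebra (sl n))"
    if "p \<in> carrier (free_algebra (sl n))" "q \<in> carrier (free_algebra (sl n))" for p q
    using minus_closed[OF that] that by (simp only: a_minus_def free_algebra_minus free_algebra_simps(3)) simp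
  have a: "p + q \<in> carrier (free_algebra (sl n))" "p * q \<in> carrier (free_algebra (sl n))"
    if "p \<in> carrier (free_algebra (sl n))" "q \<in> carrier (free_algebra (sl n))" for p q
    using add.m_closed[OF that] m_closed[OF that] by simp_all
  show ?thesis
    unfolding env_relations_def
    by (auto intro!: a m g free_algebra_const sl_add sl_smult sl_bracket simp del: free_algebra_simps(1))
qed

lemma env_relationsI:
  "x \<in> sl n \<Longrightarrow> y \<in> sl n \<Longrightarrow> fa_gen (x + y) - (fa_gen x + fa_gen y) \<in> env_relations n"
  "x \<in> sl n \<Longrightarrow> fa_gen (c \<cdot>\<^sub>m x) - fa_const c * fa_gen x \<in> env_relations n"
  "x \<in> sl n \<Longrightarrow> y \<in> sl n \<Longrightarrow>
    fa_gen x * fa_gen y - fa_gen y * fa_gen x - fa_gen (lie_bracket x y) \<in> env_relations n"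
  unfolding env_relations_def by blast+

context fixes n :: nat begin

private abbreviation "A \<equiv> free_algebra (sl n)"
private abbreviation "I \<equiv> env_ideal n"

lemma env_ideal: "ideal I A"
  unfolding env_ideal_def by (rule ring.genideal_ideal[OF free_algebra_ring env_relations_carrier])

lemma U_ring: "ring (U_alg n)"
  unfolding U_alg_def by (rule ideal.quotient_is_ring[OF env_ideal])

definition U_proj :: "(complex mat free_word \<Rightarrow>\<^sub>0 complex) \<Rightarrow> env" where
  "U_proj p = I +>\<^bsub>A\<^esub> p"

lemma U_proj_hom: "U_proj \<in> Ring.ring_hom A (U_alg n)"
proof -
  have "U_proj = (+>\<^bsub>A\<^esub>) I" by (rule ext) (simp add: U_proj_def)
  then show ?thesis unfolding U_alg_def using ideal.rcos_ring_hom[OF env_ideal] by simp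
qed

lemmas U_proj_simps = ring_hom_closed[OF U_proj_hom] ring_hom_add[OF U_proj_hom, simplified]
  ring_hom_mult[OF U_proj_hom, simplified] ring_hom_one[OF U_proj_hom, simplified]

lemma U_carrier: "carrier (U_alg n) = U_proj ` carrier A"
  unfolding U_alg_def U_proj_def FactRing_def A_RCOSETS_def' by auto

lemma U_proj_eqI:
  assumes "p \<in> carrier A" "q \<in> carrier A" "p - q \<in> env_relations n"
  shows "U_proj p = U_proj q"
proof -
  interpret ring A by (rule free_algebra_ring)
  have "p - q \<in> I" using assms(3) genideal_self[OF env_relations_carrier] by (auto simp: env_ideal_def)
  then have "p \<ominus>\<^bsub>A\<^esub> q \<in> I" using assms by (simp add: a_minus_def free_algebra_minus del: free_algebra_simps(1))
  then show ?thesis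
    unfolding U_proj_def using quotient_eq_iff_same_a_r_cos[OF env_ideal assms(1,2)] by simp
qed

lemma U_gen_proj: "U_gen n x = U_proj (fa_gen x)" and U_const_proj: "U_const n c = U_proj (fa_const c)"
  by (simp_all add: U_gen_def U_const_def U_proj_def)

lemma U_gen_closed: "x \<in> sl n \<Longrightarrow> U_gen n x \<in> carrier (U_alg n)"
  unfolding U_gen_proj by (intro U_proj_simps free_algebra_gen)

lemma U_const_closed: "U_const n c \<in> carrier (U_alg n)"
  unfolding U_const_proj by (intro U_proj_simps free_algebra_const)

lemma U_const_add: "U_const n (c + d) = U_const n c \<oplus>\<^bsub>U_alg n\<^esub> U_const n d"
  and U_const_mult: "U_const n (c * d) = U_const n c \<otimes>\<^bsub>U_alg n\<^esub> U_const n d"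
  and U_const_one: "U_const n 1 = \<one>\<^bsub>U_alg n\<^esub>"
proof -
  note c = free_algebra_const[of _ "sl n"]
  show "U_const n (c + d) = U_const n c \<oplus>\<^bsub>U_alg n\<^esub> U_const n d"
    unfolding U_const_proj ring_hom_add[OF U_proj_hom c c, symmetric] by (simp add: fa_const_def single_add)
  show "U_const n (c * d) = U_const n c \<otimes>\<^bsub>U_alg n\<^esub> U_const n d"
    unfolding U_const_proj ring_hom_mult[OF U_proj_hom c c, symmetric] by (simp add: fa_const_def mult_single)
  show "U_const n 1 = \<one>\<^bsub>U_alg n\<^esub>"
    unfolding U_const_proj ring_hom_one[OF U_proj_hom, symmetric] by (simp add: fa_const_def)
qed

lemma U_gen_add:
  assumes "x \<in> sl n" "y \<in> sl n"
  shows "U_gen n (x + y) = U_gen n x \<oplus>\<^bsub>U_alg n\<^esub> U_gen n y"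
proof -
  interpret ring A by (rule free_algebra_ring)
  note g = free_algebra_gen[OF assms(1)] free_algebra_gen[OF assms(2)]
  have "U_proj (fa_gen (x + y)) = U_proj (fa_gen x + fa_gen y)"
    using add.m_closed[OF g]
    by (intro U_proj_eqI free_algebra_gen sl_add env_relationsI assms) (simp only: free_algebra_simps(3))
  then show ?thesis unfolding U_gen_proj ring_hom_add[OF U_proj_hom g, symmetric] by simp
qed

lemma U_gen_smult:
  assumes "x \<in> sl n"
  shows "U_gen n (c \<cdot>\<^sub>m x) = U_const n c \<otimes>\<^bsub>U_alg n\<^esub> U_gen n x"
proof -
  interpret ring A by (rule free_algebra_ring)
  note g = free_algebra_const[of c "sl n"] free_algebra_gen[OF assms]
  have "U_proj (fa_gen (c \<cdot>\<^sub>m x)) = U_proj (fa_const c * fa_gen x)"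
    using m_closed[OF g]
    by (intro U_proj_eqI free_algebra_gen sl_smult env_relationsI assms) (simp only: free_algebra_simps(2))
  then show ?thesis
    unfolding U_gen_proj U_const_proj ring_hom_mult[OF U_proj_hom g, symmetric] by simp
qed

lemma U_gen_bracket:
  assumes x: "x \<in> sl n" and y: "y \<in> sl n"
  shows "U_gen n x \<otimes>\<^bsub>U_alg n\<^esub> U_gen n y =
    U_gen n (lie_bracket x y) \<oplus>\<^bsub>U_alg n\<^esub> U_gen n y \<otimes>\<^bsub>U_alg n\<^esub> U_gen n x"
proof -
  interpret ring A by (rule free_algebra_ring)
  note g = free_algebra_gen[OF x] free_algebra_gen[OF y] free_algebra_gen[OF sl_bracket[OF x y]]
  have d: "fa_gen x * fa_gen y - (fa_gen (lie_bracket x y) + fa_gen y * fa_gen x) =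
      fa_gen x * fa_gen y - fa_gen y * fa_gen x - fa_gen (lie_bracket x y)"
    by (simp only: diff_diff_eq add.commute)
  have "U_proj (fa_gen x * fa_gen y) = U_proj (fa_gen (lie_bracket x y) + fa_gen y * fa_gen x)"
    using m_closed[OF g(1,2)] add.m_closed[OF g(3) m_closed[OF g(2,1)]] env_relationsI(3)[OF x y]
    by (intro U_proj_eqI) (simp_all only: free_algebra_simps(2,3) d)
  then show ?thesis
    unfolding U_gen_proj ring_hom_mult[OF U_proj_hom g(1,2), symmetric]
      ring_hom_mult[OF U_proj_hom g(2,1), symmetric]
    using ring_hom_add[OF U_proj_hom g(3) m_closed[OF g(2,1)]] by simp
qed

lemma U_const_central:
  assumes "u \<in> carrier (U_alg n)"
  shows "U_const n c \<otimes>\<^bsub>U_alg n\<^esub> u = u \<otimes>\<^bsub>U_alg n\<^esub> U_const n c"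
proof -
  obtain p where p: "p \<in> carrier A" "u = U_proj p" using assms U_carrier by blast
  have "fa_const c * p = p * fa_const c"
    using p(1)
  proof (induction p rule: free_algebra_monomial_induct)
    case (single w d)
    then show ?case by (simp add: fa_const_def mult_single mult.commute)
  qed (simp add: algebra_simps)
  then show ?thesis
    unfolding U_const_proj p(2)
    using ring_hom_mult[OF U_proj_hom free_algebra_const[of c] p(1)]
      ring_hom_mult[OF U_proj_hom p(1) free_algebra_const[of c]] by (simp only: free_algebra_simps(2))
qed

lemma U_induct [consumes 1, case_names add mult const gen]:
  assumes u: "u \<in> carrier (U_alg n)"
    and add: "\<And>u v. u \<in> carrier (U_alg n) \<Longrightarrow> v \<in> carrier (U_alg n) \<Longrightarrow>
      P u \<Longrightarrow> P v \<Longrightarrow> P (u \<oplus>\<^bsub>U_alg n\<^esub> v)"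
    and mult: "\<And>u v. u \<in> carrier (U_alg n) \<Longrightarrow> v \<in> carrier (U_alg n) \<Longrightarrow>
      P u \<Longrightarrow> P v \<Longrightarrow> P (u \<otimes>\<^bsub>U_alg n\<^esub> v)"
    and const: "\<And>c. P (U_const n c)"
    and gen: "\<And>x. x \<in> sl n \<Longrightarrow> P (U_gen n x)"
  shows "P u"
proof -
  obtain p where p: "p \<in> carrier A" "u = U_proj p" using u U_carrier by blast
  have "P (U_proj p)"
    using p(1)
  proof (induction p rule: free_algebra_induct)
    case (add p q)
    then show ?case
      using assms(2)[of "U_proj p" "U_proj q"] ring_hom_add[OF U_proj_hom add.hyps(1,2)] U_proj_simps(1) by simp
  next
    case (mult p q)
    then show ?case
      using assms(3)[of "U_proj p" "U_proj q"] ring_hom_mult[OF U_proj_hom mult.hyps(1,2)] U_proj_simps(1) by simp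
  qed (use assms(4,5) in \<open>simp_all add: U_const_proj U_gen_proj\<close>)
  then show ?thesis using p by simp
qed

end

lemma sl_moduleD:
  assumes "sl_module n M"
  shows "vectorspace cfield M"
    and "x \<in> sl n \<Longrightarrow> linear_op M M (act M x)"
    and "x \<in> sl n \<Longrightarrow> y \<in> sl n \<Longrightarrow> v \<in> carrier M \<Longrightarrow> act M (x + y) v = act M x v \<oplus>\<^bsub>M\<^esub> act M y v"
    and "x \<in> sl n \<Longrightarrow> v \<in> carrier M \<Longrightarrow> act M (c \<cdot>\<^sub>m x) v = c \<odot>\<^bsub>M\<^esub> act M x v"
    and "x \<in> sl n \<Longrightarrow> y \<in> sl n \<Longrightarrow> v \<in> carrier M \<Longrightarrow>
      act M (lie_bracket x y) v = act M x (act M y v) \<ominus>\<^bsub>M\<^esub> act M y (act M x v)"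
  using assms by (auto simp: sl_module_def linear_op_def linear_op_axioms_def)

locale sl_rep =
  fixes n :: nat and M :: "(complex mat, 'm) rep" (structure)
  assumes sl_mod: "sl_module n M"
begin

sublocale vectorspace cfield M by (rule sl_moduleD(1)[OF sl_mod])

lemmas sm = vectorspace_smult_simps[OF vectorspace_axioms]
lemmas act_op = sl_moduleD(2)[OF sl_mod]
lemmas act_simps = linear_op.closed[OF act_op] linear_op.add[OF act_op] linear_op.smult[OF act_op]
  linear_op.zero[OF act_op]

definition word_act :: "complex mat free_word \<Rightarrow> 'm \<Rightarrow> 'm" where
  "word_act w v = foldr (act M) (letters w) v"

lemma word_act_closed:
  "set (letters w) \<subseteq> sl n \<Longrightarrow> v \<in> carrier M \<Longrightarrow> word_act w v \<in> carrier M"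
proof -
  have "set xs \<subseteq> sl n \<Longrightarrow> v \<in> carrier M \<Longrightarrow> foldr (act M) xs v \<in> carrier M" for xs
    by (induction xs) (auto simp: act_simps)
  then show "set (letters w) \<subseteq> sl n \<Longrightarrow> v \<in> carrier M \<Longrightarrow> word_act w v \<in> carrier M"
    by (simp add: word_act_def)
qed

lemma word_act_op: "set (letters w) \<subseteq> sl n \<Longrightarrow> linear_op M M (word_act w)"
proof -
  have "set xs \<subseteq> sl n \<Longrightarrow> linear_op M M (foldr (act M) xs)" for xs
  proof (induction xs)
    case Nil
    then show ?case
      by (simp add: linear_op_def linear_op_axioms_def module_hom_iff vectorspace_axioms)
  next
    case (Cons x xs)
    then have "linear_op M M (foldr (act M) xs)" "linear_op M M (act M x)" by (auto simp: act_op)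
    then show ?case by (simp add: linear_op_def linear_op_axioms_def module_hom_iff)
  qed
  then show "set (letters w) \<subseteq> sl n \<Longrightarrow> linear_op M M (word_act w)"
    by (simp add: word_act_def[abs_def])
qed

text \<open>The action of the enveloping algebra is obtained from that of the free algebra, whose words
  act by composition.\<close>

definition free_act :: "(complex mat free_word \<Rightarrow>\<^sub>0 complex) \<Rightarrow> 'm \<Rightarrow> 'm" where
  "free_act p v = (\<Oplus>w \<in> Poly_Mapping.keys p. Poly_Mapping.lookup p w \<odot> word_act w v)"

context fixes v assumes v: "v \<in> carrier M" begin

lemma free_act_superset:
  assumes "finite B" "Poly_Mapping.keys p \<subseteq> B" "\<And>w. w \<in> B \<Longrightarrow> set (letters w) \<subseteq> sl n"
  shows "free_act p v = (\<Oplus>w \<in> B. Poly_Mapping.lookup p w \<odot> word_act w v)"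
  unfolding free_act_def
proof (rule M.add.finprod_mono_neutral_cong_left)
  fix w assume "w \<in> B - Poly_Mapping.keys p"
  then show "Poly_Mapping.lookup p w \<odot> word_act w v = \<zero>"
    using assms(3) v by (simp add: in_keys_iff sm word_act_closed)
qed (use assms v in \<open>auto intro!: sm word_act_closed\<close>)

lemma free_act_closed: "p \<in> carrier (free_algebra (sl n)) \<Longrightarrow> free_act p v \<in> carrier M"
  unfolding free_act_def by (intro M.finsum_closed) (auto intro!: sm word_act_closed v)

lemma free_act_add:
  assumes "p \<in> carrier (free_algebra (sl n))" "q \<in> carrier (free_algebra (sl n))"
  shows "free_act (p + q) v = free_act p v \<oplus> free_act q v"
proof -
  let ?B = "Poly_Mapping.keys p \<union> Poly_Mapping.keys q"
  have w: "\<And>w. w \<in> ?B \<Longrightarrow> set (letters w) \<subseteq> sl n" using assms by auto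
  have "free_act (p + q) v = (\<Oplus>w \<in> ?B. Poly_Mapping.lookup (p + q) w \<odot> word_act w v)"
    by (rule free_act_superset) (use w Poly_Mapping.keys_add[of p q] in auto)
  also have "\<dots> = (\<Oplus>w \<in> ?B. Poly_Mapping.lookup p w \<odot> word_act w v \<oplus> Poly_Mapping.lookup q w \<odot> word_act w v)"
    using w by (intro M.finsum_cong') (auto simp: lookup_add sm word_act_closed v)
  also have "\<dots> = (\<Oplus>w \<in> ?B. Poly_Mapping.lookup p w \<odot> word_act w v) \<oplus>
      (\<Oplus>w \<in> ?B. Poly_Mapping.lookup q w \<odot> word_act w v)"
    using w by (intro M.finsum_addf) (auto intro!: sm word_act_closed v)
  also have "(\<Oplus>w \<in> ?B. Poly_Mapping.lookup p w \<odot> word_act w v) = free_act p v"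
    by (rule free_act_superset[symmetric]) (use w in auto)
  also have "(\<Oplus>w \<in> ?B. Poly_Mapping.lookup q w \<odot> word_act w v) = free_act q v"
    by (rule free_act_superset[symmetric]) (use w in auto)
  finally show ?thesis .
qed

lemma free_act_single:
  assumes "set (letters w) \<subseteq> sl n"
  shows "free_act (Poly_Mapping.single w c) v = c \<odot> word_act w v"
proof -
  have "free_act (Poly_Mapping.single w c) v =
      (\<Oplus>u \<in> {w}. Poly_Mapping.lookup (Poly_Mapping.single w c) u \<odot> word_act u v)"
    by (rule free_act_superset) (use assms in \<open>auto simp: in_keys_iff lookup_single when_def\<close>)
  then show ?thesis using assms v by (simp add: sm word_act_closed)
qed

end

lemma single_carrier:
  "set (letters w) \<subseteq> sl n \<Longrightarrow> Poly_Mapping.single w c \<in> carrier (free_algebra (sl n))"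
  by (auto simp: in_keys_iff lookup_single when_def)

lemma free_act_gen: "x \<in> sl n \<Longrightarrow> v \<in> carrier M \<Longrightarrow> free_act (fa_gen x) v = act M x v"
  by (simp add: fa_gen_def free_act_single word_act_def sm act_simps)

lemma free_act_const: "v \<in> carrier M \<Longrightarrow> free_act (fa_const c) v = c \<odot> v"
  by (simp add: fa_const_def free_act_single word_act_def sm)

lemma free_act_op:
  assumes "p \<in> carrier (free_algebra (sl n))"
  shows "linear_op M M (free_act p)"
proof -
  have "free_act p \<in> module_hom cfield M M"
    using assms
  proof (induction p rule: free_algebra_monomial_induct)
    case (add p q)
    then show ?case by (auto simp: module_hom_iff free_act_add sm M.a_ac simp del: free_algebra_simps)
  next
    case (single w c)
    interpret w: linear_op M M "word_act w" using word_act_op[OF single] .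
    show ?case using single
      by (auto simp: module_hom_iff free_act_single sm w.add w.smult) (metis sm(4) mult.commute w.closed)
  qed
  then show ?thesis by (simp add: linear_op_def linear_op_axioms_def vectorspace_axioms)
qed

lemmas free_act_simps = linear_op.closed[OF free_act_op] linear_op.add[OF free_act_op]
  linear_op.smult[OF free_act_op] linear_op.zero[OF free_act_op]

lemma free_act_mult:
  assumes p: "p \<in> carrier (free_algebra (sl n))" and q: "q \<in> carrier (free_algebra (sl n))"
    and v: "v \<in> carrier M"
  shows "free_act (p * q) v = free_act p (free_act q v)"
proof -
  interpret A: ring "free_algebra (sl n)" by (rule free_algebra_ring)
  have cl: "p * q \<in> carrier (free_algebra (sl n))"
    if "p \<in> carrier (free_algebra (sl n))" "q \<in> carrier (free_algebra (sl n))" for p q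
    using A.m_closed[OF that] by simp
  have ss: "free_act (Poly_Mapping.single w c * q) v = free_act (Poly_Mapping.single w c) (free_act q v)"
    if w: "set (letters w) \<subseteq> sl n" for w c
    using q
  proof (induction q rule: free_algebra_monomial_induct)
    case (add q r)
    then show ?case using v cl single_carrier[OF w, of c]
      by (simp add: distrib_left free_act_add free_act_simps del: free_algebra_simps)
  next
    case (single u d)
    interpret w: linear_op M M "word_act w" using word_act_op[OF w] .
    have "word_act (w + u) v = word_act w (word_act u v)" by (simp add: word_act_def)
    then show ?case
      using single w v by (simp add: mult_single free_act_single word_act_closed w.smult sm)
  qed
  show ?thesis using p
  proof (induction p rule: free_algebra_monomial_induct)
    case (add p r)
    then show ?case using v cl q
      by (simp add: distrib_right free_act_add free_act_simps del: free_algebra_simps)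
  next
    case (single w c)
    then show ?case by (rule ss)
  qed
qed

text \<open>The operators that come from elements of the enveloping ideal vanish, because they form an
  ideal that contains the defining relations.\<close>

lemma free_act_env_ideal:
  assumes "p \<in> env_ideal n" "v \<in> carrier M"
  shows "free_act p v = \<zero>"
proof -
  let ?A = "free_algebra (sl n)"
  interpret A: ring ?A by (rule free_algebra_ring)
  let ?K = "{p \<in> carrier ?A. \<forall>v \<in> carrier M. free_act p v = \<zero>}"
  have neg: "- p \<in> carrier ?A \<and> free_act (- p) v = \<ominus> free_act p v"
    if "p \<in> carrier ?A" "v \<in> carrier M" for p v
  proof -
    have c: "- p \<in> carrier ?A" using A.a_inv_closed[OF that(1)] that by (simp add: free_algebra_minus)
    have "free_act (- p + p) v = \<zero>" using free_act_single[OF that(2), of 0 0] that by (simp add: word_act_def sm)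
    then have "free_act (- p) v \<oplus> free_act p v = \<zero>" using free_act_add[OF that(2) c that(1)] by simp
    then have "free_act (- p) v = \<ominus> free_act p v"
      using that c free_act_closed by (intro M.minus_equality[symmetric]) auto
    then show ?thesis using c by simp
  qed
  have diff: "p - q \<in> carrier ?A \<and> free_act (p - q) v = free_act p v \<ominus> free_act q v"
    if "p \<in> carrier ?A" "q \<in> carrier ?A" "v \<in> carrier M" for p q v
    using free_act_add[OF that(3,1), of "- q"] neg[OF that(2,3)] A.add.m_closed[OF that(1), of "- q"]
    by (simp add: M.minus_eq)
  have mc: "p * q \<in> carrier ?A" "p + q \<in> carrier ?A" if "p \<in> carrier ?A" "q \<in> carrier ?A" for p q
    using A.m_closed[OF that] A.add.m_closed[OF that] by simp_all
  have "ideal ?K ?A"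
  proof (rule idealI)
    show "subgroup ?K (add_monoid ?A)"
    proof (rule A.add.subgroupI)
      have "\<zero>\<^bsub>?A\<^esub> \<in> ?K" using free_act_single[of _ 0 0] by (simp add: word_act_def sm)
      then show "?K \<noteq> {}" by blast
    next
      fix p assume p: "p \<in> ?K"
      then have "\<ominus>\<^bsub>?A\<^esub> p = - p" by (intro free_algebra_minus) simp
      then show "\<ominus>\<^bsub>?A\<^esub> p \<in> ?K"
        using p neg[of p] by (auto simp del: free_algebra_simps)
    next
      fix p q assume "p \<in> ?K" "q \<in> ?K"
      then show "p \<oplus>\<^bsub>?A\<^esub> q \<in> ?K"
        using mc[of p q] by (auto simp: free_act_add simp del: free_algebra_simps(1))
    qed auto
  next
    fix p q assume "p \<in> ?K" "q \<in> carrier ?A"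
    then show "q \<otimes>\<^bsub>?A\<^esub> p \<in> ?K" "p \<otimes>\<^bsub>?A\<^esub> q \<in> ?K"
      using mc by (auto simp: free_act_mult free_act_simps simp del: free_algebra_simps(1))
  qed (rule free_algebra_ring)
  moreover have "env_relations n \<subseteq> ?K"
  proof -
    note g = free_algebra_gen[of _ "sl n"] free_algebra_const[of _ "sl n"]
    note mod = sl_moduleD(3-5)[OF sl_mod]
    have r1: "free_act (fa_gen (x + y) - (fa_gen x + fa_gen y)) v = \<zero>"
      if "x \<in> sl n" "y \<in> sl n" "v \<in> carrier M" for x y v
      using that diff[OF g(1)[OF sl_add[OF that(1,2)]] mc(2)[OF g(1)[OF that(1)] g(1)[OF that(2)]] that(3)]
      by (simp add: free_act_add g free_act_gen sl_add mod act_simps del: free_algebra_simps(1))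
    have r2: "free_act (fa_gen (c \<cdot>\<^sub>m x) - fa_const c * fa_gen x) v = \<zero>"
      if "x \<in> sl n" "v \<in> carrier M" for c x v
      using that diff[OF g(1)[OF sl_smult[OF that(1)]] mc(1)[OF g(2) g(1)[OF that(1)]] that(2)]
      by (simp add: free_act_mult g free_act_gen free_act_const sl_smult mod act_simps sm
          del: free_algebra_simps(1))
    have r3: "free_act (fa_gen x * fa_gen y - fa_gen y * fa_gen x - fa_gen (lie_bracket x y)) v = \<zero>"
      if x: "x \<in> sl n" and y: "y \<in> sl n" and v: "v \<in> carrier M" for x y v
    proof -
      note xy = mc(1)[OF g(1)[OF x] g(1)[OF y]] and yx = mc(1)[OF g(1)[OF y] g(1)[OF x]]
      note d = diff[OF xy yx v]
      have "free_act (fa_gen x * fa_gen y - fa_gen y * fa_gen x) v = act M (lie_bracket x y) v"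
        using d x y v by (simp add: free_act_mult g free_act_gen mod act_simps del: free_algebra_simps(1))
      then show ?thesis
        using diff[OF _ g(1)[OF sl_bracket[OF x y]] v] d x y v
        by (simp add: free_act_gen sl_bracket act_simps del: free_algebra_simps(1))
    qed
    show ?thesis
    proof
      fix r assume r: "r \<in> env_relations n"
      then have "free_act r v = \<zero>" if "v \<in> carrier M" for v
        using r1[of _ _ v] r2[of _ v] r3[of _ _ v] that unfolding env_relations_def by blast
      then show "r \<in> ?K" using r env_relations_carrier[of n] by blast
    qed
  qed
  ultimately have "env_ideal n \<subseteq> ?K" unfolding env_ideal_def by (rule A.genideal_minimal)
  then show ?thesis using assms by blast
qed

definition U_act :: "env \<Rightarrow> 'm \<Rightarrow> 'm" where
  "U_act u = free_act (SOME p. p \<in> carrier (free_algebra (sl n)) \<and> U_proj n p = u)"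

lemma U_act_proj:
  assumes p: "p \<in> carrier (free_algebra (sl n))" and v: "v \<in> carrier M"
  shows "U_act (U_proj n p) v = free_act p v"
proof -
  let ?A = "free_algebra (sl n)"
  interpret A: ring ?A by (rule free_algebra_ring)
  define q where "q = (SOME q. q \<in> carrier ?A \<and> U_proj n q = U_proj n p)"
  have q: "q \<in> carrier ?A \<and> U_proj n q = U_proj n p"
    unfolding q_def by (rule someI[of _ p]) (use p in simp)
  have "q \<ominus>\<^bsub>?A\<^esub> p \<in> env_ideal n"
    using A.quotient_eq_iff_same_a_r_cos[OF env_ideal, of q p] q p by (simp only: U_proj_def)
  then have i: "q - p \<in> env_ideal n"
    using p by (simp add: a_minus_def free_algebra_minus del: free_algebra_simps(1))
  then have "q - p \<in> carrier ?A" by (rule ideal.Icarr[OF env_ideal])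
  from free_act_add[OF v this p] have "free_act q v = free_act p v"
    using free_act_env_ideal[OF i v] free_act_closed[OF v p] by simp
  then show ?thesis by (simp add: U_act_def q_def)
qed

lemma U_act_op: assumes "u \<in> carrier (U_alg n)" shows "linear_op M M (U_act u)"
proof -
  obtain p where p: "p \<in> carrier (free_algebra (sl n))" "u = U_proj n p"
    using assms U_carrier by blast
  interpret linear_op M M "free_act p" using free_act_op[OF p(1)] .
  show ?thesis unfolding p(2) linear_op_def linear_op_axioms_def module_hom_iff
    by (auto simp: U_act_proj[OF p(1)] vectorspace_axioms add smult sm)
qed

lemmas U_act_simps = linear_op.closed[OF U_act_op] linear_op.add[OF U_act_op]
  linear_op.smult[OF U_act_op] linear_op.zero[OF U_act_op]

lemma
  assumes u: "u \<in> carrier (U_alg n)" and u': "u' \<in> carrier (U_alg n)" and v: "v \<in> carrier M"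
  shows U_act_add: "U_act (u \<oplus>\<^bsub>U_alg n\<^esub> u') v = U_act u v \<oplus> U_act u' v"
    and U_act_mult: "U_act (u \<otimes>\<^bsub>U_alg n\<^esub> u') v = U_act u (U_act u' v)"
proof -
  interpret A: ring "free_algebra (sl n)" by (rule free_algebra_ring)
  obtain p where p: "p \<in> carrier (free_algebra (sl n))" "u = U_proj n p" using u U_carrier by blast
  obtain q where q: "q \<in> carrier (free_algebra (sl n))" "u' = U_proj n q" using u' U_carrier by blast
  have "U_proj n p \<oplus>\<^bsub>U_alg n\<^esub> U_proj n q = U_proj n (p + q)"
    using ring_hom_add[OF U_proj_hom p(1) q(1)] by simp
  then show "U_act (u \<oplus>\<^bsub>U_alg n\<^esub> u') v = U_act u v \<oplus> U_act u' v"
    using p q v A.add.m_closed[OF p(1) q(1)]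
    by (simp add: U_act_proj free_act_add del: free_algebra_simps(1))
  have "U_proj n p \<otimes>\<^bsub>U_alg n\<^esub> U_proj n q = U_proj n (p * q)"
    using ring_hom_mult[OF U_proj_hom p(1) q(1)] by simp
  then show "U_act (u \<otimes>\<^bsub>U_alg n\<^esub> u') v = U_act u (U_act u' v)"
    using p q v A.m_closed[OF p(1) q(1)] free_act_closed[OF v q(1)]
    by (simp add: U_act_proj free_act_mult del: free_algebra_simps(1))
qed

lemma U_act_gen: "x \<in> sl n \<Longrightarrow> v \<in> carrier M \<Longrightarrow> U_act (U_gen n x) v = act M x v"
  by (simp add: U_gen_proj U_act_proj free_act_gen free_algebra_gen del: free_algebra_simps(1))

lemma U_act_const: "v \<in> carrier M \<Longrightarrow> U_act (U_const n c) v = c \<odot> v"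
  by (simp add: U_const_proj U_act_proj free_act_const free_algebra_const del: free_algebra_simps(1))

end

section \<open>Modules over the localization\<close>

lemma with_act_simps [simp]:
  "carrier (with_act M \<alpha>) = carrier M" "ring.zero (with_act M \<alpha>) = \<zero>\<^bsub>M\<^esub>"
  "add (with_act M \<alpha>) = add M" "smult (with_act M \<alpha>) = smult M" "act (with_act M \<alpha>) = \<alpha>"
  by (simp_all add: with_act_def)

lemma abelian_group_cong:
  assumes "carrier N = carrier M" "add N = add M" "ring.zero N = ring.zero M" "abelian_group M"
  shows "abelian_group N"
proof -
  interpret abelian_group M by fact
  show ?thesis
    by (rule abelian_groupI) (use assms in \<open>auto simp: a_ac intro: l_neg bexI[of _ "\<ominus>\<^bsub>M\<^esub> x" for x]\<close>)
qed

lemma vectorspace_cong: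
  assumes "carrier N = carrier M" "add N = add M" "ring.zero N = ring.zero M" "smult N = smult M"
    and "vectorspace cfield M"
  shows "vectorspace cfield N"
  using vectorspace_smult_simps[OF assms(5)]
    abelian_group_cong[OF assms(1-3) vectorspace_abelian_group[OF assms(5)]]
  by (intro vectorspaceI) (auto simp: assms(1-4))

lemma (in ring) unit_cancel:
  assumes "u \<in> Units R" "x \<in> carrier R"
  shows "inv u \<otimes> (u \<otimes> x) = x" "u \<otimes> (inv u \<otimes> x) = x" "(x \<otimes> u) \<otimes> inv u = x" "(x \<otimes> inv u) \<otimes> u = x"
proof -
  have u: "u \<in> carrier R" "inv u \<in> carrier R" using assms(1) by auto
  show "inv u \<otimes> (u \<otimes> x) = x" "u \<otimes> (inv u \<otimes> x) = x"
    using u assms by (simp_all add: m_assoc[symmetric])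
  show "(x \<otimes> u) \<otimes> inv u = x" "(x \<otimes> inv u) \<otimes> u = x"
    using u assms by (simp_all add: m_assoc)
qed

lemma (in ring) inv_mult_units:
  assumes "u \<in> Units R" "v \<in> Units R"
  shows "inv (u \<otimes> v) = inv v \<otimes> inv u"
  using assms by (intro inv_unique'[symmetric]) (simp_all add: m_assoc unit_cancel Units_closed)

lemma (in ring) inv_commute:
  assumes "u \<in> Units R" "q \<in> carrier R" "u \<otimes> q = q \<otimes> u"
  shows "inv u \<otimes> q = q \<otimes> inv u"
proof -
  have "inv u \<otimes> q = inv u \<otimes> ((q \<otimes> u) \<otimes> inv u)"
    using assms(1,2) by (simp add: unit_cancel)
  also have "\<dots> = inv u \<otimes> (u \<otimes> (q \<otimes> inv u))"
    using assms(1,2) by (simp add: assms(3)[symmetric] m_assoc Units_closed)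
  finally show ?thesis using assms(1,2) by (simp add: unit_cancel)
qed

locale localized =
  fixes n :: nat and Q :: "'q ring" (structure) and \<phi> :: "env \<Rightarrow> 'q"
  assumes localization: "is_localization (U_alg n) (ore_set n) Q \<phi>"
begin

sublocale ring Q using localization by (simp add: is_localization_def)

sublocale U: ring "U_alg n" by (rule U_ring)

abbreviation "gen \<equiv> q_gen n \<phi>"
abbreviation "const \<equiv> q_const n \<phi>"

definition t :: "nat \<Rightarrow> 'q" where "t i = gen (mat_unit n 0 i)"

lemma phi_hom: "\<phi> \<in> Ring.ring_hom (U_alg n) Q"
  using localization by (simp add: is_localization_def)

lemmas phi_closed [simp, intro] = ring_hom_closed[OF phi_hom]
lemmas phi_add = ring_hom_add[OF phi_hom] and phi_mult = ring_hom_mult[OF phi_hom]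
  and phi_one = ring_hom_one[OF phi_hom]

lemma phi_unit: "s \<in> ore_set n \<Longrightarrow> \<phi> s \<in> Units Q"
  using localization by (auto simp: is_localization_def)

lemma gen_closed [simp]: "x \<in> sl n \<Longrightarrow> gen x \<in> carrier Q"
  by (simp add: q_gen_def U_gen_closed)

lemma const_closed [simp]: "const c \<in> carrier Q"
  by (simp add: q_const_def U_const_closed)

lemma const_add: "const (c + d) = const c \<oplus> const d"
  and const_mult: "const (c * d) = const c \<otimes> const d"
  and const_one: "const 1 = \<one>"
  by (simp_all add: q_const_def U_const_add U_const_mult U_const_one phi_add phi_mult phi_one
      U_const_closed)

lemma const_zero: "const 0 = \<zero>"
  using const_add[of 0 0] const_closed[of 0] by (simp add: add.l_cancel_one')

lemma gen_add: "x \<in> sl n \<Longrightarrow> y \<in> sl n \<Longrightarrow> gen (x + y) = gen x \<oplus> gen y"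
  by (simp add: q_gen_def U_gen_add phi_add U_gen_closed)

lemma gen_smult: "x \<in> sl n \<Longrightarrow> gen (c \<cdot>\<^sub>m x) = const c \<otimes> gen x"
  by (simp add: q_gen_def q_const_def U_gen_smult phi_mult U_gen_closed U_const_closed)

lemma gen_bracket:
  assumes "x \<in> sl n" "y \<in> sl n"
  shows "gen x \<otimes> gen y = gen (lie_bracket x y) \<oplus> gen y \<otimes> gen x"
proof -
  note c = U_gen_closed[OF assms(1)] U_gen_closed[OF assms(2)]
  have "\<phi> (U_gen n x \<otimes>\<^bsub>U_alg n\<^esub> U_gen n y) =
      \<phi> (U_gen n (lie_bracket x y) \<oplus>\<^bsub>U_alg n\<^esub> U_gen n y \<otimes>\<^bsub>U_alg n\<^esub> U_gen n x)"
    using U_gen_bracket[OF assms] by simp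
  then show ?thesis
    using c U_gen_closed[OF sl_bracket[OF assms]] by (simp add: q_gen_def phi_mult phi_add)
qed

definition ore_prod :: "(nat \<Rightarrow> nat) \<Rightarrow> nat list \<Rightarrow> env" where
  "ore_prod k js = foldr (\<lambda>j u. (U_gen n (mat_unit n 0 j) [^]\<^bsub>U_alg n\<^esub> k j) \<otimes>\<^bsub>U_alg n\<^esub> u) js \<one>\<^bsub>U_alg n\<^esub>"

lemma ore_prod_simps [simp]:
  "ore_prod k [] = \<one>\<^bsub>U_alg n\<^esub>"
  "ore_prod k (j # js) = (U_gen n (mat_unit n 0 j) [^]\<^bsub>U_alg n\<^esub> k j) \<otimes>\<^bsub>U_alg n\<^esub> ore_prod k js"
  by (simp_all add: ore_prod_def)

lemma ore_setE:
  assumes "s \<in> ore_set n"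
  obtains k js where "set js \<subseteq> {1..n}" "s = ore_prod k js"
proof -
  obtain k where "s = ore_prod k [1..<n + 1]" using assms unfolding ore_set_def ore_prod_def by blast
  then show thesis by (rule that[rotated]) auto
qed

lemma ore_product_closed: "set js \<subseteq> {1..n} \<Longrightarrow> ore_prod k js \<in> carrier (U_alg n)"
  by (induction js) (auto intro!: U.m_closed U.nat_pow_closed U_gen_closed mat_unit_sl)

lemma ore_set_closed: "s \<in> ore_set n \<Longrightarrow> s \<in> carrier (U_alg n)"
  by (metis ore_setE ore_product_closed)

lemma ore_set_unit:
  assumes "i \<in> {1..n}"
  shows "U_gen n (mat_unit n 0 i) \<in> ore_set n"
proof -
  let ?k = "\<lambda>j. if j = i then 1 else 0 :: nat"
  have c: "U_gen n (mat_unit n 0 j) \<in> carrier (U_alg n)" if "j \<in> {1..n}" for j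
    using that by (intro U_gen_closed mat_unit_sl) auto
  have "distinct js \<Longrightarrow> set js \<subseteq> {1..n} \<Longrightarrow>
      ore_prod ?k js =
      (if i \<in> set js then U_gen n (mat_unit n 0 i) else \<one>\<^bsub>U_alg n\<^esub>)" for js
    by (induction js) (use c assms in auto)
  from this[of "[1..<n + 1]"] assms have "U_gen n (mat_unit n 0 i) = ore_prod ?k [1..<n + 1]"
    by (simp del: upt_Suc) (metis atLeastLessThanSuc_atLeastAtMost order_refl)
  then show ?thesis unfolding ore_set_def ore_prod_def by (intro CollectI exI[of _ ?k] conjI TrueI)
qed

lemma t_unit: "i \<in> {1..n} \<Longrightarrow> t i \<in> Units Q"
  using phi_unit[OF ore_set_unit] by (simp add: t_def q_gen_def)

lemma t_closed [simp]: "i \<in> {1..n} \<Longrightarrow> t i \<in> carrier Q" "i \<in> {1..n} \<Longrightarrow> inv (t i) \<in> carrier Q"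
  using t_unit by auto

text \<open>Every element of the localization is built from scalars, the Lie algebra and the inverses of
  the \<open>t i\<close>.\<close>

lemma Q_induct [consumes 1, case_names add mult const gen inv_t]:
  assumes q: "q \<in> carrier Q"
    and add: "\<And>a b. a \<in> carrier Q \<Longrightarrow> b \<in> carrier Q \<Longrightarrow> P a \<Longrightarrow> P b \<Longrightarrow> P (a \<oplus> b)"
    and mult: "\<And>a b. a \<in> carrier Q \<Longrightarrow> b \<in> carrier Q \<Longrightarrow> P a \<Longrightarrow> P b \<Longrightarrow> P (a \<otimes> b)"
    and const: "\<And>c. P (const c)"
    and gen: "\<And>x. x \<in> sl n \<Longrightarrow> P (gen x)"
    and inv_t: "\<And>i. i \<in> {1..n} \<Longrightarrow> P (inv (t i))"
  shows "P q"
proof -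
  have P_phi: "P (\<phi> u)" if "u \<in> carrier (U_alg n)" for u
    using that
  proof (induction u rule: U_induct)
    case (add u v)
    then show ?case using assms(2)[of "\<phi> u" "\<phi> v"] by (simp add: phi_add)
  next
    case (mult u v)
    then show ?case using assms(3)[of "\<phi> u" "\<phi> v"] by (simp add: phi_mult)
  qed (use const gen in \<open>simp_all add: q_const_def q_gen_def\<close>)
  have one: "P \<one>" using const[of 1] by (simp add: const_one)
  have pow: "P (inv (t i [^] (k::nat)))" if i: "i \<in> {1..n}" for i k
  proof (induction k)
    case (Suc k)
    have "inv (t i [^] Suc k) = inv (t i) \<otimes> inv (t i [^] k)"
      using t_unit[OF i] Units_pow_closed[OF t_unit[OF i], of k] by (simp add: inv_mult_units)
    then show ?case using mult[OF _ _ inv_t[OF i] Suc] t_unit[OF i] Units_pow_closed[OF t_unit[OF i], of k]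
      by simp
  qed (simp add: one)
  have P_inv: "\<phi> s \<in> Units Q \<and> P (inv (\<phi> s))"
    if "set js \<subseteq> {1..n}" and
      "s = ore_prod k js"
    for js s k
    using that
  proof (induction js arbitrary: s)
    case Nil
    then show ?case by (simp add: phi_one one)
  next
    case (Cons j js)
    let ?g = "U_gen n (mat_unit n 0 j)"
    let ?s = "ore_prod k js"
    have j: "j \<in> {1..n}" and js: "set js \<subseteq> {1..n}" using Cons by auto
    have g: "?g \<in> carrier (U_alg n)" using j by (intro U_gen_closed mat_unit_sl) auto
    have "\<phi> (?g [^]\<^bsub>U_alg n\<^esub> m) = t j [^] m" for m :: nat
      by (induction m) (use g in \<open>simp_all add: phi_one phi_mult t_def q_gen_def\<close>)
    then have s: "\<phi> s = t j [^] k j \<otimes> \<phi> ?s"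
      using Cons.prems g ore_product_closed[OF js, of k] by (simp add: phi_mult)
    have u: "t j [^] k j \<in> Units Q" using Units_pow_closed[OF t_unit[OF j]] .
    have IH: "\<phi> ?s \<in> Units Q" "P (inv (\<phi> ?s))" using Cons.IH[OF js refl] by auto
    have "inv (\<phi> s) = inv (\<phi> ?s) \<otimes> inv (t j [^] k j)"
      unfolding s using inv_mult_units[OF u IH(1)] .
    then show ?case
      using mult[OF _ _ IH(2) pow[OF j, of "k j"]] u IH(1) by (simp add: s Units_m_closed)
  qed
  obtain r s where rs: "r \<in> carrier (U_alg n)" "s \<in> ore_set n" "q = \<phi> r \<otimes> inv (\<phi> s)"
    using q localization unfolding is_localization_def by blast
  have "P (inv (\<phi> s))"
    using rs(2) P_inv by (metis ore_setE)
  then show ?thesis using mult[OF _ _ P_phi[OF rs(1)]] rs phi_unit[OF rs(2)] by simp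
qed

lemma const_central: "q \<in> carrier Q \<Longrightarrow> const c \<otimes> q = q \<otimes> const c"
proof (induction q rule: Q_induct)
  case (add a b)
  then show ?case by (simp add: l_distr r_distr)
next
  case (mult a b)
  then show ?case by (metis const_closed m_assoc)
next
  case (const d)
  then show ?case by (metis const_mult mult.commute)
next
  case (gen x)
  then show ?case
    using U_const_central[OF U_gen_closed[OF gen], of c]
    by (metis U_const_closed U_gen_closed phi_mult q_const_def q_gen_def)
next
  case (inv_t i)
  then have "t i \<otimes> const c = const c \<otimes> t i"
    using U_const_central[OF U_gen_closed[OF mat_unit_sl[of 0 n i]], of c]
    by (metis U_const_closed U_gen_closed phi_mult q_const_def q_gen_def mat_unit_sl t_def
        atLeastAtMost_iff le0 not_one_le_zero)
  from inv_commute[OF t_unit[OF inv_t] _ this] show ?case by simp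
qed

text \<open>Right fractions are used in the form \<open>q s = r\<close>, which needs no inverse.\<close>

lemma fraction:
  assumes "q \<in> carrier Q"
  obtains r s where "r \<in> carrier (U_alg n)" "s \<in> ore_set n" "q \<otimes> \<phi> s = \<phi> r"
proof -
  obtain r s where rs: "r \<in> carrier (U_alg n)" "s \<in> ore_set n" "q = \<phi> r \<otimes> inv (\<phi> s)"
    using assms localization unfolding is_localization_def by blast
  then have "q \<otimes> \<phi> s = \<phi> r" using phi_unit[OF rs(2)] by (simp add: unit_cancel)
  then show thesis using that rs by blast
qed

lemma phi_eqD:
  assumes "r \<in> carrier (U_alg n)" "r' \<in> carrier (U_alg n)" "\<phi> r = \<phi> r'"
  obtains s where "s \<in> ore_set n" "r \<otimes>\<^bsub>U_alg n\<^esub> s = r' \<otimes>\<^bsub>U_alg n\<^esub> s"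
proof -
  have "\<phi> (r \<ominus>\<^bsub>U_alg n\<^esub> r') \<oplus> \<phi> r' = \<phi> r"
    using phi_add[of "r \<ominus>\<^bsub>U_alg n\<^esub> r'" r'] assms by (simp add: U.add_diff_cancel)
  then have "\<phi> (r \<ominus>\<^bsub>U_alg n\<^esub> r') = \<zero>"
    using assms by (simp add: add.l_cancel_one')
  then obtain s where s: "s \<in> ore_set n" "(r \<ominus>\<^bsub>U_alg n\<^esub> r') \<otimes>\<^bsub>U_alg n\<^esub> s = \<zero>\<^bsub>U_alg n\<^esub>"
    using localization assms unfolding is_localization_def by (metis U.minus_closed)
  have "r \<otimes>\<^bsub>U_alg n\<^esub> s = ((r \<ominus>\<^bsub>U_alg n\<^esub> r') \<oplus>\<^bsub>U_alg n\<^esub> r') \<otimes>\<^bsub>U_alg n\<^esub> s"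
    using assms by (simp add: U.add_diff_cancel)
  also have "\<dots> = r' \<otimes>\<^bsub>U_alg n\<^esub> s"
    using assms s ore_set_closed[OF s(1)] by (simp only: U.l_distr U.minus_closed) simp
  finally show thesis using that s by blast
qed

end

text \<open>A module on which the denominators act bijectively carries an action of the right fractions:
  \<open>r s\<^sup>-\<^sup>1\<close> sends \<open>s v\<close> to \<open>r v\<close>.\<close>

locale localized_rep = localized n Q \<phi> + M: sl_rep n M
  for n :: nat and Q :: "'q ring" (structure) and \<phi> :: "env \<Rightarrow> 'q" and M :: "(complex mat, 'm) rep" +
  assumes bij: "i \<in> {1..n} \<Longrightarrow> bij_betw (act M (mat_unit n 0 i)) (carrier M) (carrier M)"
begin

abbreviation "uact \<equiv> sl_rep.U_act n M"

lemma ore_bij: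
  assumes "s \<in> ore_set n"
  shows "bij_betw (uact s) (carrier M) (carrier M)"
proof -
  have one: "bij_betw (uact \<one>\<^bsub>U_alg n\<^esub>) (carrier M) (carrier M)"
  proof -
    have "bij_betw (uact \<one>\<^bsub>U_alg n\<^esub>) (carrier M) (carrier M) \<longleftrightarrow> bij_betw id (carrier M) (carrier M)"
      by (rule bij_betw_cong) (simp add: U_const_one[symmetric] M.U_act_const M.sm)
    then show ?thesis by simp
  qed
  have mult: "bij_betw (uact (u \<otimes>\<^bsub>U_alg n\<^esub> u')) (carrier M) (carrier M)"
    if "u \<in> carrier (U_alg n)" "u' \<in> carrier (U_alg n)" "bij_betw (uact u) (carrier M) (carrier M)"
      "bij_betw (uact u') (carrier M) (carrier M)" for u u'
  proof -
    have "bij_betw (uact (u \<otimes>\<^bsub>U_alg n\<^esub> u')) (carrier M) (carrier M) \<longleftrightarrow>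
        bij_betw (uact u \<circ> uact u') (carrier M) (carrier M)"
      by (rule bij_betw_cong) (simp add: M.U_act_mult that)
    then show ?thesis using bij_betw_trans[OF that(4,3)] by simp
  qed
  have pow: "bij_betw (uact (U_gen n (mat_unit n 0 j) [^]\<^bsub>U_alg n\<^esub> k)) (carrier M) (carrier M)"
    if j: "j \<in> {1..n}" for j and k :: nat
  proof -
    have sl: "mat_unit n 0 j \<in> sl n" using j by (intro mat_unit_sl) auto
    have "bij_betw (uact (U_gen n (mat_unit n 0 j))) (carrier M) (carrier M) \<longleftrightarrow>
        bij_betw (act M (mat_unit n 0 j)) (carrier M) (carrier M)"
      by (rule bij_betw_cong) (simp add: M.U_act_gen sl)
    then show ?thesis
      by (induction k) (use bij[OF j] one mult U_gen_closed[OF sl] in auto)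
  qed
  have "set js \<subseteq> {1..n} \<Longrightarrow> bij_betw (uact (ore_prod k js))
      (carrier M) (carrier M)" for js k
  proof (induction js)
    case (Cons j js)
    then show ?case
      using mult pow ore_product_closed[of js k]
      by (auto intro!: mult pow U.nat_pow_closed U_gen_closed mat_unit_sl)
  qed (simp add: one)
  then show ?thesis using assms by (metis ore_setE)
qed

lemma ore_surj:
  assumes "s \<in> ore_set n" "v \<in> carrier M"
  obtains w where "w \<in> carrier M" "v = uact s w"
  using ore_bij[OF assms(1)] assms(2) unfolding bij_betw_def by blast

lemma uact_phi_eq:
  assumes "r \<in> carrier (U_alg n)" "r' \<in> carrier (U_alg n)" "\<phi> r = \<phi> r'" "v \<in> carrier M"
  shows "uact r v = uact r' v"
proof -
  obtain s where s: "s \<in> ore_set n" "r \<otimes>\<^bsub>U_alg n\<^esub> s = r' \<otimes>\<^bsub>U_alg n\<^esub> s" using phi_eqD assms by blast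
  obtain w where w: "w \<in> carrier M" "v = uact s w" using ore_surj[OF s(1) assms(4)] .
  show ?thesis unfolding w(2) using M.U_act_mult[OF _ ore_set_closed[OF s(1)] w(1)] assms s by metis
qed

definition frac :: "'q \<Rightarrow> env \<times> env" where
  "frac q = (SOME (r, s). r \<in> carrier (U_alg n) \<and> s \<in> ore_set n \<and> q \<otimes> \<phi> s = \<phi> r)"

definition qact :: "'q \<Rightarrow> 'm \<Rightarrow> 'm" where
  "qact q v = uact (fst (frac q)) (inv_into (carrier M) (uact (snd (frac q))) v)"

lemma frac: "q \<in> carrier Q \<Longrightarrow> fst (frac q) \<in> carrier (U_alg n) \<and> snd (frac q) \<in> ore_set n \<and>
    q \<otimes> \<phi> (snd (frac q)) = \<phi> (fst (frac q))"
proof -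
  assume "q \<in> carrier Q"
  then obtain r s where "r \<in> carrier (U_alg n)" "s \<in> ore_set n" "q \<otimes> \<phi> s = \<phi> r"
    by (rule fraction)
  then have "(\<lambda>(r, s). r \<in> carrier (U_alg n) \<and> s \<in> ore_set n \<and> q \<otimes> \<phi> s = \<phi> r) (r, s)" by simp
  then have "(\<lambda>(r, s). r \<in> carrier (U_alg n) \<and> s \<in> ore_set n \<and> q \<otimes> \<phi> s = \<phi> r) (frac q)"
    unfolding frac_def by (rule someI)
  then show ?thesis by (simp only: split_beta)
qed

text \<open>The operator of \<open>q\<close> is defined by one chosen fraction, but it satisfies every equation \<open>q x = y\<close>
  with \<open>x\<close> and \<open>y\<close> in the enveloping algebra: if \<open>q = r s\<^sup>-\<^sup>1\<close> and \<open>s\<^sup>-\<^sup>1 x = c d\<^sup>-\<^sup>1\<close>, then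
  \<open>x d = s c\<close> and \<open>r c = y d\<close> hold up to right factors from the Ore set, so they hold for the operators.
  Sums and products then follow by finding common denominators.\<close>

lemma qact_eq:
  assumes q: "q \<in> carrier Q" and x: "x \<in> carrier (U_alg n)" and y: "y \<in> carrier (U_alg n)"
    and eq: "q \<otimes> \<phi> x = \<phi> y" and v: "v \<in> carrier M"
  shows "qact q (uact x v) = uact y v"
proof -
  define r s where "r = fst (frac q)" and "s = snd (frac q)"
  have rs: "r \<in> carrier (U_alg n)" "s \<in> ore_set n" "q \<otimes> \<phi> s = \<phi> r"
    using frac[OF q] by (auto simp: r_def s_def)
  note sc = ore_set_closed[OF rs(2)] and su = phi_unit[OF rs(2)]
  have def: "qact q (uact s w) = uact r w" if "w \<in> carrier M" for w
    using that ore_bij[OF rs(2)] by (simp add: qact_def r_def[symmetric] s_def[symmetric] bij_betw_def)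
  obtain c d where cd: "c \<in> carrier (U_alg n)" "d \<in> ore_set n" "inv (\<phi> s) \<otimes> \<phi> x \<otimes> \<phi> d = \<phi> c"
    using fraction[of "inv (\<phi> s) \<otimes> \<phi> x"] su x by auto
  note dc = ore_set_closed[OF cd(2)]
  have "\<phi> s \<otimes> \<phi> c = \<phi> x \<otimes> \<phi> d"
    using su x dc by (simp add: cd(3)[symmetric] m_assoc unit_cancel)
  then have 1: "\<phi> (x \<otimes>\<^bsub>U_alg n\<^esub> d) = \<phi> (s \<otimes>\<^bsub>U_alg n\<^esub> c)" using x dc sc cd by (simp add: phi_mult)
  have "\<phi> r \<otimes> \<phi> c = q \<otimes> (\<phi> s \<otimes> \<phi> c)" using rs(3) q sc cd by (simp add: m_assoc[symmetric])
  also have "\<dots> = \<phi> y \<otimes> \<phi> d" using \<open>\<phi> s \<otimes> \<phi> c = _\<close> q x dc eq by (simp add: m_assoc[symmetric])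
  finally have 2: "\<phi> (r \<otimes>\<^bsub>U_alg n\<^esub> c) = \<phi> (y \<otimes>\<^bsub>U_alg n\<^esub> d)" using y dc rs cd by (simp add: phi_mult)
  obtain w where w: "w \<in> carrier M" "v = uact d w" using ore_surj[OF cd(2) v] .
  have "uact x v = uact s (uact c w)"
    using uact_phi_eq[OF _ _ 1 w(1)] x dc sc cd w by (simp add: M.U_act_mult)
  moreover have "uact r (uact c w) = uact y v"
    using uact_phi_eq[OF _ _ 2 w(1)] y dc rs cd w by (simp add: M.U_act_mult)
  ultimately show ?thesis using def[of "uact c w"] w cd by (simp add: M.U_act_simps)
qed

lemma qact_op: assumes q: "q \<in> carrier Q" shows "qact q \<in> module_hom cfield M M"
proof -
  obtain r s where rs: "r \<in> carrier (U_alg n)" "s \<in> ore_set n" "q \<otimes> \<phi> s = \<phi> r"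
    using fraction[OF q] .
  note eq = qact_eq[OF q ore_set_closed[OF rs(2)] rs(1,3)]
  note sc = ore_set_closed[OF rs(2)]
  have "qact q v \<in> carrier M \<and> qact q (c \<odot>\<^bsub>M\<^esub> v) = c \<odot>\<^bsub>M\<^esub> qact q v" if v: "v \<in> carrier M" for v c
  proof -
    obtain a where a: "a \<in> carrier M" "v = uact s a" using ore_surj[OF rs(2) v] .
    then have "c \<odot>\<^bsub>M\<^esub> v = uact s (c \<odot>\<^bsub>M\<^esub> a)" using sc by (simp add: M.U_act_simps)
    then have "qact q (c \<odot>\<^bsub>M\<^esub> v) = uact r (c \<odot>\<^bsub>M\<^esub> a)" using a eq M.sm(1) by metis
    then show ?thesis using a rs sc eq by (simp add: M.U_act_simps M.sm)
  qed
  moreover have "qact q (v \<oplus>\<^bsub>M\<^esub> w) = qact q v \<oplus>\<^bsub>M\<^esub> qact q w"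
    if v: "v \<in> carrier M" and w: "w \<in> carrier M" for v w
  proof -
    obtain a where a: "a \<in> carrier M" "v = uact s a" using ore_surj[OF rs(2) v] .
    obtain b where b: "b \<in> carrier M" "w = uact s b" using ore_surj[OF rs(2) w] .
    then have e: "v \<oplus>\<^bsub>M\<^esub> w = uact s (a \<oplus>\<^bsub>M\<^esub> b)" using a sc by (simp add: M.U_act_simps)
    have "qact q (v \<oplus>\<^bsub>M\<^esub> w) = uact r (a \<oplus>\<^bsub>M\<^esub> b)" unfolding e using eq a b by simp
    then show ?thesis using a b rs sc eq by (simp add: M.U_act_simps)
  qed
  ultimately show ?thesis by (auto simp: module_hom_iff)
qed

lemma qact_add:
  assumes p: "p \<in> carrier Q" and q: "q \<in> carrier Q" and v: "v \<in> carrier M"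
  shows "qact (p \<oplus> q) v = qact p v \<oplus>\<^bsub>M\<^esub> qact q v"
proof -
  obtain r s where rs: "r \<in> carrier (U_alg n)" "s \<in> ore_set n" "p \<otimes> \<phi> s = \<phi> r" using fraction[OF p] .
  note sc = ore_set_closed[OF rs(2)]
  obtain a d where ad: "a \<in> carrier (U_alg n)" "d \<in> ore_set n" "q \<otimes> \<phi> s \<otimes> \<phi> d = \<phi> a"
    using fraction[of "q \<otimes> \<phi> s"] q sc by auto
  note dc = ore_set_closed[OF ad(2)]
  have e: "p \<otimes> \<phi> (s \<otimes>\<^bsub>U_alg n\<^esub> d) = \<phi> (r \<otimes>\<^bsub>U_alg n\<^esub> d)" "q \<otimes> \<phi> (s \<otimes>\<^bsub>U_alg n\<^esub> d) = \<phi> a"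
    using p q sc dc rs ad by (simp_all add: phi_mult m_assoc[symmetric])
  then have 3: "(p \<oplus> q) \<otimes> \<phi> (s \<otimes>\<^bsub>U_alg n\<^esub> d) = \<phi> (r \<otimes>\<^bsub>U_alg n\<^esub> d \<oplus>\<^bsub>U_alg n\<^esub> a)"
    using p q sc dc rs ad by (simp add: l_distr phi_add)
  obtain w' where w': "w' \<in> carrier M" "v = uact s w'" using ore_surj[OF rs(2) v] .
  obtain w where w: "w \<in> carrier M" "w' = uact d w" using ore_surj[OF ad(2) w'(1)] .
  have "v = uact (s \<otimes>\<^bsub>U_alg n\<^esub> d) w" using w w' sc dc by (simp add: M.U_act_mult)
  then show ?thesis
    using qact_eq[OF _ _ _ 3 w(1)] qact_eq[OF _ _ _ e(1) w(1)] qact_eq[OF _ _ _ e(2) w(1)] p q sc dc rs ad w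
    by (simp add: M.U_act_add)
qed

lemma qact_mult:
  assumes p: "p \<in> carrier Q" and q: "q \<in> carrier Q" and v: "v \<in> carrier M"
  shows "qact (p \<otimes> q) v = qact p (qact q v)"
proof -
  obtain r s where rs: "r \<in> carrier (U_alg n)" "s \<in> ore_set n" "q \<otimes> \<phi> s = \<phi> r" using fraction[OF q] .
  note sc = ore_set_closed[OF rs(2)]
  obtain a d where ad: "a \<in> carrier (U_alg n)" "d \<in> ore_set n" "p \<otimes> \<phi> r \<otimes> \<phi> d = \<phi> a"
    using fraction[of "p \<otimes> \<phi> r"] p rs by auto
  note dc = ore_set_closed[OF ad(2)]
  have 1: "q \<otimes> \<phi> (s \<otimes>\<^bsub>U_alg n\<^esub> d) = \<phi> (r \<otimes>\<^bsub>U_alg n\<^esub> d)" "p \<otimes> \<phi> (r \<otimes>\<^bsub>U_alg n\<^esub> d) = \<phi> a"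
    using p q sc dc rs ad by (simp_all add: phi_mult m_assoc[symmetric])
  have 2: "p \<otimes> q \<otimes> \<phi> (s \<otimes>\<^bsub>U_alg n\<^esub> d) = \<phi> a"
    using 1 p q sc dc rs by (simp add: m_assoc)
  obtain w' where w': "w' \<in> carrier M" "v = uact s w'" using ore_surj[OF rs(2) v] .
  obtain w where w: "w \<in> carrier M" "w' = uact d w" using ore_surj[OF ad(2) w'(1)] .
  have "v = uact (s \<otimes>\<^bsub>U_alg n\<^esub> d) w" using w w' sc dc by (simp add: M.U_act_mult)
  then show ?thesis
    using qact_eq[OF _ _ _ 2 w(1)] qact_eq[OF _ _ _ 1(1) w(1)] qact_eq[OF _ _ _ 1(2) w(1)] p q sc dc rs ad
    by simp
qed

lemma qact_phi: "u \<in> carrier (U_alg n) \<Longrightarrow> v \<in> carrier M \<Longrightarrow> qact (\<phi> u) v = uact u v"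
  using qact_eq[of "\<phi> u" "\<one>\<^bsub>U_alg n\<^esub>" u v]
  by (simp add: phi_one U_const_one[symmetric] M.U_act_const M.sm)
    (simp add: U_const_one phi_one)

lemma ex_loc_action:
  "\<exists>\<alpha>. alg_module n Q \<phi> (carrier Q) (with_act M \<alpha>) \<and>
     (\<forall>x \<in> sl n. \<forall>v \<in> carrier M. \<alpha> (q_gen n \<phi> x) v = act M x v)"
proof (intro exI conjI ballI)
  show "alg_module n Q \<phi> (carrier Q) (with_act M qact)"
    unfolding alg_module_def
  proof (intro conjI ballI allI)
    show "vectorspace cfield (with_act M qact)"
      by (rule vectorspace_cong[OF _ _ _ _ M.vectorspace_axioms]) simp_all
    fix a v assume "a \<in> carrier Q"
    then show "act (with_act M qact) a \<in> module_hom cfield (with_act M qact) (with_act M qact)"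
      using qact_op by (simp add: module_hom_iff)
  next
    fix v assume "v \<in> carrier (with_act M qact)"
    then show "act (with_act M qact) \<one> v = v"
      using qact_phi[of "\<one>\<^bsub>U_alg n\<^esub>" v] M.U_act_const[of v 1] by (simp add: phi_one U_const_one M.sm)
  next
    fix c v assume "v \<in> carrier (with_act M qact)"
    then show "act (with_act M qact) (const c) v = c \<odot>\<^bsub>with_act M qact\<^esub> v"
      using qact_phi[of "U_const n c" v] by (simp add: q_const_def U_const_closed M.U_act_const)
  qed (simp_all add: qact_add qact_mult)
  show "qact (q_gen n \<phi> x) v = act M x v" if "x \<in> sl n" "v \<in> carrier M" for x v
    using that by (simp add: q_gen_def qact_phi U_gen_closed M.U_act_gen)
qed

end

section \<open>The localization as a module under conjugation\<close>

lemma a_minus_cong: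
  assumes "carrier N = carrier M" "add N = add M" "ring.zero N = ring.zero M"
  shows "a_inv N = a_inv M" "a_minus N = a_minus M"
proof -
  show 1: "a_inv N = a_inv M" using assms by (simp add: a_inv_def m_inv_def fun_eq_iff)
  show "a_minus N = a_minus M" using assms by (simp add: a_minus_def fun_eq_iff 1)
qed

context localized begin

lemma gen_zero_smult: "x \<in> sl n \<Longrightarrow> gen (0 \<cdot>\<^sub>m x) = \<zero>"
  by (simp add: gen_smult const_zero)

lemma const_mult_left: "a \<in> carrier Q \<Longrightarrow> b \<in> carrier Q \<Longrightarrow> a \<otimes> (const c \<otimes> b) = const c \<otimes> (a \<otimes> b)"
  by (metis const_central const_closed m_assoc)

lemma const_minus: "const (- c) = \<ominus> const c"
  using const_add[of "- c" c] by (simp add: const_zero minus_equality)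

lemma t_sl: "i \<in> {1..n} \<Longrightarrow> mat_unit n 0 i \<in> sl n"
  by (intro mat_unit_sl) auto

lemma t_t: "i \<in> {1..n} \<Longrightarrow> j \<in> {1..n} \<Longrightarrow> t i \<otimes> t j = t j \<otimes> t i"
  using gen_bracket[OF t_sl t_sl, of i j]
  by (simp add: unit_bracket_zero gen_zero_smult t_sl flip: t_def)

lemma cartan_t:
  "x \<in> cartan n \<Longrightarrow> j \<in> {1..n} \<Longrightarrow>
    gen x \<otimes> t j = const (x $$ (0, 0) - x $$ (j, j)) \<otimes> t j \<oplus> t j \<otimes> gen x"
  using gen_bracket[OF cartan_sl t_sl, of x j]
  by (simp add: cartan_bracket_unit gen_smult t_sl flip: t_def)

lemma cartan_cartan: "x \<in> cartan n \<Longrightarrow> y \<in> cartan n \<Longrightarrow> gen x \<otimes> gen y = gen y \<otimes> gen x"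
  using gen_bracket[OF cartan_sl cartan_sl, of x y]
  by (simp add: cartan_bracket_cartan gen_zero_smult cartan_sl)

definition h :: "nat \<Rightarrow> 'q" where "h i = gen (cartan_dual n i)"

lemma h_closed [simp]: "i \<in> {1..n} \<Longrightarrow> h i \<in> carrier Q"
  by (simp add: h_def cartan_sl cartan_dual_cartan)

lemma h_h: "i \<in> {1..n} \<Longrightarrow> j \<in> {1..n} \<Longrightarrow> h i \<otimes> h j = h j \<otimes> h i"
  by (simp add: h_def cartan_cartan cartan_dual_cartan)

lemma h_t:
  assumes i: "i \<in> {1..n}" and j: "j \<in> {1..n}"
  shows "t j \<otimes> h i = (if i = j then h i \<otimes> t j \<oplus> t j else h i \<otimes> t j)"
proof -
  have "cartan_dual n i $$ (0, 0) - cartan_dual n i $$ (j, j) = (if i = j then - 1 else 0)"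
    using i j by (simp add: cartan_dual_index)
  then have e: "h i \<otimes> t j = const (if i = j then - 1 else 0) \<otimes> t j \<oplus> t j \<otimes> h i"
    using cartan_t[OF cartan_dual_cartan j, of i] i by (simp add: h_def)
  show ?thesis
  proof (cases "i = j")
    case True
    then have "h i \<otimes> t j = \<ominus> t j \<oplus> t j \<otimes> h i"
      using e j by (simp add: const_minus const_one l_minus)
    then have "h i \<otimes> t j \<oplus> t j = t j \<otimes> h i"
      using i j by (simp add: a_ac r_neg1 r_neg2 l_neg r_neg)
    then show ?thesis using True by simp
  next
    case False
    then show ?thesis using e i j by (simp add: const_zero)
  qed
qed

definition Q_space :: "(complex, 'q) module" where
  "Q_space = \<lparr>carrier = carrier Q, monoid.mult = (\<otimes>), one = \<one>, ring.zero = \<zero>, add = (\<oplus>),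
    smult = (\<lambda>c q. const c \<otimes> q)\<rparr>"

lemma Q_space_simps [simp]:
  "carrier Q_space = carrier Q" "ring.zero Q_space = \<zero>" "add Q_space = (\<oplus>)"
  "smult Q_space = (\<lambda>c q. const c \<otimes> q)" "a_inv Q_space = a_inv Q" "a_minus Q_space = a_minus Q"
  by (auto simp: Q_space_def intro: a_minus_cong)

lemma Q_vectorspace: "vectorspace cfield Q_space"
proof (rule vectorspaceI)
  show "abelian_group Q_space"
    by (rule abelian_group_cong[OF _ _ _ abelian_group_axioms]) simp_all
qed (simp_all add: const_add const_mult const_one l_distr r_distr m_assoc)

definition conj :: "nat \<Rightarrow> 'q \<Rightarrow> 'q" where
  "conj i q = t i \<otimes> q \<otimes> inv (t i)"

lemma conj_closed [simp]: "i \<in> {1..n} \<Longrightarrow> q \<in> carrier Q \<Longrightarrow> conj i q \<in> carrier Q"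
  by (simp add: conj_def)

lemma conj_add: "i \<in> {1..n} \<Longrightarrow> a \<in> carrier Q \<Longrightarrow> b \<in> carrier Q \<Longrightarrow> conj i (a \<oplus> b) = conj i a \<oplus> conj i b"
  by (simp add: conj_def l_distr r_distr)

lemma conj_mult: "i \<in> {1..n} \<Longrightarrow> a \<in> carrier Q \<Longrightarrow> b \<in> carrier Q \<Longrightarrow> conj i (a \<otimes> b) = conj i a \<otimes> conj i b"
  by (simp add: conj_def m_assoc unit_cancel t_unit)

lemma conj_eq_iff:
  assumes "i \<in> {1..n}" "q \<in> carrier Q" "r \<in> carrier Q"
  shows "conj i q = r \<longleftrightarrow> t i \<otimes> q = r \<otimes> t i"
proof
  assume "conj i q = r"
  then show "t i \<otimes> q = r \<otimes> t i" using assms unit_cancel(4)[OF t_unit[OF assms(1)], of "t i \<otimes> q"]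
    by (simp add: conj_def)
next
  assume "t i \<otimes> q = r \<otimes> t i"
  then show "conj i q = r" using assms unit_cancel(3)[OF t_unit[OF assms(1)], of r] by (simp add: conj_def)
qed

lemma conj_const: "i \<in> {1..n} \<Longrightarrow> conj i (const c) = const c"
  by (simp add: conj_eq_iff const_central)

lemma conj_t: "i \<in> {1..n} \<Longrightarrow> j \<in> {1..n} \<Longrightarrow> conj i (t j) = t j"
  by (simp add: conj_eq_iff t_t)

lemma conj_inv_t: "i \<in> {1..n} \<Longrightarrow> j \<in> {1..n} \<Longrightarrow> conj i (inv (t j)) = inv (t j)"
  using inv_commute[OF t_unit, of j "t i"] by (simp add: conj_eq_iff t_t)

lemma conj_conj:
  assumes "i \<in> {1..n}" "j \<in> {1..n}" "q \<in> carrier Q"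
  shows "conj i (conj j q) = conj j (conj i q)"
proof -
  have 1: "conj i (conj j q) = t i \<otimes> t j \<otimes> q \<otimes> (inv (t j) \<otimes> inv (t i))" if "i \<in> {1..n}" "j \<in> {1..n}" for i j
    using that assms(3) by (simp add: conj_def m_assoc)
  have "inv (t j) \<otimes> inv (t i) = inv (t i) \<otimes> inv (t j)"
    using inv_mult_units[OF t_unit t_unit] t_t assms(1,2) by metis
  then show ?thesis using 1 t_t assms by simp
qed

lemma conj_h:
  assumes "i \<in> {1..n}" "j \<in> {1..n}"
  shows "conj i (h j) = (if i = j then h j \<oplus> \<one> else h j)"
  using assms h_t[of j i] by (simp add: conj_eq_iff l_distr)

abbreviation conj_diff :: "nat \<Rightarrow> 'q \<Rightarrow> 'q" where
  "conj_diff i q \<equiv> conj i q \<ominus> q"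

lemma conj_diff_add:
  "i \<in> {1..n} \<Longrightarrow> a \<in> carrier Q \<Longrightarrow> b \<in> carrier Q \<Longrightarrow> conj_diff i (a \<oplus> b) = conj_diff i a \<oplus> conj_diff i b"
  by (simp add: conj_add minus_eq minus_add a_ac)

lemma conj_diff_pow_closed: "i \<in> {1..n} \<Longrightarrow> a \<in> carrier Q \<Longrightarrow> (conj_diff i ^^ k) a \<in> carrier Q"
  by (induction k) auto

lemma conj_diff_pow_add:
  "i \<in> {1..n} \<Longrightarrow> a \<in> carrier Q \<Longrightarrow> b \<in> carrier Q \<Longrightarrow>
    (conj_diff i ^^ k) (a \<oplus> b) = (conj_diff i ^^ k) a \<oplus> (conj_diff i ^^ k) b"
  by (induction k) (auto simp: conj_diff_add conj_diff_pow_closed)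

lemma conj_diff_zero: "i \<in> {1..n} \<Longrightarrow> conj_diff i \<zero> = \<zero>"
  by (simp add: conj_def)

lemma conj_diff_pow_mono:
  "i \<in> {1..n} \<Longrightarrow> (conj_diff i ^^ k) a = \<zero> \<Longrightarrow> k \<le> l \<Longrightarrow> (conj_diff i ^^ l) a = \<zero>"
  by (induction l) (auto simp: conj_diff_zero le_Suc_eq)

lemma conj_diff_mult:
  assumes i: "i \<in> {1..n}" and a: "a \<in> carrier Q" and b: "b \<in> carrier Q"
  shows "conj_diff i (a \<otimes> b) = conj_diff i a \<otimes> b \<oplus> a \<otimes> conj_diff i b \<oplus> conj_diff i a \<otimes> conj_diff i b"
proof -
  define x y where "x = conj_diff i a" and "y = conj_diff i b"
  have c: "x \<in> carrier Q" "y \<in> carrier Q" using assms by (auto simp: x_def y_def)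
  have "conj i a = x \<oplus> a" "conj i b = y \<oplus> b" using assms by (simp_all add: x_def y_def add_diff_cancel)
  then have "conj_diff i (a \<otimes> b) = (x \<oplus> a) \<otimes> (y \<oplus> b) \<ominus> a \<otimes> b"
    using assms by (simp add: conj_mult)
  also have "(x \<oplus> a) \<otimes> (y \<oplus> b) = a \<otimes> b \<oplus> (x \<otimes> b \<oplus> a \<otimes> y \<oplus> x \<otimes> y)"
    using c a b by (simp add: l_distr r_distr a_ac)
  finally show ?thesis using c a b by (simp add: add_diff_cancel x_def y_def)
qed

text \<open>The Leibniz rule \<open>conj_diff_mult\<close> lowers the nilpotency degree of one of the factors in each of its
  three terms.\<close>

lemma conj_diff_nilp_mult:
  assumes i: "i \<in> {1..n}"
  shows "a \<in> carrier Q \<Longrightarrow> b \<in> carrier Q \<Longrightarrow> (conj_diff i ^^ k) a = \<zero> \<Longrightarrow> (conj_diff i ^^ l) b = \<zero> \<Longrightarrow>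
    (conj_diff i ^^ (k + l)) (a \<otimes> b) = \<zero>"
proof (induction "k + l" arbitrary: k l a b rule: less_induct)
  case less
  note ab = less.prems(1,2)
  show ?case
  proof (cases k)
    case 0
    then show ?thesis using less.prems conj_diff_pow_mono[OF i, of 0 \<zero> l] by simp
  next
    case k: (Suc k')
    show ?thesis
    proof (cases l)
      case 0
      then show ?thesis using less.prems conj_diff_pow_mono[OF i, of 0 \<zero> k] by simp
    next
      case l: (Suc l')
      let ?x = "conj_diff i a" and ?y = "conj_diff i b"
      have c: "?x \<in> carrier Q" "?y \<in> carrier Q" using ab i by auto
      have z: "(conj_diff i ^^ k') ?x = \<zero>" "(conj_diff i ^^ l') ?y = \<zero>"
        using less.prems(3,4) by (simp_all only: k l funpow_Suc_right o_apply)
      have N: "k + l = Suc (k' + l)" "k' + l = Suc (k' + l')" using k l by auto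
      have 1: "(conj_diff i ^^ (k' + l)) (?x \<otimes> b) = \<zero>"
        using less.hyps[of k' l ?x b] c ab z less.prems k by simp
      have 2: "(conj_diff i ^^ (k' + l)) (a \<otimes> ?y) = \<zero>"
        using less.hyps[of k l' a ?y] c ab z less.prems k l by simp
      have "(conj_diff i ^^ (k' + l')) (?x \<otimes> ?y) = \<zero>"
        using less.hyps[of k' l' ?x ?y] c z k l by simp
      then have 3: "(conj_diff i ^^ (k' + l)) (?x \<otimes> ?y) = \<zero>"
        by (rule conj_diff_pow_mono[OF i]) (simp add: N)
      have "(conj_diff i ^^ (k + l)) (a \<otimes> b) = (conj_diff i ^^ (k' + l)) (conj_diff i (a \<otimes> b))"
        by (simp only: N(1) funpow_Suc_right o_apply)
      also have "\<dots> = (conj_diff i ^^ (k' + l)) (?x \<otimes> b) \<oplus> (conj_diff i ^^ (k' + l)) (a \<otimes> ?y) \<oplus>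
          (conj_diff i ^^ (k' + l)) (?x \<otimes> ?y)"
        unfolding conj_diff_mult[OF i ab]
        using conj_diff_pow_add[OF i] c ab by (simp add: conj_diff_pow_closed[OF i])
      finally show ?thesis by (simp add: 1 2 3)
    qed
  qed
qed

text \<open>Conjugation by \<open>t i\<close> is locally unipotent: it is an algebra automorphism, so it is enough to
  look at generators, and \<open>conj_diff i\<close> sends \<open>x\<close> to \<open>[t i, x] (t i)\<^sup>-\<^sup>1\<close>, where \<open>ad (t i)\<close> has cube
  zero on the Lie algebra.\<close>

lemma conj_diff_gen:
  assumes i: "i \<in> {1..n}" and x: "x \<in> sl n"
  shows "conj_diff i (gen x) = gen (lie_bracket (mat_unit n 0 i) x) \<otimes> inv (t i)"
proof -
  let ?y = "gen (lie_bracket (mat_unit n 0 i) x)"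
  have c: "?y \<in> carrier Q" "gen x \<in> carrier Q" using x i by (simp_all add: sl_bracket t_sl)
  have "t i \<otimes> gen x = ?y \<oplus> gen x \<otimes> t i" using gen_bracket[OF t_sl[OF i] x] by (simp add: t_def)
  then have "conj i (gen x) = ?y \<otimes> inv (t i) \<oplus> gen x"
    using c i unit_cancel(3)[OF t_unit[OF i]] by (simp add: conj_def l_distr)
  then show ?thesis using c i by (simp add: minus_eq a_assoc r_neg)
qed

lemma conj_diff_nilp:
  assumes i: "i \<in> {1..n}" and q: "q \<in> carrier Q"
  shows "\<exists>k. (conj_diff i ^^ k) q = \<zero>"
  using q
proof (induction q rule: Q_induct)
  case (add a b)
  then obtain k l where "(conj_diff i ^^ k) a = \<zero>" "(conj_diff i ^^ l) b = \<zero>" by blast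
  then have "(conj_diff i ^^ (k + l)) a = \<zero>" "(conj_diff i ^^ (k + l)) b = \<zero>"
    by (auto intro: conj_diff_pow_mono[OF i])
  then have "(conj_diff i ^^ (k + l)) (a \<oplus> b) = \<zero>" using add i by (simp add: conj_diff_pow_add)
  then show ?case ..
next
  case (mult a b)
  then show ?case using conj_diff_nilp_mult[OF i] by blast
next
  case (const c)
  have "(conj_diff i ^^ 1) (const c) = \<zero>" using i by (simp add: conj_const)
  then show ?case ..
next
  case (inv_t j)
  have "(conj_diff i ^^ 1) (inv (t j)) = \<zero>" using i inv_t by (simp add: conj_inv_t)
  then show ?case ..
next
  case (gen x)
  let ?E = "mat_unit n 0 i" and ?u = "inv (t i)"
  note sl = sl_bracket[OF t_sl[OF i]]
  have D: "conj_diff i (a \<otimes> ?u) = conj_diff i a \<otimes> ?u" if "a \<in> carrier Q" for a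
    using i that by (simp add: conj_mult conj_inv_t minus_eq l_distr l_minus)
  let ?x1 = "lie_bracket ?E x"
  let ?x2 = "lie_bracket ?E ?x1"
  let ?x3 = "lie_bracket ?E ?x2"
  have x: "?x1 \<in> sl n" "?x2 \<in> sl n" "?x3 \<in> sl n" using sl gen by blast+
  have 1: "conj_diff i (gen x) = gen ?x1 \<otimes> ?u" using conj_diff_gen[OF i gen] .
  have 2: "conj_diff i (gen ?x1 \<otimes> ?u) = gen ?x2 \<otimes> ?u \<otimes> ?u" using D x conj_diff_gen[OF i x(1)] by simp
  have 3: "conj_diff i (gen ?x2 \<otimes> ?u \<otimes> ?u) = gen ?x3 \<otimes> ?u \<otimes> ?u \<otimes> ?u"
    using D x i conj_diff_gen[OF i x(2)] by simp
  have "gen ?x3 = \<zero>" using unit_bracket_cubed[OF i gen] gen_zero_smult[OF gen] by simp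
  then have "(conj_diff i ^^ 3) (gen x) = \<zero>" using i by (simp add: numeral_3_eq_3 1 2 3)
  then show ?case ..
qed

sublocale QS: shift_ops Q_space "{1..n}" conj "\<lambda>i q. h i \<otimes> q"
proof (rule shift_ops.intro[OF Q_vectorspace], rule shift_ops_axioms.intro)
  fix i assume i: "i \<in> {1..n}"
  show "conj i \<in> module_hom cfield Q_space Q_space"
    using i by (auto simp: module_hom_iff conj_add conj_mult conj_const)
  show "(\<lambda>q. h i \<otimes> q) \<in> module_hom cfield Q_space Q_space"
    using i by (auto simp: module_hom_iff r_distr const_mult_left)
  fix q assume q: "q \<in> carrier Q_space"
  show "conj i (h i \<otimes> q) = h i \<otimes> conj i q \<oplus>\<^bsub>Q_space\<^esub> conj i q"
    using i q by (simp add: conj_mult conj_h l_distr)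
  show "\<exists>k. ((\<lambda>w. conj i w \<ominus>\<^bsub>Q_space\<^esub> w) ^^ k) q = \<zero>\<^bsub>Q_space\<^esub>"
    using i q conj_diff_nilp by simp
  fix j assume j: "j \<in> {1..n}"
  show "conj i (conj j q) = conj j (conj i q)" using i j q by (simp add: conj_conj)
  show "h i \<otimes> (h j \<otimes> q) = h j \<otimes> (h i \<otimes> q)"
    using i j q h_h[of i j] by (simp add: m_assoc[symmetric])
  assume "i \<noteq> j"
  then show "conj i (h j \<otimes> q) = h j \<otimes> conj i q" using i j q by (simp add: conj_mult conj_h)
qed simp

text \<open>The centralizer of the \<open>t i\<close>, that is, the invariants of conjugation. It turns out to be
  the algebra that \<open>G\<close> induces from, see \<open>Um_S_W_eq\<close>.\<close>

definition C :: "'q set" where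
  "C = {q \<in> carrier Q. \<forall>i \<in> {1..n}. t i \<otimes> q = q \<otimes> t i}"

lemma C_conj: "q \<in> C \<longleftrightarrow> q \<in> carrier Q \<and> (\<forall>i \<in> {1..n}. conj i q = q)"
  by (auto simp: C_def conj_eq_iff)

lemma C_inv_on: "QS.inv_on {1..n} = C"
  by (auto simp: QS.inv_on_def C_conj)

lemma C_closed [simp]: "q \<in> C \<Longrightarrow> q \<in> carrier Q"
  by (simp add: C_def)

lemma C_ring:
  "a \<in> C \<Longrightarrow> b \<in> C \<Longrightarrow> a \<oplus> b \<in> C" "a \<in> C \<Longrightarrow> b \<in> C \<Longrightarrow> a \<otimes> b \<in> C" "const c \<in> C" "\<one> \<in> C" "\<zero> \<in> C"
  "a \<in> C \<Longrightarrow> \<ominus> a \<in> C"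
  by (auto simp: C_conj conj_add conj_mult conj_const)
    (auto simp: conj_eq_iff l_minus r_minus)

lemma C_t: "i \<in> {1..n} \<Longrightarrow> t i \<in> C" "i \<in> {1..n} \<Longrightarrow> inv (t i) \<in> C"
  by (auto simp: C_conj conj_t conj_inv_t)

text \<open>\<open>Q\<close> is the direct sum of \<open>C\<close> and the right ideal generated by the \<open>h i\<close>; \<open>const_term\<close> is the
  projection to the first summand. It is a map of right \<open>C\<close>-modules.\<close>

lemma h_span_ideal:
  assumes "s \<in> QS.H_span {1..n}" "c \<in> carrier Q"
  shows "s \<otimes> c \<in> QS.H_span {1..n}"
proof -
  have "linear_op Q_space Q_space (\<lambda>q. q \<otimes> c)"
    using assms(2) by (auto simp: linear_op_def linear_op_axioms_def Q_vectorspace module_hom_iff l_distr m_assoc)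
  then show ?thesis
    by (rule QS.H_span_hom) (use assms in \<open>auto simp: m_assoc\<close>)
qed

lemma h_span_neg: "s \<in> QS.H_span {1..n} \<Longrightarrow> \<ominus> s \<in> QS.H_span {1..n}"
  using h_span_ideal[of s "\<ominus> \<one>"] QS.H_span_closed[of s "{1..n}"] by (simp add: r_minus)

definition const_term :: "'q \<Rightarrow> 'q" where
  "const_term q = (THE c. c \<in> C \<and> (\<exists>s \<in> QS.H_span {1..n}. q = c \<oplus> s))"

lemma const_term_eqI:
  assumes c: "c \<in> C" and s: "s \<in> QS.H_span {1..n}" and q: "q = c \<oplus> s"
  shows "const_term q = c"
  unfolding const_term_def
proof (rule the_equality)
  show "c \<in> C \<and> (\<exists>s \<in> QS.H_span {1..n}. q = c \<oplus> s)" using assms by blast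
  fix d assume "d \<in> C \<and> (\<exists>s \<in> QS.H_span {1..n}. q = d \<oplus> s)"
  then obtain r where d: "d \<in> C" "r \<in> QS.H_span {1..n}" "q = d \<oplus> r" by blast
  have cl: "c \<in> carrier Q" "d \<in> carrier Q" "s \<in> carrier Q" "r \<in> carrier Q"
    using c s d QS.H_span_closed[OF _ order_refl] by auto
  have "d \<ominus> c = s \<ominus> r"
  proof -
    have "d = (r \<oplus> d) \<ominus> r" using cl by (simp only: add_diff_cancel)
    also have "r \<oplus> d = c \<oplus> s" using d q cl by (simp add: a_comm)
    also have "(c \<oplus> s) \<ominus> r = c \<oplus> (s \<ominus> r)" using cl by (simp add: minus_eq a_assoc)
    finally show ?thesis using cl by (metis add_diff_cancel(1) minus_closed)
  qed
  moreover have "s \<ominus> r \<in> QS.H_span {1..n}"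
    using QS.H_span_add[OF s order_refl h_span_neg[OF d(2)]] by (simp add: minus_eq)
  moreover have "d \<ominus> c \<in> C" using c d C_ring by (simp add: minus_eq)
  ultimately have "d \<ominus> c = \<zero>" using QS.inv_inter_H_span[of "d \<ominus> c"] C_inv_on by simp
  then show "d = c" using cl by simp
qed

lemma const_term:
  assumes "q \<in> carrier Q"
  obtains s where "const_term q \<in> C" "s \<in> QS.H_span {1..n}" "q = const_term q \<oplus> s"
proof -
  obtain c s where "c \<in> C" "s \<in> QS.H_span {1..n}" "q = c \<oplus> s"
    using QS.inv_plus_H_span[of q] assms C_inv_on by auto
  then show thesis using that const_term_eqI by metis
qed

lemma const_term_closed: "q \<in> carrier Q \<Longrightarrow> const_term q \<in> C"
  using const_term by blast

lemma const_term_C: "c \<in> C \<Longrightarrow> const_term c = c"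
  by (rule const_term_eqI[of _ \<zero>]) (use QS.H_span.zero[of "{1..n}"] in auto)

lemma const_term_add:
  assumes "a \<in> carrier Q" "b \<in> carrier Q"
  shows "const_term (a \<oplus> b) = const_term a \<oplus> const_term b"
proof -
  obtain s where s: "const_term a \<in> C" "s \<in> QS.H_span {1..n}" "a = const_term a \<oplus> s" using const_term[OF assms(1)] .
  obtain r where r: "const_term b \<in> C" "r \<in> QS.H_span {1..n}" "b = const_term b \<oplus> r" using const_term[OF assms(2)] .
  have cl: "s \<in> carrier Q" "r \<in> carrier Q" using s r QS.H_span_closed[OF _ order_refl] by auto
  have "a \<oplus> b = (const_term a \<oplus> s) \<oplus> (const_term b \<oplus> r)"
    by (rule arg_cong2[OF s(3) r(3), of "(\<oplus>)"])
  also have "\<dots> = (const_term a \<oplus> const_term b) \<oplus> (s \<oplus> r)"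
    using s(1) r(1) cl by (simp add: a_ac)
  finally show ?thesis
    using s r QS.H_span_add[OF s(2) order_refl r(2)] by (intro const_term_eqI[of _ "s \<oplus> r"]) (auto simp: C_ring)
qed

lemma const_term_mult:
  assumes "a \<in> carrier Q" "c \<in> C"
  shows "const_term (a \<otimes> c) = const_term a \<otimes> c"
proof -
  obtain s where s: "const_term a \<in> C" "s \<in> QS.H_span {1..n}" "a = const_term a \<oplus> s" using const_term[OF assms(1)] .
  have cl: "s \<in> carrier Q" using s QS.H_span_closed[OF _ order_refl] by auto
  have "a \<otimes> c = (const_term a \<oplus> s) \<otimes> c" by (rule arg_cong[OF s(3), of "\<lambda>x. x \<otimes> c"])
  also have "\<dots> = const_term a \<otimes> c \<oplus> s \<otimes> c" using s(1) cl assms by (simp add: l_distr)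
  finally show ?thesis
    using s assms h_span_ideal[OF s(2)] by (intro const_term_eqI[of _ "s \<otimes> c"]) (auto simp: C_ring)
qed

end

section \<open>Weights and the augmentation\<close>

context localized begin

definition weights :: "(nat \<Rightarrow> int) set" where
  "weights = {m. \<forall>i. i \<notin> {1..n} \<longrightarrow> m i = 0}"

text \<open>The eigenvalue of \<open>ad x\<close>, for \<open>x\<close> in the Cartan subalgebra, on the monomial in the \<open>t i\<close> with
  exponents \<open>m\<close>. Every weight of \<open>Q\<close> is of this form, because every root is an integral
  combination of the roots of the \<open>e\<^sub>0\<^sub>i\<close>.\<close>

definition char :: "(nat \<Rightarrow> int) \<Rightarrow> complex mat \<Rightarrow> complex" where
  "char m x = (\<Sum>i = 1..n. of_int (m i) * (x $$ (0, 0) - x $$ (i, i)))"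

definition wt :: "(nat \<Rightarrow> int) \<Rightarrow> 'q \<Rightarrow> bool" where
  "wt m q \<longleftrightarrow> q \<in> carrier Q \<and> (\<forall>x \<in> cartan n. gen x \<otimes> q = const (char m x) \<otimes> q \<oplus> q \<otimes> gen x)"

lemma char_add: "char (\<lambda>i. m i + k i) x = char m x + char k x"
  and char_zero: "char (\<lambda>i. 0) x = 0"
  and char_minus: "char (\<lambda>i. - m i) x = - char m x"
  by (simp_all add: char_def distrib_right sum.distrib sum_negf)

lemma weights_closed:
  "m \<in> weights \<Longrightarrow> k \<in> weights \<Longrightarrow> (\<lambda>i. m i + k i) \<in> weights" "m \<in> weights \<Longrightarrow> (\<lambda>i. - m i) \<in> weights"
  "(\<lambda>i. 0) \<in> weights"
  by (auto simp: weights_def)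

lemma wt_closed [simp]: "wt m q \<Longrightarrow> q \<in> carrier Q"
  by (simp add: wt_def)

lemma cartan_gen_closed [simp]: "x \<in> cartan n \<Longrightarrow> gen x \<in> carrier Q"
  by (simp add: cartan_sl)

lemma wtD: "wt m q \<Longrightarrow> x \<in> cartan n \<Longrightarrow> gen x \<otimes> q = const (char m x) \<otimes> q \<oplus> q \<otimes> gen x"
  by (simp add: wt_def)

lemma wt_zero: "wt m \<zero>"
  by (simp add: wt_def)

lemma wt_add: "wt m a \<Longrightarrow> wt m b \<Longrightarrow> wt m (a \<oplus> b)"
  unfolding wt_def by (simp add: r_distr l_distr a_ac)

lemma wt_neg: "wt m a \<Longrightarrow> wt m (\<ominus> a)"
  unfolding wt_def by (simp add: r_minus l_minus minus_add)

lemma wt_mult: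
  assumes a: "wt m a" and b: "wt k b"
  shows "wt (\<lambda>i. m i + k i) (a \<otimes> b)"
  unfolding wt_def
proof (intro conjI ballI)
  show "a \<otimes> b \<in> carrier Q" using a b by simp
  fix x assume x: "x \<in> cartan n"
  have "gen x \<otimes> (a \<otimes> b) = (gen x \<otimes> a) \<otimes> b" using a b x by (simp add: m_assoc)
  also have "\<dots> = const (char m x) \<otimes> (a \<otimes> b) \<oplus> a \<otimes> (gen x \<otimes> b)"
    using a b x by (simp add: wtD[OF a x] l_distr m_assoc)
  also have "a \<otimes> (gen x \<otimes> b) = const (char k x) \<otimes> (a \<otimes> b) \<oplus> (a \<otimes> b) \<otimes> gen x"
    using a b x by (simp add: wtD[OF b x] r_distr m_assoc const_mult_left)
  finally show "gen x \<otimes> (a \<otimes> b) = const (char (\<lambda>i. m i + k i) x) \<otimes> (a \<otimes> b) \<oplus> (a \<otimes> b) \<otimes> gen x"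
    using a b x by (simp add: char_add const_add l_distr a_assoc)
qed

lemma wt_inv:
  assumes u: "u \<in> Units Q" and m: "wt m u"
  shows "wt (\<lambda>i. - m i) (inv u)"
  unfolding wt_def
proof (intro conjI ballI)
  show "inv u \<in> carrier Q" using u by simp
  fix x assume x: "x \<in> cartan n"
  let ?v = "inv u" and ?c = "const (char m x)"
  have c: "u \<in> carrier Q" "?v \<in> carrier Q" "gen x \<in> carrier Q" using u x by auto
  have "?v \<otimes> gen x = ?v \<otimes> (gen x \<otimes> u) \<otimes> ?v" using c unit_cancel(3)[OF u] by (simp add: m_assoc u)
  also have "\<dots> = ?c \<otimes> ?v \<oplus> gen x \<otimes> ?v"
    unfolding wtD[OF m x]
    using c u by (simp add: r_distr l_distr m_assoc const_mult_left unit_cancel)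
  finally have "\<ominus> (?c \<otimes> ?v) \<oplus> ?v \<otimes> gen x = gen x \<otimes> ?v"
    using c by (simp add: r_neg1)
  then show "gen x \<otimes> ?v = const (char (\<lambda>i. - m i) x) \<otimes> ?v \<oplus> ?v \<otimes> gen x"
    using c by (simp add: char_minus const_minus l_minus)
qed

lemma wt_const: "wt (\<lambda>i. 0) (const c)"
  by (simp add: wt_def char_zero const_zero const_central[OF cartan_gen_closed])

lemma wt_one: "wt (\<lambda>i. 0) \<one>"
  using wt_const[of 1] by (simp add: const_one)

definition unit_weight :: "nat \<Rightarrow> nat \<Rightarrow> int" where
  "unit_weight j = (\<lambda>i. if i = j \<and> i \<in> {1..n} then 1 else 0)"

lemma unit_weight: "unit_weight j \<in> weights"
  by (auto simp: unit_weight_def weights_def)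

lemma char_unit_weight: "j \<le> n \<Longrightarrow> char (unit_weight j) x = x $$ (0, 0) - x $$ (j, j)"
proof -
  assume j: "j \<le> n"
  have "char (unit_weight j) x = (\<Sum>i = 1..n. if i = j then x $$ (0, 0) - x $$ (j, j) else 0)"
    unfolding char_def by (intro sum.cong) (auto simp: unit_weight_def)
  then show ?thesis using j by (cases "j = 0") auto
qed

lemma wt_t: "i \<in> {1..n} \<Longrightarrow> wt (unit_weight i) (t i)"
  unfolding wt_def by (auto simp: cartan_t char_unit_weight)

lemma wt_gen_cartan: "y \<in> cartan n \<Longrightarrow> wt (\<lambda>i. 0) (gen y)"
  unfolding wt_def by (auto simp: char_zero const_zero cartan_cartan)

lemma wt_gen_unit:
  assumes "i \<le> n" "j \<le> n" "i \<noteq> j"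
  shows "wt (\<lambda>k. unit_weight j k + - unit_weight i k) (gen (mat_unit n i j))"
  unfolding wt_def
proof (intro conjI ballI)
  have sl: "mat_unit n i j \<in> sl n" using assms by (simp add: mat_unit_sl)
  then show "gen (mat_unit n i j) \<in> carrier Q" by simp
  fix x assume x: "x \<in> cartan n"
  have "char (\<lambda>k. unit_weight j k + - unit_weight i k) x = x $$ (i, i) - x $$ (j, j)"
    using char_add[of "unit_weight j" "\<lambda>k. - unit_weight i k"] assms
    by (simp only: char_minus char_unit_weight) simp
  then show "gen x \<otimes> gen (mat_unit n i j) = const (char (\<lambda>k. unit_weight j k + - unit_weight i k) x) \<otimes>
      gen (mat_unit n i j) \<oplus> gen (mat_unit n i j) \<otimes> gen x"
    using gen_bracket[OF cartan_sl[OF x] sl] assms x by (simp add: cartan_bracket_unit gen_smult sl)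
qed

text \<open>The sums of weight vectors are closed under multiplication and contain the generators of \<open>Q\<close>, so
  they are all of \<open>Q\<close>.\<close>

inductive_set weight_sums :: "'q set" where
  wt: "m \<in> weights \<Longrightarrow> wt m q \<Longrightarrow> q \<in> weight_sums"
| add: "a \<in> weight_sums \<Longrightarrow> b \<in> weight_sums \<Longrightarrow> a \<oplus> b \<in> weight_sums"

lemma weight_sums_closed: "a \<in> weight_sums \<Longrightarrow> a \<in> carrier Q"
  by (induction rule: weight_sums.induct) auto

lemma weight_sums_mult:
  assumes "a \<in> weight_sums" "b \<in> weight_sums"
  shows "a \<otimes> b \<in> weight_sums"
  using assms(1)
proof (induction rule: weight_sums.induct)
  case (wt m q)
  show ?case using assms(2)
  proof (induction rule: weight_sums.induct)
    case (wt k r)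
    then show ?case using wt_mult weights_closed(1) \<open>m \<in> weights\<close> \<open>local.wt m q\<close> weight_sums.wt by blast
  next
    case (add b c)
    then show ?case using \<open>local.wt m q\<close> by (simp add: r_distr weight_sums_closed weight_sums.add)
  qed
next
  case (add c d)
  then show ?case using assms(2) by (simp add: l_distr weight_sums_closed weight_sums.add)
qed

lemma weight_sums_UNIV: "q \<in> carrier Q \<Longrightarrow> q \<in> weight_sums"
proof (induction q rule: Q_induct)
  case (const c)
  then show ?case using weight_sums.wt[OF weights_closed(3) wt_const] .
next
  case (gen x)
  then show ?case
  proof (induction x rule: sl_induct[consumes 1, case_names add smult unit diag])
    case (smult c y)
    then show ?case
      using weight_sums_mult[OF weight_sums.wt[OF weights_closed(3) wt_const]] by (simp add: gen_smult)
  next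
    case (unit i j)
    then show ?case
      by (intro weight_sums.wt[OF _ wt_gen_unit] weights_closed unit_weight) auto
  next
    case (diag y)
    then show ?case using weight_sums.wt[OF weights_closed(3) wt_gen_cartan] by blast
  qed (simp add: gen_add weight_sums.add)
next
  case (inv_t i)
  then show ?case
    using weight_sums.wt[OF weights_closed(2)[OF unit_weight] wt_inv[OF t_unit wt_t]] by blast
qed (auto intro: weight_sums.add weight_sums_mult)

text \<open>A decomposition of \<open>q\<close> into weight components \<open>f m\<close>. The function \<open>f\<close> is required to vanish outside
  \<open>F\<close> so that two decompositions can be compared over a common index set.\<close>

definition family :: "(nat \<Rightarrow> int) set \<Rightarrow> ((nat \<Rightarrow> int) \<Rightarrow> 'q) \<Rightarrow> 'q \<Rightarrow> bool" where
  "family F f q \<longleftrightarrow> finite F \<and> F \<subseteq> weights \<and> (\<forall>m. wt m (f m)) \<and> (\<forall>m. m \<notin> F \<longrightarrow> f m = \<zero>) \<and>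
    q = (\<Oplus>m \<in> F. f m)"

lemma family_closed: "family F f q \<Longrightarrow> f m \<in> carrier Q"
  unfolding family_def using wt_closed by blast

lemma family_mono:
  assumes "family F f q" "F \<subseteq> F'" "finite F'" "F' \<subseteq> weights"
  shows "family F' f q"
proof -
  have "(\<Oplus>m \<in> F. f m) = (\<Oplus>m \<in> F'. f m)"
    using assms family_closed[OF assms(1)]
    by (intro add.finprod_mono_neutral_cong_left) (auto simp: family_def)
  then show ?thesis using assms by (auto simp: family_def)
qed

lemma family_add:
  assumes "family F f a" "family F' f' b"
  shows "family (F \<union> F') (\<lambda>m. f m \<oplus> f' m) (a \<oplus> b)"
proof -
  have F: "finite (F \<union> F')" "F \<union> F' \<subseteq> weights" using assms by (auto simp: family_def)
  have "family (F \<union> F') f a" "family (F \<union> F') f' b" using assms family_mono F by blast+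
  then have "(\<Oplus>m \<in> F \<union> F'. f m \<oplus> f' m) = a \<oplus> b"
    using family_closed[OF assms(1)] family_closed[OF assms(2)]
    by (subst finsum_addf) (auto simp: family_def)
  then show ?thesis using assms F by (auto simp: family_def wt_add)
qed

lemma family_single:
  assumes "wt m q" "m \<in> weights"
  shows "family {m} (\<lambda>k. if k = m then q else \<zero>) q"
  using assms by (auto simp: family_def wt_zero)

lemma family_ex: assumes "q \<in> carrier Q" shows "\<exists>F f. family F f q"
  using weight_sums_UNIV[OF assms]
proof (induction rule: weight_sums.induct)
  case (wt m q)
  then show ?case using family_single by blast
next
  case (add a b)
  then show ?case using family_add weight_sums_closed by blast
qed

lemma finsum_additive:
  assumes "finite F" "\<And>m. m \<in> F \<Longrightarrow> f m \<in> carrier Q"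
    and A: "\<And>a. a \<in> carrier Q \<Longrightarrow> A a \<in> carrier Q"
      "\<And>a b. a \<in> carrier Q \<Longrightarrow> b \<in> carrier Q \<Longrightarrow> A (a \<oplus> b) = A a \<oplus> A b"
  shows "A (\<Oplus>m \<in> F. f m) = (\<Oplus>m \<in> F. A (f m))"
  using assms(1,2)
proof (induction rule: finite_induct)
  case empty
  have "A \<zero> = \<zero>" using A(2)[of \<zero> \<zero>] A(1)[of \<zero>] by (simp add: add.l_cancel_one')
  then show ?case by simp
next
  case (insert m F)
  then show ?case using A by simp
qed

text \<open>Weight spaces for distinct weights are independent: the operator \<open>ad (h i) + k i\<close> kills weight
  \<open>k\<close> and multiplies weight \<open>m\<close> by \<open>k i - m i\<close>.\<close>

lemma weight_independent:
  assumes "finite F" "F \<subseteq> weights" "\<And>m. m \<in> F \<Longrightarrow> wt m (f m)" "(\<Oplus>m \<in> F. f m) = \<zero>"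
  shows "\<forall>m \<in> F. f m = \<zero>"
  using assms
proof (induction arbitrary: f rule: finite_induct)
  case (insert k F)
  have wts: "wt m (f m)" if "m \<in> insert k F" for m using insert.prems that by blast
  have cl: "f m \<in> carrier Q" if "m \<in> insert k F" for m using wts[OF that] by simp
  have zero: "f m = \<zero>" if m: "m \<in> F" for m
  proof -
    have "m \<noteq> k" using m insert by blast
    then obtain i where "m i \<noteq> k i" by blast
    then have i: "i \<in> {1..n}" "m i \<noteq> k i" using insert.prems m by (auto simp: weights_def) force+
    define A where "A q = (h i \<otimes> q \<ominus> q \<otimes> h i) \<oplus> const (of_int (k i)) \<otimes> q" for q
    have A1: "A a \<in> carrier Q" if "a \<in> carrier Q" for a
      using that i by (simp add: A_def)
    have A2: "A (a \<oplus> b) = A a \<oplus> A b" if "a \<in> carrier Q" "b \<in> carrier Q" for a b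
      using that i by (simp add: A_def l_distr r_distr minus_eq minus_add a_ac)
    note A = A1 A2
    have Af: "A (f l) = const (of_int (k i - l i)) \<otimes> f l" if l: "l \<in> insert k F" for l
    proof -
      have "char l (cartan_dual n i) = (\<Sum>j = 1..n. if j = i then - of_int (l i) else 0)"
        unfolding char_def using i by (intro sum.cong) (auto simp: cartan_dual_index)
      then have "char l (cartan_dual n i) = - of_int (l i)" using i by simp
      then have "h i \<otimes> f l = const (- of_int (l i)) \<otimes> f l \<oplus> f l \<otimes> h i"
        using wtD[OF wts[OF l] cartan_dual_cartan, of i] i by (simp add: h_def)
      then have "A (f l) = const (- of_int (l i)) \<otimes> f l \<oplus> const (of_int (k i)) \<otimes> f l"
        using cl[OF l] i by (simp add: A_def minus_eq a_assoc r_neg)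
      also have "\<dots> = const (- of_int (l i) + of_int (k i)) \<otimes> f l"
        using cl[OF l] by (simp only: const_add l_distr const_closed)
      finally show ?thesis by simp
    qed
    have "(\<Oplus>l \<in> insert k F. A (f l)) = A (\<Oplus>l \<in> insert k F. f l)"
      using insert cl A by (intro finsum_additive[symmetric]) auto
    also have "\<dots> = \<zero>" unfolding insert.prems(3) using i by (simp add: A_def)
    finally have "A (f k) \<oplus> (\<Oplus>l \<in> F. A (f l)) = \<zero>"
      using insert cl A by (subst (asm) finsum_insert) auto
    moreover have "A (f k) = \<zero>" using Af[of k] cl[of k] by (simp add: const_zero)
    ultimately have s: "(\<Oplus>l \<in> F. A (f l)) = \<zero>" using A cl by (simp add: Pi_def)
    have "\<forall>l \<in> F. A (f l) = \<zero>"
    proof (rule insert.IH[OF _ _ s])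
      show "F \<subseteq> weights" using insert.prems by blast
      fix l assume l: "l \<in> F"
      have "wt (\<lambda>i. 0 + l i) (const (of_int (k i - l i)) \<otimes> f l)" using wt_mult[OF wt_const] wts l by blast
      then show "wt l (A (f l))" using Af[of l] l by simp
    qed
    then have "const (of_int (k i - m i)) \<otimes> f m = \<zero>" using Af[of m] m by simp
    then have "const (inverse (of_int (k i - m i))) \<otimes> (const (of_int (k i - m i)) \<otimes> f m) = \<zero>" by simp
    moreover have "const (inverse (of_int (k i - m i))) \<otimes> (const (of_int (k i - m i)) \<otimes> f m) =
        const (inverse (of_int (k i - m i)) * of_int (k i - m i)) \<otimes> f m"
      using cl m by (simp only: const_mult m_assoc const_closed insertI2)
    ultimately show ?thesis using i cl m by (simp add: const_one del: of_int_diff)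
  qed
  moreover have "f k = \<zero>"
  proof -
    have "(\<Oplus>l \<in> F. f l) = \<zero>" using zero by (simp add: add.finprod_one_eqI)
    moreover have "f k \<oplus> (\<Oplus>l \<in> F. f l) = \<zero>"
      using insert.prems(3) insert.hyps cl by (subst (asm) finsum_insert) auto
    ultimately show ?thesis using cl by simp
  qed
  ultimately show ?case by blast
qed simp

lemma family_zero: assumes "family F f \<zero>" shows "f m = \<zero>"
  using weight_independent[of F f] assms by (metis family_def)

lemma family_unique:
  assumes f: "family F f q" and g: "family G g q" and q: "q \<in> carrier Q"
  shows "f = g"
proof
  fix m
  have F: "finite (F \<union> G)" "F \<union> G \<subseteq> weights" using assms by (auto simp: family_def)
  have fg: "family (F \<union> G) f q" "family (F \<union> G) g q" using assms family_mono F by blast+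
  have c: "\<And>m. f m \<in> carrier Q" "\<And>m. g m \<in> carrier Q" using family_closed f g by blast+
  have "(\<Oplus>m \<in> F \<union> G. f m \<oplus> \<ominus> g m) = (\<Oplus>m \<in> F \<union> G. f m) \<oplus> (\<Oplus>m \<in> F \<union> G. \<ominus> g m)"
    using c by (subst finsum_addf) auto
  also have "(\<Oplus>m \<in> F \<union> G. \<ominus> g m) = \<ominus> (\<Oplus>m \<in> F \<union> G. g m)"
    using F c by (intro finsum_additive[symmetric]) (auto simp: minus_add)
  finally have "family (F \<union> G) (\<lambda>m. f m \<oplus> \<ominus> g m) \<zero>"
    using fg F q by (auto simp: family_def wt_add wt_neg r_neg)
  then have "f m \<oplus> \<ominus> g m = \<zero>" by (rule family_zero)
  then show "f m = g m" using c by (metis add.inv_closed minus_equality minus_minus a_comm)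
qed

text \<open>Conjugation by \<open>t i\<close> preserves every weight space, so it fixes each component of an element that
  it fixes.\<close>

lemma family_C:
  assumes f: "family F f q" and q: "q \<in> C"
  shows "f m \<in> C"
proof -
  have c: "\<And>m. f m \<in> carrier Q" using family_closed[OF f] .
  have "conj i (f m) = f m" if i: "i \<in> {1..n}" for i m
  proof -
    have "conj i q = (\<Oplus>m \<in> F. conj i (f m))"
      using f c i by (auto simp: family_def conj_add intro!: finsum_additive)
    moreover have "conj i q = q" using q i by (simp add: C_conj)
    moreover have "wt m (conj i (f m))" for m
    proof -
      have "wt m (f m)" using f by (simp add: family_def)
      from wt_mult[OF wt_mult[OF wt_t[OF i] this] wt_inv[OF t_unit[OF i] wt_t[OF i]]]
      show ?thesis by (simp add: conj_def)
    qed
    ultimately have "family F (\<lambda>m. conj i (f m)) q"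
      using f i by (auto simp: family_def conj_def)
    from family_unique[OF this f] q show ?thesis by (metis C_closed)
  qed
  then show ?thesis using c by (simp add: C_conj)
qed

lemma C_induct [consumes 1, case_names wt add]:
  assumes c: "c \<in> C"
    and wt: "\<And>m c. m \<in> weights \<Longrightarrow> c \<in> C \<Longrightarrow> wt m c \<Longrightarrow> P c"
    and add: "\<And>a b. a \<in> C \<Longrightarrow> b \<in> C \<Longrightarrow> P a \<Longrightarrow> P b \<Longrightarrow> P (a \<oplus> b)"
  shows "P c"
proof -
  obtain F f where f: "family F f c" using family_ex[OF C_closed[OF c]] by blast
  have fC: "\<And>m. f m \<in> C" using family_C[OF f c] .
  have "finite G \<Longrightarrow> G \<subseteq> weights \<Longrightarrow> (\<Oplus>m \<in> G. f m) \<in> C \<and> P (\<Oplus>m \<in> G. f m)" for G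
  proof (induction rule: finite_induct)
    case empty
    then show ?case using assms(2)[OF weights_closed(3) C_ring(5) wt_zero] C_ring(5) by simp
  next
    case (insert m G)
    have "local.wt m (f m)" using f by (simp add: family_def)
    then have Pm: "P (f m)" using assms(2)[OF _ fC] insert.prems by blast
    have IH: "(\<Oplus>m \<in> G. f m) \<in> C" "P (\<Oplus>m \<in> G. f m)" using insert by auto
    have "(\<Oplus>m \<in> insert m G. f m) = f m \<oplus> (\<Oplus>m \<in> G. f m)"
      using insert.hyps fC by (intro finsum_insert) auto
    then show ?case using assms(3)[OF fC IH(1) Pm IH(2)] C_ring(1)[OF fC IH(1)] by simp
  qed
  then show ?thesis using f unfolding family_def by blast
qed

text \<open>The monomials in the \<open>t i\<close> live in the group of units of the center of \<open>C\<close>.\<close>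

definition Z :: "'q monoid" where
  "Z = \<lparr>carrier = {u \<in> Units Q. \<forall>c \<in> C. u \<otimes> c = c \<otimes> u}, monoid.mult = (\<otimes>), one = \<one>\<rparr>"

lemma Z_simps [simp]: "u \<otimes>\<^bsub>Z\<^esub> v = u \<otimes> v" "\<one>\<^bsub>Z\<^esub> = \<one>"
  by (simp_all add: Z_def)

lemma C_comm: "c \<in> C \<Longrightarrow> i \<in> {1..n} \<Longrightarrow> t i \<otimes> c = c \<otimes> t i"
  unfolding C_def by blast

lemma Z_I: "u \<in> Units Q \<Longrightarrow> (\<And>c. c \<in> C \<Longrightarrow> u \<otimes> c = c \<otimes> u) \<Longrightarrow> u \<in> carrier Z"
  by (simp add: Z_def)

lemma Z_unit: "u \<in> carrier Z \<Longrightarrow> u \<in> Units Q"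
  and Z_comm: "u \<in> carrier Z \<Longrightarrow> c \<in> C \<Longrightarrow> u \<otimes> c = c \<otimes> u"
  unfolding Z_def by simp_all

lemma Z_closed [simp]: "u \<in> carrier Z \<Longrightarrow> u \<in> carrier Q"
  using Z_unit by blast

lemma Z_C: "u \<in> carrier Z \<Longrightarrow> u \<in> C"
  using Z_comm[OF _ C_t(1)] Z_closed unfolding C_def by (intro CollectI conjI ballI) fastforce+

lemma Z_inv_closed: "u \<in> carrier Z \<Longrightarrow> inv u \<in> carrier Z"
  by (intro Z_I inv_commute) (auto simp: Z_unit Z_comm)

sublocale Z: comm_group Z
proof (rule comm_groupI)
  fix u v assume u: "u \<in> carrier Z" and v: "v \<in> carrier Z"
  have "u \<otimes> v \<in> carrier Z"
  proof (rule Z_I)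
    show "u \<otimes> v \<in> Units Q" using Z_unit u v by blast
    fix c assume c: "c \<in> C"
    have "(u \<otimes> v) \<otimes> c = u \<otimes> (c \<otimes> v)" using u v c Z_comm[OF v c] by (simp add: m_assoc)
    also have "\<dots> = (c \<otimes> u) \<otimes> v" using u v c Z_comm[OF u c] by (simp add: m_assoc[symmetric])
    finally show "(u \<otimes> v) \<otimes> c = c \<otimes> (u \<otimes> v)" using u v c by (simp add: m_assoc)
  qed
  then show "u \<otimes>\<^bsub>Z\<^esub> v \<in> carrier Z" by simp
  show "u \<otimes>\<^bsub>Z\<^esub> v = v \<otimes>\<^bsub>Z\<^esub> u" using Z_comm[OF u Z_C[OF v]] by simp
next
  fix u assume u: "u \<in> carrier Z"
  then show "\<exists>v \<in> carrier Z. v \<otimes>\<^bsub>Z\<^esub> u = \<one>\<^bsub>Z\<^esub>"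
    by (intro bexI[of _ "inv u"] Z_inv_closed) (simp add: Z_unit)
next
  have "\<one> \<in> carrier Z" by (rule Z_I) auto
  then show "\<one>\<^bsub>Z\<^esub> \<in> carrier Z" by simp
qed (simp_all add: m_assoc)

lemma Z_inv: "u \<in> carrier Z \<Longrightarrow> inv\<^bsub>Z\<^esub> u = inv u"
  using Z_inv_closed[of u] Z_unit[of u] by (intro Z.inv_equality) auto

lemma t_Z: "i \<in> {1..n} \<Longrightarrow> t i \<in> carrier Z"
  by (rule Z_I[OF t_unit C_comm])

definition monom :: "(nat \<Rightarrow> int) \<Rightarrow> 'q" where
  "monom m = (\<Otimes>\<^bsub>Z\<^esub>i \<in> {1..n}. t i [^]\<^bsub>Z\<^esub> m i)"

lemma t_pow_Z: "i \<in> {1..n} \<Longrightarrow> t i [^]\<^bsub>Z\<^esub> (k::int) \<in> carrier Z"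
  using Z.int_pow_closed[OF t_Z] .

lemma monom_Z: "monom m \<in> carrier Z"
  unfolding monom_def by (rule Z.finprod_closed) (use t_pow_Z in blast)

lemma monom_add: "monom (\<lambda>i. m i + k i) = monom m \<otimes> monom k"
proof -
  have "monom (\<lambda>i. m i + k i) = (\<Otimes>\<^bsub>Z\<^esub>i \<in> {1..n}. t i [^]\<^bsub>Z\<^esub> m i \<otimes>\<^bsub>Z\<^esub> t i [^]\<^bsub>Z\<^esub> k i)"
    unfolding monom_def
    by (rule Z.finprod_cong') (use t_pow_Z t_Z Z.m_closed in \<open>auto simp del: Z_simps simp: Z.int_pow_mult\<close>)
  also have "\<dots> = monom m \<otimes>\<^bsub>Z\<^esub> monom k"
    unfolding monom_def by (rule Z.finprod_multf) (use t_pow_Z in blast)+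
  finally show ?thesis by simp
qed

lemma monom_zero: "monom (\<lambda>i. 0) = \<one>"
  unfolding monom_def by simp

lemma monom_unit_weight:
  assumes j: "j \<in> {1..n}"
  shows "monom (unit_weight j) = t j"
proof -
  have "monom (unit_weight j) = (\<Otimes>\<^bsub>Z\<^esub>i \<in> {1..n}. if j = i then t i else \<one>\<^bsub>Z\<^esub>)"
    unfolding monom_def
    by (rule Z.finprod_cong') (use t_Z in \<open>auto simp: unit_weight_def Z.int_pow_1 simp del: Z_simps\<close>)
  then show ?thesis using Z.finprod_singleton[of j "{1..n}" t] j t_Z by (simp del: Z_simps add: Pi_def)
qed

lemma wt_t_pow:
  assumes i: "i \<in> {1..n}"
  shows "wt (\<lambda>j. if j = i then k else 0) (t i [^]\<^bsub>Z\<^esub> k)"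
proof -
  have nat: "wt (\<lambda>j. if j = i then int l else 0) (t i [^]\<^bsub>Z\<^esub> l)" for l
  proof (induction l)
    case 0
    have "(\<lambda>j. if j = i then int 0 else 0) = (\<lambda>i. 0)" by auto
    then show ?case using wt_one by simp
  next
    case (Suc l)
    have "(\<lambda>j. (if j = i then int l else 0) + unit_weight i j) = (\<lambda>j. if j = i then int (Suc l) else 0)"
      using i by (auto simp: unit_weight_def)
    then show ?case using wt_mult[OF Suc wt_t[OF i]] by simp
  qed
  obtain l where "k = int l \<or> k = - int l" by (cases k rule: int_cases2) auto
  then show ?thesis
  proof
    assume k: "k = - int l"
    have "t i [^]\<^bsub>Z\<^esub> l \<in> carrier Z" using Z.nat_pow_closed[OF t_Z[OF i]] .
    moreover have "(\<lambda>j. - (if j = i then int l else 0)) = (\<lambda>j. if j = i then - int l else 0)" by auto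
    ultimately show ?thesis unfolding k
      using wt_inv[OF Z_unit nat[of l]] Z.int_pow_neg_int[OF t_Z[OF i], of l] Z_inv by simp
  next
    assume k: "k = int l"
    show ?thesis unfolding k using nat[of l] by (simp add: int_pow_int)
  qed
qed

lemma wt_monom: assumes m: "m \<in> weights" shows "wt m (monom m)"
proof -
  have "finite I \<Longrightarrow> I \<subseteq> {1..n} \<Longrightarrow>
      wt (\<lambda>i. if i \<in> I then m i else 0) (\<Otimes>\<^bsub>Z\<^esub>i \<in> I. t i [^]\<^bsub>Z\<^esub> m i)" for I
  proof (induction rule: finite_induct)
    case empty
    then show ?case using wt_one by simp
  next
    case (insert j I)
    have "(\<Otimes>\<^bsub>Z\<^esub>i \<in> insert j I. t i [^]\<^bsub>Z\<^esub> m i) = t j [^]\<^bsub>Z\<^esub> m j \<otimes>\<^bsub>Z\<^esub> (\<Otimes>\<^bsub>Z\<^esub>i \<in> I. t i [^]\<^bsub>Z\<^esub> m i)"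
      using insert t_pow_Z by (intro Z.finprod_insert) (auto simp del: Z_simps)
    moreover have e: "(\<lambda>i. (if i = j then m j else 0) + (if i \<in> I then m i else 0)) =
        (\<lambda>i. if i \<in> insert j I then m i else 0)"
      using insert by auto
    moreover have "wt (\<lambda>i. if i \<in> I then m i else 0) (\<Otimes>\<^bsub>Z\<^esub>i \<in> I. t i [^]\<^bsub>Z\<^esub> m i)"
      using insert by simp
    then have "wt (\<lambda>i. if i \<in> insert j I then m i else 0)
        (t j [^]\<^bsub>Z\<^esub> m j \<otimes> (\<Otimes>\<^bsub>Z\<^esub>i \<in> I. t i [^]\<^bsub>Z\<^esub> m i))"
      using wt_mult[OF wt_t_pow[of j "m j"]] insert.prems unfolding e[symmetric] by blast
    ultimately show ?case by simp
  qed
  from this[of "{1..n}"] have "wt (\<lambda>i. if i \<in> {1..n} then m i else 0) (monom m)" by (simp add: monom_def)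
  moreover have "(\<lambda>i. if i \<in> {1..n} then m i else 0) = m" using m by (auto simp: weights_def)
  ultimately show ?thesis by simp
qed

lemma W_iff: "w \<in> W_alg n Q \<phi> \<longleftrightarrow> w \<in> C \<and> wt (\<lambda>i. 0) w"
proof
  assume w: "w \<in> W_alg n Q \<phi>"
  then have c: "w \<in> carrier Q" by (simp add: W_alg_def)
  have comm: "gen x \<otimes> w = w \<otimes> gen x" if "x \<in> cartan n \<union> m_sub n" for x
  proof -
    have "gen x \<in> carrier Q" using that cartan_sl m_sub_sl by auto
    moreover have "gen x \<otimes> w \<ominus> w \<otimes> gen x = \<zero>" using w that by (simp add: W_alg_def)
    ultimately show ?thesis using c by simp
  qed
  have "t i \<otimes> w = w \<otimes> t i" if "i \<in> {1..n}" for i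
    using comm[of "mat_unit n 0 i"] mat_unit_m_sub[OF that] by (simp add: t_def)
  then have "w \<in> C" using c unfolding C_def by blast
  moreover have "wt (\<lambda>i. 0) w"
    unfolding wt_def using c comm by (simp add: char_zero const_zero)
  ultimately show "w \<in> C \<and> wt (\<lambda>i. 0) w" ..
next
  assume w: "w \<in> C \<and> wt (\<lambda>i. 0) w"
  then have c: "w \<in> carrier Q" by simp
  have cartan: "gen x \<otimes> w = w \<otimes> gen x" if "x \<in> cartan n" for x
    using w that c wtD[of "\<lambda>i. 0" w x] by (simp add: char_zero const_zero)
  have m: "gen x \<otimes> w = w \<otimes> gen x" if "x \<in> m_sub n" for x
    using that
  proof (rule m_sub_induct)
    fix y z assume "y \<in> sl n" "z \<in> sl n" "gen y \<otimes> w = w \<otimes> gen y" "gen z \<otimes> w = w \<otimes> gen z"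
    then show "gen (y + z) \<otimes> w = w \<otimes> gen (y + z)" using c by (simp add: gen_add l_distr r_distr)
  next
    fix d y assume "y \<in> sl n" "gen y \<otimes> w = w \<otimes> gen y"
    then show "gen (d \<cdot>\<^sub>m y) \<otimes> w = w \<otimes> gen (d \<cdot>\<^sub>m y)"
      using c by (simp add: gen_smult m_assoc const_mult_left)
  next
    fix j assume "j \<in> {1..n}"
    then show "gen (mat_unit n 0 j) \<otimes> w = w \<otimes> gen (mat_unit n 0 j)" using C_comm w by (simp add: t_def)
  next
    have z: "0\<^sub>m (n + 1) (n + 1) \<in> sl n" by (simp add: sl_def)
    have "0 \<cdot>\<^sub>m 0\<^sub>m (n + 1) (n + 1) = (0\<^sub>m (n + 1) (n + 1) :: complex mat)" by auto
    then have "gen (0\<^sub>m (n + 1) (n + 1)) = \<zero>" using gen_zero_smult[OF z] by simp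
    then show "gen (0\<^sub>m (n + 1) (n + 1)) \<otimes> w = w \<otimes> gen (0\<^sub>m (n + 1) (n + 1))" using c by simp
  qed
  have "gen x \<in> carrier Q" if "x \<in> cartan n \<union> m_sub n" for x
    using that cartan_sl m_sub_sl by auto
  moreover have "gen x \<otimes> w = w \<otimes> gen x" if "x \<in> cartan n \<union> m_sub n" for x
    using that cartan m by blast
  ultimately have "gen x \<otimes> w \<ominus> w \<otimes> gen x = \<zero>" if "x \<in> cartan n \<union> m_sub n" for x
    using that c by (metis m_closed r_right_minus_eq)
  then show "w \<in> W_alg n Q \<phi>" using c by (simp add: W_alg_def)
qed

lemma W_C: "w \<in> W_alg n Q \<phi> \<Longrightarrow> w \<in> C" by (simp add: W_iff)

lemma W_ring:
  "a \<in> W_alg n Q \<phi> \<Longrightarrow> b \<in> W_alg n Q \<phi> \<Longrightarrow> a \<oplus> b \<in> W_alg n Q \<phi>"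
  "a \<in> W_alg n Q \<phi> \<Longrightarrow> b \<in> W_alg n Q \<phi> \<Longrightarrow> a \<otimes> b \<in> W_alg n Q \<phi>"
  "const c \<in> W_alg n Q \<phi>" "\<one> \<in> W_alg n Q \<phi>"
  using wt_mult[of "\<lambda>i. 0" a "\<lambda>i. 0" b] wt_one wt_const
  by (auto simp: W_iff C_ring wt_add)

text \<open>An element of \<open>C\<close> of weight \<open>m\<close> is the monomial of weight \<open>m\<close> times an element of \<open>W\<close>. Setting
  all \<open>t i\<close> to one therefore means dividing every weight component by its monomial. On \<open>C\<close> this is
  an algebra homomorphism onto \<open>W\<close>, because the monomials are central in \<open>C\<close>.\<close>

definition aug :: "'q \<Rightarrow> 'q" where
  "aug q = (THE w. \<exists>F f. family F f q \<and> w = (\<Oplus>m \<in> F. inv (monom m) \<otimes> f m))"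

lemma inv_monom_closed [simp]: "inv (monom m) \<in> carrier Q" "monom m \<in> carrier Q" "monom m \<in> Units Q"
  using monom_Z[of m] Z_unit by auto

lemma aug_eqI:
  assumes f: "family F f q"
  shows "aug q = (\<Oplus>m \<in> F. inv (monom m) \<otimes> f m)"
  unfolding aug_def
proof (rule the_equality)
  show "\<exists>F' f'. family F' f' q \<and> (\<Oplus>m \<in> F. inv (monom m) \<otimes> f m) = (\<Oplus>m \<in> F'. inv (monom m) \<otimes> f' m)"
    using f by blast
  fix w assume "\<exists>F' f'. family F' f' q \<and> w = (\<Oplus>m \<in> F'. inv (monom m) \<otimes> f' m)"
  then obtain G g where g: "family G g q" "w = (\<Oplus>m \<in> G. inv (monom m) \<otimes> g m)" by blast
  have c: "\<And>m. f m \<in> carrier Q" using family_closed[OF f] .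
  have "q \<in> carrier Q" using f c by (auto simp: family_def)
  then have "g = f" using family_unique g f by blast
  have z: "f m = \<zero>" if "m \<notin> F \<or> m \<notin> G" for m
    using that f g \<open>g = f\<close> by (auto simp: family_def)
  have "(\<Oplus>m \<in> F. inv (monom m) \<otimes> f m) = (\<Oplus>m \<in> G. inv (monom m) \<otimes> f m)"
    by (rule add.finprod_mono_neutral_cong) (use f g c z in \<open>auto simp: family_def\<close>)
  then show "w = (\<Oplus>m \<in> F. inv (monom m) \<otimes> f m)" using g \<open>g = f\<close> by simp
qed

lemma aug_add:
  assumes "a \<in> carrier Q" "b \<in> carrier Q"
  shows "aug (a \<oplus> b) = aug a \<oplus> aug b"
proof -
  obtain F f where f: "family F f a" using family_ex assms by blast
  obtain G g where g: "family G g b" using family_ex assms by blast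
  have F: "finite (F \<union> G)" "F \<union> G \<subseteq> weights" using f g by (auto simp: family_def)
  have fg: "family (F \<union> G) f a" "family (F \<union> G) g b" using f g family_mono F by blast+
  have c: "\<And>m. f m \<in> carrier Q" "\<And>m. g m \<in> carrier Q" using family_closed f g by blast+
  have "aug (a \<oplus> b) = (\<Oplus>m \<in> F \<union> G. inv (monom m) \<otimes> f m \<oplus> inv (monom m) \<otimes> g m)"
    unfolding aug_eqI[OF family_add[OF f g]] using c by (simp add: r_distr)
  also have "\<dots> = aug a \<oplus> aug b"
    unfolding aug_eqI[OF fg(1)] aug_eqI[OF fg(2)] using c by (subst finsum_addf) auto
  finally show ?thesis .
qed

lemma aug_wt: "wt m c \<Longrightarrow> m \<in> weights \<Longrightarrow> aug c = inv (monom m) \<otimes> c"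
  using aug_eqI[OF family_single[of m c]] by simp

lemma aug_closed: "c \<in> C \<Longrightarrow> aug c \<in> W_alg n Q \<phi>"
proof (induction c rule: C_induct)
  case (wt m c)
  have "inv (monom m) \<in> carrier Z" using Z_inv_closed[OF monom_Z] .
  then have "inv (monom m) \<otimes> c \<in> C" using wt Z_C C_ring(2) by blast
  moreover have "wt (\<lambda>i. - m i + m i) (inv (monom m) \<otimes> c)"
    by (rule wt_mult[OF wt_inv[OF inv_monom_closed(3) wt_monom[OF wt(1)]] wt(3)])
  ultimately show ?case using wt by (simp add: aug_wt W_iff)
next
  case (add a b)
  then show ?case by (simp add: aug_add W_ring)
qed

lemma aug_mult:
  assumes a: "a \<in> C" and b: "b \<in> C"
  shows "aug (a \<otimes> b) = aug a \<otimes> aug b"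
proof -
  have cl: "aug c \<in> carrier Q" if "c \<in> C" for c using aug_closed[OF that] W_C by auto
  show ?thesis using a
  proof (induction a rule: C_induct)
    case (wt m a)
    note a = wt
    show ?case using b
    proof (induction b rule: C_induct)
      case (wt k b)
      let ?u = "inv (monom m)" and ?v = "inv (monom k)"
      have v: "?v \<in> carrier Z" using Z_inv_closed[OF monom_Z] .
      have c: "?u \<in> carrier Q" "?v \<in> carrier Q" "a \<in> carrier Q" "b \<in> carrier Q" using a wt by auto
      have "inv (monom (\<lambda>i. m i + k i)) = ?v \<otimes> ?u"
        unfolding monom_add by (rule inv_mult_units) simp_all
      moreover have "?u \<in> C" using Z_C[OF Z_inv_closed[OF monom_Z]] .
      ultimately have u: "inv (monom (\<lambda>i. m i + k i)) = ?u \<otimes> ?v" using Z_comm[OF v] by simp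
      have "aug (a \<otimes> b) = ?u \<otimes> ?v \<otimes> (a \<otimes> b)"
        using aug_wt[OF wt_mult[OF a(3) wt(3)] weights_closed(1)[OF a(1) wt(1)]] u by simp
      also have "\<dots> = ?u \<otimes> (?v \<otimes> a) \<otimes> b" using c by (simp add: m_assoc)
      also have "?v \<otimes> a = a \<otimes> ?v" using Z_comm[OF v a(2)] .
      finally show ?case using a wt c by (simp add: aug_wt m_assoc)
    next
      case (add b c)
      then show ?case using a cl C_ring by (simp add: r_distr aug_add)
    qed
  next
    case (add a c)
    then show ?case using b cl C_ring by (simp add: l_distr aug_add)
  qed
qed

lemma aug_W: "w \<in> W_alg n Q \<phi> \<Longrightarrow> aug w = w"
  using aug_wt[of "\<lambda>i. 0" w] weights_closed(3) by (simp add: W_iff monom_zero)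

lemma aug_t: "i \<in> {1..n} \<Longrightarrow> aug (t i) = \<one>"
  using aug_wt[OF wt_t unit_weight, of i] t_unit[of i] by (simp add: monom_unit_weight)

text \<open>The nontrivial inclusion holds since an element of \<open>C\<close> of weight \<open>m\<close> is the monomial of weight \<open>m\<close>
  times its augmentation.\<close>

lemma Um_S_W_eq: "Um_S_W n Q \<phi> = C"
proof
  let ?X = "range const \<union> {gen (mat_unit n 0 i) | i. i \<in> {1..n}} \<union> {inv (gen (mat_unit n 0 i)) | i. i \<in> {1..n}}"
  have C_gen: "generate_ring Q H \<subseteq> C" if "H \<subseteq> C" for H
  proof
    fix x assume "x \<in> generate_ring Q H"
    then show "x \<in> C" by induction (use that C_ring in auto)
  qed
  have "?X \<subseteq> C" using C_t by (auto simp: C_ring simp flip: t_def)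
  then have "Um_S n Q \<phi> \<subseteq> C" unfolding Um_S_def by (rule C_gen)
  then show "Um_S_W n Q \<phi> \<subseteq> C" unfolding Um_S_W_def using W_C by (intro C_gen) blast
  let ?B = "Um_S_W n Q \<phi>"
  have B: "a \<oplus> b \<in> ?B" "a \<otimes> b \<in> ?B" if "a \<in> ?B" "b \<in> ?B" for a b
    using that unfolding Um_S_W_def by (auto intro: generate_ring.intros)
  have one: "\<one> \<in> ?B" unfolding Um_S_W_def by (rule generate_ring.one)
  have t: "t i \<in> ?B" "inv (t i) \<in> ?B" if "i \<in> {1..n}" for i
    using that unfolding Um_S_W_def Um_S_def t_def
    by (auto intro!: generate_ring.incl)
  have W: "w \<in> ?B" if "w \<in> W_alg n Q \<phi>" for w
    using that unfolding Um_S_W_def by (intro generate_ring.incl) simp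
  have pow: "t i [^]\<^bsub>Z\<^esub> (k :: int) \<in> ?B" if i: "i \<in> {1..n}" for i k
  proof -
    have p: "u [^]\<^bsub>Z\<^esub> (l :: nat) \<in> ?B" if "u \<in> ?B" for u l
      by (induction l) (use one B that in auto)
    obtain l where "k = int l \<or> k = - int l" by (cases k rule: int_cases2) auto
    then show ?thesis
    proof
      assume "k = - int l"
      \<comment> \<open>Negative powers are powers of the inverse, since \<open>?B\<close> contains \<open>inv (t i)\<close> as a generator.\<close>
      then have "t i [^]\<^bsub>Z\<^esub> k = (inv (t i)) [^]\<^bsub>Z\<^esub> l"
        using Z.int_pow_neg_int[OF t_Z[OF i], of l] Z.nat_pow_inv[OF t_Z[OF i], of l] Z_inv[OF t_Z[OF i]] by simp
      then show ?thesis using p[OF t(2)[OF i]] by simp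
    qed (use p t i in \<open>simp add: int_pow_int\<close>)
  qed
  have monom: "monom m \<in> ?B" for m
  proof -
    have "finite I \<Longrightarrow> I \<subseteq> {1..n} \<Longrightarrow> (\<Otimes>\<^bsub>Z\<^esub>i \<in> I. t i [^]\<^bsub>Z\<^esub> m i) \<in> ?B" for I
    proof (induction rule: finite_induct)
      case (insert j I)
      have "(\<Otimes>\<^bsub>Z\<^esub>i \<in> insert j I. t i [^]\<^bsub>Z\<^esub> m i) = t j [^]\<^bsub>Z\<^esub> m j \<otimes>\<^bsub>Z\<^esub> (\<Otimes>\<^bsub>Z\<^esub>i \<in> I. t i [^]\<^bsub>Z\<^esub> m i)"
        using insert t_pow_Z by (intro Z.finprod_insert) (auto simp del: Z_simps)
      then show ?case using insert pow B by simp
    qed (simp add: one)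
    then show ?thesis unfolding monom_def by blast
  qed
  show "C \<subseteq> ?B"
  proof
    fix c assume "c \<in> C"
    then show "c \<in> ?B"
    proof (induction c rule: C_induct)
      case (wt m c)
      have "c = monom m \<otimes> aug c" using wt by (simp add: aug_wt unit_cancel)
      then show ?case using monom W aug_closed wt B by metis
    qed (rule B)
  qed
qed

end

section \<open>The tensor product\<close>

lemma alg_moduleD:
  assumes "alg_module n Q \<phi> A M"
  shows "vectorspace cfield M"
    and "a \<in> A \<Longrightarrow> linear_op M M (act M a)"
    and "a \<in> A \<Longrightarrow> b \<in> A \<Longrightarrow> v \<in> carrier M \<Longrightarrow> act M (a \<oplus>\<^bsub>Q\<^esub> b) v = act M a v \<oplus>\<^bsub>M\<^esub> act M b v"
    and "a \<in> A \<Longrightarrow> b \<in> A \<Longrightarrow> v \<in> carrier M \<Longrightarrow> act M (a \<otimes>\<^bsub>Q\<^esub> b) v = act M a (act M b v)"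
    and "v \<in> carrier M \<Longrightarrow> act M \<one>\<^bsub>Q\<^esub> v = v"
    and "v \<in> carrier M \<Longrightarrow> act M (q_const n \<phi> c) v = c \<odot>\<^bsub>M\<^esub> v"
  using assms by (auto simp: alg_module_def linear_op_def linear_op_axioms_def)

lemma alg_module_mono: "alg_module n Q \<phi> A M \<Longrightarrow> B \<subseteq> A \<Longrightarrow> alg_module n Q \<phi> B M"
  unfolding alg_module_def by blast

lemma tensor_relations_cases [consumes 1, case_names left right balanced]:
  assumes "r \<in> tensor_relations Q B V"
  obtains a b v where "r = frag_of (a \<oplus>\<^bsub>Q\<^esub> b, v) - (frag_of (a, v) + frag_of (b, v))"
      "a \<in> carrier Q" "b \<in> carrier Q" "v \<in> carrier V"
  | a v w where "r = frag_of (a, v \<oplus>\<^bsub>V\<^esub> w) - (frag_of (a, v) + frag_of (a, w))"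
      "a \<in> carrier Q" "v \<in> carrier V" "w \<in> carrier V"
  | a c v where "r = frag_of (a \<otimes>\<^bsub>Q\<^esub> c, v) - frag_of (a, act V c v)"
      "a \<in> carrier Q" "c \<in> B" "v \<in> carrier V"
  using assms unfolding tensor_relations_def by blast

locale tensor_product = localized n Q \<phi>
  for n :: nat and Q :: "'q ring" (structure) and \<phi> :: "env \<Rightarrow> 'q" +
  fixes V :: "('q, 'v) rep"
  assumes V_mod: "alg_module n Q \<phi> C V"
begin

sublocale V: vectorspace cfield V by (rule alg_moduleD(1)[OF V_mod])

lemmas V_op = alg_moduleD(2)[OF V_mod]
lemmas V_act = linear_op.closed[OF V_op] linear_op.add[OF V_op] linear_op.smult[OF V_op]
  linear_op.zero[OF V_op] alg_moduleD(3-6)[OF V_mod]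

abbreviation "TF \<equiv> tensor_free Q V"
abbreviation "TN \<equiv> tensor_null Q C V"
abbreviation "cls \<equiv> tensor_class Q C V"
abbreviation "T \<equiv> tensor n Q \<phi> C V"

sublocale TF: comm_group TF
  unfolding tensor_free_def by (rule abelian_free_Abelian_group)

lemma TF_simps [simp]:
  "z \<in> carrier TF \<longleftrightarrow> Poly_Mapping.keys z \<subseteq> carrier Q \<times> carrier V"
  "y \<otimes>\<^bsub>TF\<^esub> z = y + z" "\<one>\<^bsub>TF\<^esub> = 0"
  by (simp_all add: tensor_free_def)

lemma TF_inv: "z \<in> carrier TF \<Longrightarrow> inv\<^bsub>TF\<^esub> z = - z"
  by (simp add: tensor_free_def)

lemma frag_of_TF: "q \<in> carrier Q \<Longrightarrow> v \<in> carrier V \<Longrightarrow> frag_of (q, v) \<in> carrier TF"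
  by simp

lemma TF_closed:
  assumes "y \<in> carrier TF" "z \<in> carrier TF"
  shows "y + z \<in> carrier TF" "- z \<in> carrier TF" "y - z \<in> carrier TF"
proof -
  show "y + z \<in> carrier TF" using TF.m_closed[OF assms] by (simp only: TF_simps(2))
  show m: "- z \<in> carrier TF" using TF.inv_closed[OF assms(2)] by (simp only: TF_inv[OF assms(2)])
  show "y - z \<in> carrier TF" using TF.m_closed[OF assms(1) m] by (simp only: TF_simps(2)) simp
qed

lemma tensor_relations_carrier: "tensor_relations Q C V \<subseteq> carrier TF"
  unfolding tensor_relations_def
  by (auto intro!: TF_closed frag_of_TF simp: V_act simp del: TF_simps)

lemma TN_subgroup: "subgroup TN TF"
  unfolding tensor_null_def by (rule TF.generate_is_subgroup[OF tensor_relations_carrier])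

sublocale TN: normal TN TF
  by (rule TF.subgroup_imp_normal[OF TN_subgroup])

lemma cls_eq_iff:
  assumes "y \<in> carrier TF" "z \<in> carrier TF"
  shows "cls y = cls z \<longleftrightarrow> y - z \<in> TN"
proof -
  have "y \<otimes>\<^bsub>TF\<^esub> inv\<^bsub>TF\<^esub> z = y - z" using TF_inv[OF assms(2)] by simp
  then have "y \<in> cls z \<longleftrightarrow> y - z \<in> TN"
    unfolding tensor_class_def using TN.rcos_module[OF TF.is_group assms(2,1)] by simp
  then show ?thesis
    unfolding tensor_class_def
    using TF.repr_independence[OF _ assms(2) TN_subgroup] TF.repr_independenceD[OF TN_subgroup assms(1)]
    by metis
qed

lemma mem_cls:
  assumes "y \<in> cls z" "z \<in> carrier TF"
  shows "y \<in> carrier TF" "cls y = cls z"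
  using assms TN.elemrcos_carrier[OF TF.is_group assms(2)] TF.repr_independence[OF _ assms(2) TN_subgroup]
  unfolding tensor_class_def by auto

lemma self_cls: "z \<in> carrier TF \<Longrightarrow> z \<in> cls z"
  unfolding tensor_class_def by (rule TF.rcos_self[OF _ TN_subgroup])

lemma T_carrier: "carrier T = cls ` carrier TF"
  by (auto simp: tensor_def FactGroup_def RCOSETS_def tensor_class_def)

lemma T_zero: "\<zero>\<^bsub>T\<^esub> = cls 0"
  using TF.coset_mult_one[OF TN.subset] by (simp add: tensor_def FactGroup_def tensor_class_def)

lemma T_add: "y \<in> carrier TF \<Longrightarrow> z \<in> carrier TF \<Longrightarrow> cls y \<oplus>\<^bsub>T\<^esub> cls z = cls (y + z)"
  using TN.rcos_sum[of y z] by (simp add: tensor_def FactGroup_def tensor_class_def del: TF_simps(1))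

lemma T_abelian_group: "abelian_group T"
proof (rule abelian_groupI)
  fix x y assume "x \<in> carrier T" "y \<in> carrier T"
  then obtain a b where ab: "a \<in> carrier TF" "b \<in> carrier TF" "x = cls a" "y = cls b"
    unfolding T_carrier by blast
  show "x \<oplus>\<^bsub>T\<^esub> y \<in> carrier T" unfolding T_carrier using ab TF_closed(1) T_add by auto
  show "x \<oplus>\<^bsub>T\<^esub> y = y \<oplus>\<^bsub>T\<^esub> x" unfolding ab T_add[OF ab(1,2)] T_add[OF ab(2,1)] by (simp add: add.commute)
  fix z assume "z \<in> carrier T"
  then obtain c where c: "c \<in> carrier TF" "z = cls c" unfolding T_carrier by blast
  show "x \<oplus>\<^bsub>T\<^esub> y \<oplus>\<^bsub>T\<^esub> z = x \<oplus>\<^bsub>T\<^esub> (y \<oplus>\<^bsub>T\<^esub> z)"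
    unfolding ab c T_add[OF ab(1,2)] T_add[OF ab(2) c(1)] T_add[OF TF_closed(1)[OF ab(1,2)] c(1)]
      T_add[OF ab(1) TF_closed(1)[OF ab(2) c(1)]] by (simp add: add.assoc)
next
  have z: "0 \<in> carrier TF" by simp
  then show "\<zero>\<^bsub>T\<^esub> \<in> carrier T" unfolding T_zero T_carrier by blast
  fix x assume "x \<in> carrier T"
  then obtain a where a: "a \<in> carrier TF" "x = cls a" unfolding T_carrier by blast
  show "\<zero>\<^bsub>T\<^esub> \<oplus>\<^bsub>T\<^esub> x = x" unfolding T_zero a T_add[OF z a(1)] by simp
  have "cls (- a) \<oplus>\<^bsub>T\<^esub> x = \<zero>\<^bsub>T\<^esub>" "cls (- a) \<in> carrier T"
    unfolding T_zero a T_add[OF TF_closed(2)[OF z a(1)] a(1)] T_carrier using TF_closed(2)[OF z a(1)] by simp_all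
  then show "\<exists>y \<in> carrier T. y \<oplus>\<^bsub>T\<^esub> x = \<zero>\<^bsub>T\<^esub>" by blast
qed

sublocale TG: abelian_group T by (rule T_abelian_group)

definition tens :: "'q \<Rightarrow> 'v \<Rightarrow> ('q \<times> 'v \<Rightarrow>\<^sub>0 int) set" where
  "tens q v = cls (frag_of (q, v))"

lemma tens_closed: "q \<in> carrier Q \<Longrightarrow> v \<in> carrier V \<Longrightarrow> tens q v \<in> carrier T"
  unfolding tens_def T_carrier using frag_of_TF by blast

lemma rel_TN: "r \<in> tensor_relations Q C V \<Longrightarrow> r \<in> TN"
  unfolding tensor_null_def by (rule generate.incl)

lemma tens_add_left:
  assumes "a \<in> carrier Q" "b \<in> carrier Q" "v \<in> carrier V"
  shows "tens (a \<oplus> b) v = tens a v \<oplus>\<^bsub>T\<^esub> tens b v"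
proof -
  have "frag_of (a \<oplus> b, v) - (frag_of (a, v) + frag_of (b, v)) \<in> TN"
    by (rule rel_TN) (use assms in \<open>unfold tensor_relations_def, blast\<close>)
  then show ?thesis
    unfolding tens_def using assms frag_of_TF TF_closed(1)
    by (subst T_add) (simp_all add: cls_eq_iff del: TF_simps)
qed

lemma tens_add_right:
  assumes "a \<in> carrier Q" "v \<in> carrier V" "w \<in> carrier V"
  shows "tens a (v \<oplus>\<^bsub>V\<^esub> w) = tens a v \<oplus>\<^bsub>T\<^esub> tens a w"
proof -
  have "frag_of (a, v \<oplus>\<^bsub>V\<^esub> w) - (frag_of (a, v) + frag_of (a, w)) \<in> TN"
    by (rule rel_TN) (use assms in \<open>unfold tensor_relations_def, blast\<close>)
  then show ?thesis
    unfolding tens_def using assms frag_of_TF TF_closed(1)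
    by (subst T_add) (simp_all add: cls_eq_iff del: TF_simps)
qed

lemma tens_balanced:
  assumes "a \<in> carrier Q" "c \<in> C" "v \<in> carrier V"
  shows "tens (a \<otimes> c) v = tens a (act V c v)"
proof -
  have "frag_of (a \<otimes> c, v) - frag_of (a, act V c v) \<in> TN"
    by (rule rel_TN) (use assms in \<open>unfold tensor_relations_def, blast\<close>)
  then show ?thesis
    unfolding tens_def using assms frag_of_TF V_act(1) by (simp add: cls_eq_iff del: TF_simps)
qed

lemma tens_zero_left: "v \<in> carrier V \<Longrightarrow> tens \<zero> v = \<zero>\<^bsub>T\<^esub>"
  using tens_add_left[of \<zero> \<zero> v] tens_closed[of \<zero> v] by (simp add: TG.add.l_cancel_one')

lemma tens_zero_right: "a \<in> carrier Q \<Longrightarrow> tens a \<zero>\<^bsub>V\<^esub> = \<zero>\<^bsub>T\<^esub>"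
  using tens_add_right[of a "\<zero>\<^bsub>V\<^esub>" "\<zero>\<^bsub>V\<^esub>"] tens_closed[of a "\<zero>\<^bsub>V\<^esub>"] by (simp add: TG.add.l_cancel_one')

text \<open>Negatives need no case of their own, since \<open>- (q \<otimes> v) = (- q) \<otimes> v\<close>.\<close>

lemma T_induct [consumes 1, case_names tens add]:
  assumes x: "x \<in> carrier T"
    and tens: "\<And>q v. q \<in> carrier Q \<Longrightarrow> v \<in> carrier V \<Longrightarrow> P (tens q v)"
    and add: "\<And>x y. x \<in> carrier T \<Longrightarrow> y \<in> carrier T \<Longrightarrow> P x \<Longrightarrow> P y \<Longrightarrow> P (x \<oplus>\<^bsub>T\<^esub> y)"
  shows "P x"
proof -
  obtain z where z: "z \<in> carrier TF" "x = cls z" using x T_carrier by blast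
  have cl: "cls a \<in> carrier T" if "a \<in> carrier TF" for a using that T_carrier by blast
  have "P (cls z) \<and> P (cls (- z))"
    using z(1)[unfolded TF_simps]
  proof (rule free_Abelian_group_induct)
    have "P (cls 0)" using tens[of \<zero> "\<zero>\<^bsub>V\<^esub>"] tens_zero_left[of "\<zero>\<^bsub>V\<^esub>"] T_zero by simp
    then show "P (cls 0) \<and> P (cls (- 0))" by simp
  next
    fix a b :: "'q \<times> 'v \<Rightarrow>\<^sub>0 int"
    assume *: "Poly_Mapping.keys a \<subseteq> carrier Q \<times> carrier V" "Poly_Mapping.keys b \<subseteq> carrier Q \<times> carrier V"
      and IH: "P (cls a) \<and> P (cls (- a))" "P (cls b) \<and> P (cls (- b))"
    have ab: "a \<in> carrier TF" "b \<in> carrier TF" using * by auto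
    note mab = TF_closed(2)[OF ab(1) ab(2)] TF_closed(2)[OF ab(2) ab(1)]
    have "cls (a - b) = cls a \<oplus>\<^bsub>T\<^esub> cls (- b)" using T_add[OF ab(1) mab(1)] by simp
    moreover have "cls (- (a - b)) = cls b \<oplus>\<^bsub>T\<^esub> cls (- a)" using T_add[OF ab(2) mab(2)] by simp
    ultimately show "P (cls (a - b)) \<and> P (cls (- (a - b)))"
      using IH add cl ab mab by metis
  next
    fix p assume "p \<in> carrier Q \<times> carrier V"
    then obtain q v where p: "p = (q, v)" "q \<in> carrier Q" "v \<in> carrier V" by auto
    have f: "frag_of p \<in> carrier TF" using p by simp
    have "tens q v \<oplus>\<^bsub>T\<^esub> tens (\<ominus> q) v = \<zero>\<^bsub>T\<^esub>"
      using tens_add_left[of q "\<ominus> q" v] p tens_zero_left by (simp add: r_neg)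
    moreover have "tens q v \<oplus>\<^bsub>T\<^esub> cls (- frag_of p) = \<zero>\<^bsub>T\<^esub>"
      unfolding tens_def p(1)[symmetric] T_zero using T_add[OF f TF_closed(2)[OF f f]] by simp
    ultimately have "cls (- frag_of p) = tens (\<ominus> q) v"
      using p tens_closed cl[OF TF_closed(2)[OF f f]] by (metis TG.add_diff_cancel(1) a_inv_closed)
    then show "P (cls (frag_of p)) \<and> P (cls (- frag_of p))"
      using tens[of q v] tens[of "\<ominus> q" v] p by (simp add: tens_def)
  qed
  then show ?thesis using z by simp
qed

lemma additive_ext:
  assumes f: "\<And>x. x \<in> carrier T \<Longrightarrow> f x \<in> carrier M" "\<And>x y. x \<in> carrier T \<Longrightarrow> y \<in> carrier T \<Longrightarrow> f (x \<oplus>\<^bsub>T\<^esub> y) = f x \<oplus>\<^bsub>M\<^esub> f y"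
    and g: "\<And>x y. x \<in> carrier T \<Longrightarrow> y \<in> carrier T \<Longrightarrow> g (x \<oplus>\<^bsub>T\<^esub> y) = g x \<oplus>\<^bsub>M\<^esub> g y"
    and eq: "\<And>q v. q \<in> carrier Q \<Longrightarrow> v \<in> carrier V \<Longrightarrow> f (tens q v) = g (tens q v)"
    and x: "x \<in> carrier T"
  shows "f x = g x"
  using x by (induction x rule: T_induct) (simp_all add: eq f g)

text \<open>A balanced map extends to the free abelian group, where it kills the relations.\<close>

theorem tensor_universal:
  fixes M (structure)
  assumes M: "abelian_group M"
    and closed: "\<And>q v. q \<in> carrier Q \<Longrightarrow> v \<in> carrier V \<Longrightarrow> g q v \<in> carrier M"
    and left: "\<And>a b v. a \<in> carrier Q \<Longrightarrow> b \<in> carrier Q \<Longrightarrow> v \<in> carrier V \<Longrightarrow> g (a \<oplus>\<^bsub>Q\<^esub> b) v = g a v \<oplus>\<^bsub>M\<^esub> g b v"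
    and right: "\<And>a v w. a \<in> carrier Q \<Longrightarrow> v \<in> carrier V \<Longrightarrow> w \<in> carrier V \<Longrightarrow> g a (v \<oplus>\<^bsub>V\<^esub> w) = g a v \<oplus>\<^bsub>M\<^esub> g a w"
    and balanced: "\<And>a c v. a \<in> carrier Q \<Longrightarrow> c \<in> C \<Longrightarrow> v \<in> carrier V \<Longrightarrow> g (a \<otimes>\<^bsub>Q\<^esub> c) v = g a (act V c v)"
  obtains f where "\<And>x. x \<in> carrier T \<Longrightarrow> f x \<in> carrier M"
    "\<And>x y. x \<in> carrier T \<Longrightarrow> y \<in> carrier T \<Longrightarrow> f (x \<oplus>\<^bsub>T\<^esub> y) = f x \<oplus>\<^bsub>M\<^esub> f y"
    "\<And>q v. q \<in> carrier Q \<Longrightarrow> v \<in> carrier V \<Longrightarrow> f (tens q v) = g q v"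
proof -
  interpret M: abelian_group M by fact
  have cg: "comm_group (add_monoid M)" by (rule M.a_comm_group)
  have sub: "(\<lambda>(q, v). g q v) ` (carrier Q \<times> carrier V) \<subseteq> carrier (add_monoid M)"
    using closed by auto
  obtain k where k: "k \<in> hom (free_Abelian_group (carrier Q \<times> carrier V)) (add_monoid M)"
    "\<And>p. p \<in> carrier Q \<times> carrier V \<Longrightarrow> k (frag_of p) = (\<lambda>(q, v). g q v) p"
    using comm_group.free_Abelian_group_universal[OF cg sub] by blast
  have kc: "k z \<in> carrier M" if "z \<in> carrier TF" for z
    using hom_in_carrier[OF k(1)] that by (simp add: tensor_free_def)
  have ka: "k (y + z) = k y \<oplus>\<^bsub>M\<^esub> k z" if "y \<in> carrier TF" "z \<in> carrier TF" for y z
    using hom_mult[OF k(1), of y z] that by (simp add: tensor_free_def)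
  have k0: "k 0 = \<zero>\<^bsub>M\<^esub>" using ka[of 0 0] kc[of 0] by (simp add: M.add.l_cancel_one')
  have km: "k (y - z) = k y \<ominus>\<^bsub>M\<^esub> k z" if "y \<in> carrier TF" "z \<in> carrier TF" for y z
  proof -
    have "k (y - z) \<oplus>\<^bsub>M\<^esub> k z = k y" using ka[OF TF_closed(3)[OF that] that(2)] by simp
    then show ?thesis
      using kc[OF TF_closed(3)[OF that]] kc that M.add_diff_cancel(1)[of "k z" "k (y - z)"] M.a_comm by metis
  qed
  have fr: "frag_of (q, v) \<in> carrier TF" "k (frag_of (q, v)) = g q v" if "q \<in> carrier Q" "v \<in> carrier V" for q v
    using that k(2)[of "(q, v)"] by simp_all
  have rel: "k r = \<zero>\<^bsub>M\<^esub>" if "r \<in> tensor_relations Q C V" for r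
  proof -
    have 1: "k (frag_of (a \<oplus>\<^bsub>Q\<^esub> b, v) - (frag_of (a, v) + frag_of (b, v))) = \<zero>\<^bsub>M\<^esub>"
      if "a \<in> carrier Q" "b \<in> carrier Q" "v \<in> carrier V" for a b v
      using that by (subst km) (auto simp: fr ka closed left TF_closed simp del: TF_simps)
    have 2: "k (frag_of (a, v \<oplus>\<^bsub>V\<^esub> w) - (frag_of (a, v) + frag_of (a, w))) = \<zero>\<^bsub>M\<^esub>"
      if "a \<in> carrier Q" "v \<in> carrier V" "w \<in> carrier V" for a v w
      using that by (subst km) (auto simp: fr ka closed right TF_closed simp del: TF_simps)
    have 3: "k (frag_of (a \<otimes>\<^bsub>Q\<^esub> c, v) - frag_of (a, act V c v)) = \<zero>\<^bsub>M\<^esub>"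
      if "a \<in> carrier Q" "c \<in> C" "v \<in> carrier V" for a c v
      using that by (subst km) (auto simp: fr closed balanced V_act simp del: TF_simps)
    from that show ?thesis by (cases rule: tensor_relations_cases) (simp_all only: 1 2 3)
  qed
  have null: "z \<in> carrier TF \<and> k z = \<zero>\<^bsub>M\<^esub>" if "z \<in> TN" for z
    using that unfolding tensor_null_def
  proof (induction rule: generate.induct)
    case one
    then show ?case by (simp add: k0)
  next
    case (incl r)
    then show ?case using rel tensor_relations_carrier by blast
  next
    case (inv r)
    then have r: "r \<in> carrier TF" "k r = \<zero>\<^bsub>M\<^esub>" using rel tensor_relations_carrier by blast+
    have "k (0 - r) = \<zero>\<^bsub>M\<^esub>" using km[of 0 r] r by (simp add: k0 del: TF_simps) (simp add: M.minus_eq)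
    then show ?case using TF_inv[OF r(1)] TF_closed(2)[OF r(1) r(1)] by simp
  next
    case (eng y z)
    then show ?case using ka TF_closed(1)[of y z] by simp
  qed
  define f where "f X = k (SOME z. z \<in> X)" for X
  have f: "f (cls z) = k z" if z: "z \<in> carrier TF" for z
  proof -
    have s: "(SOME y. y \<in> cls z) \<in> cls z" using self_cls[OF z] by (rule someI)
    then have c: "(SOME y. y \<in> cls z) \<in> carrier TF" and "(SOME y. y \<in> cls z) - z \<in> TN"
      using mem_cls[OF s z] cls_eq_iff z by auto
    then have "k (SOME y. y \<in> cls z) \<ominus>\<^bsub>M\<^esub> k z = \<zero>\<^bsub>M\<^esub>" using null km[OF c z] by metis
    then show ?thesis unfolding f_def using kc[OF c] kc[OF z] by simp
  qed
  show thesis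
  proof (rule that[of f])
    show "f x \<in> carrier M" if "x \<in> carrier T" for x
      using that f kc unfolding T_carrier by auto
    show "f (x \<oplus>\<^bsub>T\<^esub> y) = f x \<oplus>\<^bsub>M\<^esub> f y" if xy: "x \<in> carrier T" "y \<in> carrier T" for x y
    proof -
      obtain a b where ab: "a \<in> carrier TF" "b \<in> carrier TF" "x = cls a" "y = cls b"
        using xy unfolding T_carrier by blast
      show ?thesis
        unfolding ab T_add[OF ab(1,2)] f[OF ab(1)] f[OF ab(2)] f[OF TF_closed(1)[OF ab(1,2)]]
        by (rule ka[OF ab(1,2)])
    qed
    show "f (tens q v) = g q v" if "q \<in> carrier Q" "v \<in> carrier V" for q v
      using f[OF fr(1)[OF that]] fr(2)[OF that] by (simp add: tens_def)
  qed
qed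

end

text \<open>Both the left multiplication on a tensor product and the value of \<open>G\<close> on a morphism are
  induced by a pair of maps in this way.\<close>

locale tensor_map = X: tensor_product n Q \<phi> V + Y: tensor_product n Q \<phi> V'
  for n :: nat and Q :: "'q ring" (structure) and \<phi> :: "env \<Rightarrow> 'q"
    and V :: "('q, 'v) rep" and V' :: "('q, 'w) rep" +
  fixes \<alpha> :: "'q \<Rightarrow> 'q" and f :: "'v \<Rightarrow> 'w"
  assumes \<alpha>_closed: "q \<in> carrier Q \<Longrightarrow> \<alpha> q \<in> carrier Q"
    and \<alpha>_add: "a \<in> carrier Q \<Longrightarrow> b \<in> carrier Q \<Longrightarrow> \<alpha> (a \<oplus> b) = \<alpha> a \<oplus> \<alpha> b"
    and \<alpha>_mult: "a \<in> carrier Q \<Longrightarrow> c \<in> X.C \<Longrightarrow> \<alpha> (a \<otimes> c) = \<alpha> a \<otimes> c"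
    and f_closed: "v \<in> carrier V \<Longrightarrow> f v \<in> carrier V'"
    and f_add: "v \<in> carrier V \<Longrightarrow> w \<in> carrier V \<Longrightarrow> f (v \<oplus>\<^bsub>V\<^esub> w) = f v \<oplus>\<^bsub>V'\<^esub> f w"
    and f_act: "c \<in> X.C \<Longrightarrow> v \<in> carrier V \<Longrightarrow> f (act V c v) = act V' c (f v)"
begin

abbreviation "lift z \<equiv> frag_extend (\<lambda>(b, v). frag_of (\<alpha> b, f v)) z"

definition induced :: "('q \<times> 'v \<Rightarrow>\<^sub>0 int) set \<Rightarrow> ('q \<times> 'w \<Rightarrow>\<^sub>0 int) set" where
  "induced X = (\<Union>z \<in> X. tensor_class Q X.C V' (lift z))"

lemma lift_closed: "z \<in> carrier X.TF \<Longrightarrow> lift z \<in> carrier Y.TF"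
proof -
  assume z: "z \<in> carrier X.TF"
  have "Poly_Mapping.keys (lift z) \<subseteq> (\<Union>p \<in> Poly_Mapping.keys z. Poly_Mapping.keys (case p of (b, v) \<Rightarrow> frag_of (\<alpha> b, f v)))"
    by (rule keys_frag_extend)
  also have "\<dots> \<subseteq> carrier Q \<times> carrier V'"
    using z by (auto simp: \<alpha>_closed f_closed)
  finally show ?thesis by simp
qed

lemma lift_relation:
  assumes "r \<in> tensor_relations Q X.C V"
  shows "lift r \<in> Y.TN"
proof -
  from assms show ?thesis
  proof (cases rule: tensor_relations_cases)
    case (left a b v)
    then have "lift r = frag_of (\<alpha> a \<oplus> \<alpha> b, f v) - (frag_of (\<alpha> a, f v) + frag_of (\<alpha> b, f v))"
      by (simp add: frag_extend_diff frag_extend_add \<alpha>_add)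
    also have "\<dots> \<in> tensor_relations Q X.C V'"
      using left \<alpha>_closed f_closed unfolding tensor_relations_def by blast
    finally show ?thesis by (rule Y.rel_TN)
  next
    case (right a v w)
    then have "lift r = frag_of (\<alpha> a, f v \<oplus>\<^bsub>V'\<^esub> f w) - (frag_of (\<alpha> a, f v) + frag_of (\<alpha> a, f w))"
      by (simp add: frag_extend_diff frag_extend_add f_add)
    also have "\<dots> \<in> tensor_relations Q X.C V'"
      using right \<alpha>_closed f_closed unfolding tensor_relations_def by blast
    finally show ?thesis by (rule Y.rel_TN)
  next
    case (balanced a c v)
    then have "lift r = frag_of (\<alpha> a \<otimes> c, f v) - frag_of (\<alpha> a, act V' c (f v))"
      by (simp add: frag_extend_diff \<alpha>_mult f_act)
    also have "\<dots> \<in> tensor_relations Q X.C V'"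
      using balanced \<alpha>_closed f_closed unfolding tensor_relations_def by blast
    finally show ?thesis by (rule Y.rel_TN)
  qed
qed

lemma lift_null: "z \<in> X.TN \<Longrightarrow> lift z \<in> Y.TN"
  unfolding tensor_null_def[of Q "X.C" V]
proof (induction rule: generate.induct)
  case one
  then show ?case using Y.TN.one_closed by simp
next
  case (incl r)
  then show ?case by (rule lift_relation)
next
  case (inv r)
  then have r: "r \<in> carrier X.TF" using X.tensor_relations_carrier by blast
  have "inv\<^bsub>Y.TF\<^esub> (lift r) \<in> Y.TN" using lift_relation[OF inv] by (rule Y.TN.m_inv_closed)
  then show ?case
    using X.TF_inv[OF r] Y.TF_inv[OF lift_closed[OF r]] by (simp add: frag_extend_minus)
next
  case (eng y z)
  then show ?case using Y.TN.m_closed[of "lift y" "lift z"] by (simp add: frag_extend_add)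
qed

lemma induced_cls:
  assumes z: "z \<in> carrier X.TF"
  shows "induced (X.cls z) = Y.cls (lift z)"
proof -
  have "Y.cls (lift y) = Y.cls (lift z)" if "y \<in> X.cls z" for y
  proof -
    have y: "y \<in> carrier X.TF" "y - z \<in> X.TN" using X.mem_cls[OF that z] X.cls_eq_iff z by auto
    then show ?thesis
      using Y.cls_eq_iff[OF lift_closed[OF y(1)] lift_closed[OF z]] lift_null[OF y(2)]
      by (simp add: frag_extend_diff)
  qed
  then show ?thesis unfolding induced_def using X.self_cls[OF z] by blast
qed

lemma induced_closed: "x \<in> carrier X.T \<Longrightarrow> induced x \<in> carrier Y.T"
  unfolding X.T_carrier Y.T_carrier using induced_cls lift_closed by auto

lemma induced_add:
  assumes "x \<in> carrier X.T" "y \<in> carrier X.T"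
  shows "induced (x \<oplus>\<^bsub>X.T\<^esub> y) = induced x \<oplus>\<^bsub>Y.T\<^esub> induced y"
proof -
  obtain a b where ab: "a \<in> carrier X.TF" "b \<in> carrier X.TF" "x = X.cls a" "y = X.cls b"
    using assms unfolding X.T_carrier by blast
  show ?thesis
    unfolding ab X.T_add[OF ab(1,2)] induced_cls[OF ab(1)] induced_cls[OF ab(2)]
      induced_cls[OF X.TF_closed(1)[OF ab(1,2)]] frag_extend_add
      Y.T_add[OF lift_closed[OF ab(1)] lift_closed[OF ab(2)]] ..
qed

lemma induced_tens:
  assumes "q \<in> carrier Q" "v \<in> carrier V"
  shows "induced (X.tens q v) = Y.tens (\<alpha> q) (f v)"
  unfolding X.tens_def Y.tens_def induced_cls[OF X.frag_of_TF[OF assms]] by simp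

end

context tensor_product begin

lemma lmult_map: "a \<in> carrier Q \<Longrightarrow> tensor_map n Q \<phi> V V (\<lambda>q. a \<otimes> q) (\<lambda>v. v)"
  by unfold_locales (auto simp: r_distr m_assoc)

lemma act_T: "act T a = tensor_lmult Q C V a"
  by (simp add: tensor_def)

lemma act_T_induced: "a \<in> carrier Q \<Longrightarrow> act T a = tensor_map.induced n Q \<phi> V (\<lambda>q. a \<otimes> q) (\<lambda>v. v)"
  by (rule ext) (simp add: act_T tensor_lmult_def tensor_map.induced_def[OF lmult_map])

lemma act_T_closed: "a \<in> carrier Q \<Longrightarrow> x \<in> carrier T \<Longrightarrow> act T a x \<in> carrier T"
  unfolding act_T_induced by (rule tensor_map.induced_closed[OF lmult_map])

lemma act_T_add: "a \<in> carrier Q \<Longrightarrow> x \<in> carrier T \<Longrightarrow> y \<in> carrier T \<Longrightarrow>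
    act T a (x \<oplus>\<^bsub>T\<^esub> y) = act T a x \<oplus>\<^bsub>T\<^esub> act T a y"
  unfolding act_T_induced by (rule tensor_map.induced_add[OF lmult_map])

lemma act_T_tens: "a \<in> carrier Q \<Longrightarrow> q \<in> carrier Q \<Longrightarrow> v \<in> carrier V \<Longrightarrow> act T a (tens q v) = tens (a \<otimes> q) v"
  unfolding act_T_induced by (rule tensor_map.induced_tens[OF lmult_map])

lemma smult_T: "c \<odot>\<^bsub>T\<^esub> x = act T (const c) x"
  by (simp add: tensor_def)

lemma act_T_mult:
  assumes "a \<in> carrier Q" "b \<in> carrier Q" "x \<in> carrier T"
  shows "act T (a \<otimes> b) x = act T a (act T b x)"
  using assms(3)
  by (induction x rule: T_induct) (use assms in \<open>simp_all add: act_T_tens act_T_add act_T_closed m_assoc\<close>)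

lemma act_T_plus:
  assumes "a \<in> carrier Q" "b \<in> carrier Q" "x \<in> carrier T"
  shows "act T (a \<oplus> b) x = act T a x \<oplus>\<^bsub>T\<^esub> act T b x"
  using assms(3)
  by (induction x rule: T_induct)
    (use assms in \<open>simp_all add: act_T_tens act_T_add act_T_closed l_distr tens_add_left TG.a_ac\<close>)

lemma act_T_one: "x \<in> carrier T \<Longrightarrow> act T \<one> x = x"
  by (induction x rule: T_induct) (simp_all add: act_T_tens act_T_add)

lemma T_vectorspace: "vectorspace cfield T"
proof (rule vectorspaceI[OF T_abelian_group])
qed (simp_all add: smult_T act_T_closed act_T_plus act_T_mult act_T_add const_add const_mult const_one act_T_one)

theorem T_mod: "alg_module n Q \<phi> (carrier Q) T"
  unfolding alg_module_def
proof (intro conjI ballI allI)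
  fix a assume a: "a \<in> carrier Q"
  have "act T a (c \<odot>\<^bsub>T\<^esub> x) = c \<odot>\<^bsub>T\<^esub> act T a x" if "x \<in> carrier T" for c x
    using a that act_T_mult[of a "const c" x] act_T_mult[of "const c" a x] const_central[OF a, of c]
    by (simp add: smult_T)
  then show "act T a \<in> module_hom cfield T T"
    using a by (auto simp: module_hom_iff act_T_closed act_T_add)
qed (simp_all add: T_vectorspace act_T_plus act_T_mult act_T_one smult_T)

end

section \<open>Whittaker vectors and the functor F\<close>

lemma fin_dim_surj:
  assumes M: "vectorspace cfield M" and N: "vectorspace cfield N" and f: "f \<in> module_hom cfield M N"
    and surj: "f ` carrier M = carrier N" and M_fin_dim: "vectorspace.fin_dim cfield M"
  shows "vectorspace.fin_dim cfield N"
proof -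
  interpret linear_map cfield M N f
    using M N f by (simp add: linear_map_def mod_hom_def mod_hom_axioms_def vectorspace_def)
  show ?thesis using rank_nullity_main(2)[OF M_fin_dim surj] .
qed

lemma vectorspace_restrict:
  fixes M :: "('x, 'm) rep"
  assumes M: "vectorspace cfield M" and S: "S \<subseteq> carrier M" "\<zero>\<^bsub>M\<^esub> \<in> S"
    and add: "\<And>v w. v \<in> S \<Longrightarrow> w \<in> S \<Longrightarrow> v \<oplus>\<^bsub>M\<^esub> w \<in> S" and smult: "\<And>c v. v \<in> S \<Longrightarrow> c \<odot>\<^bsub>M\<^esub> v \<in> S"
  shows "vectorspace cfield (M\<lparr>carrier := S\<rparr>)"
proof -
  interpret vectorspace cfield M by fact
  note sm = vectorspace_smult_simps[OF M]
  have neg: "\<ominus>\<^bsub>M\<^esub> v \<in> S" if "v \<in> S" for v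
    using smult[OF that, of "- 1"] sm(8)[of v 1] sm(5)[of v] that S by auto
  show ?thesis
  proof (rule vectorspaceI)
    show "abelian_group (M\<lparr>carrier := S\<rparr>)"
    proof (rule abelian_groupI)
      fix v assume "v \<in> carrier (M\<lparr>carrier := S\<rparr>)"
      then show "\<exists>w \<in> carrier (M\<lparr>carrier := S\<rparr>). w \<oplus>\<^bsub>M\<lparr>carrier := S\<rparr>\<^esub> v = \<zero>\<^bsub>M\<lparr>carrier := S\<rparr>\<^esub>"
        using neg S by (intro bexI[of _ "\<ominus>\<^bsub>M\<^esub> v"]) (auto simp: M.l_neg)
    qed (use S add in \<open>auto simp: M.a_ac subset_iff\<close>)
  qed (use S smult in \<open>auto simp: sm subset_iff\<close>)
qed

locale unipotent_module = localized n Q \<phi>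
  for n :: nat and Q :: "'q ring" (structure) and \<phi> :: "env \<Rightarrow> 'q" +
  fixes M :: "('q, 'm) rep"
  assumes Q_mod: "alg_module n Q \<phi> (carrier Q) M"
    and nilp: "i \<in> {1..n} \<Longrightarrow> v \<in> carrier M \<Longrightarrow>
      \<exists>k. ((\<lambda>w. act M (t i) w \<ominus>\<^bsub>M\<^esub> w) ^^ k) v = \<zero>\<^bsub>M\<^esub>"
begin

lemmas M_op = alg_moduleD(2)[OF Q_mod]
lemmas M_act = linear_op.closed[OF M_op] linear_op.add[OF M_op] linear_op.smult[OF M_op]
  linear_op.zero[OF M_op] alg_moduleD(3-6)[OF Q_mod]

lemma act_act: "a \<in> carrier Q \<Longrightarrow> b \<in> carrier Q \<Longrightarrow> v \<in> carrier M \<Longrightarrow> act M a (act M b v) = act M (a \<otimes> b) v"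
  by (simp add: M_act)

sublocale S: shift_ops M "{1..n}" "\<lambda>i. act M (t i)" "\<lambda>i. act M (h i)"
proof (rule shift_ops.intro[OF alg_moduleD(1)[OF Q_mod]], rule shift_ops_axioms.intro)
  fix i assume i: "i \<in> {1..n}"
  show "act M (t i) \<in> module_hom cfield M M" "act M (h i) \<in> module_hom cfield M M"
    using linear_op.hom[OF M_op] i by simp_all
  fix v assume v: "v \<in> carrier M"
  show "\<exists>k. ((\<lambda>w. act M (t i) w \<ominus>\<^bsub>M\<^esub> w) ^^ k) v = \<zero>\<^bsub>M\<^esub>" using nilp i v .
  show "act M (t i) (act M (h i) v) = act M (h i) (act M (t i) v) \<oplus>\<^bsub>M\<^esub> act M (t i) v"
    using i v h_t[of i i] by (simp add: act_act M_act(5)[symmetric])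
  fix j assume j: "j \<in> {1..n}"
  show "act M (t i) (act M (t j) v) = act M (t j) (act M (t i) v)"
    using i j v t_t[of i j] by (simp add: act_act)
  show "act M (h i) (act M (h j) v) = act M (h j) (act M (h i) v)"
    using i j v h_h[of i j] by (simp add: act_act)
  assume "i \<noteq> j"
  then show "act M (t i) (act M (h j) v) = act M (h j) (act M (t i) v)"
    using i j v h_t[of j i] by (simp add: act_act)
qed simp

definition whit :: "'m set" where
  "whit = {v \<in> carrier M. \<forall>i \<in> {1..n}. act M (t i) v = v}"

lemma whit_inv_on: "S.inv_on {1..n} = whit"
  by (simp add: S.inv_on_def whit_def)

lemma whit_C: "c \<in> C \<Longrightarrow> v \<in> whit \<Longrightarrow> act M c v \<in> whit"
proof -
  assume c: "c \<in> C" and v: "v \<in> whit"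
  have "act M (t i) (act M c v) = act M c v" if i: "i \<in> {1..n}" for i
  proof -
    have v': "v \<in> carrier M" "act M (t i) v = v" using v i unfolding whit_def by blast+
    have "act M (t i) (act M c v) = act M (c \<otimes> t i) v"
      using c i act_act[OF _ _ v'(1), of "t i" c] C_comm[OF c i] by simp
    also have "\<dots> = act M c (act M (t i) v)" using c i v' by (intro M_act) simp_all
    finally show ?thesis by (simp only: v'(2))
  qed
  then show ?thesis using c v by (simp add: whit_def M_act)
qed

lemma whit_zero: "\<zero>\<^bsub>M\<^esub> \<in> whit"
  and whit_add: "v \<in> whit \<Longrightarrow> w \<in> whit \<Longrightarrow> v \<oplus>\<^bsub>M\<^esub> w \<in> whit"
  by (auto simp: whit_def M_act)

lemma whit_smult: "v \<in> whit \<Longrightarrow> c \<odot>\<^bsub>M\<^esub> v \<in> whit"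
  using whit_C[OF C_ring(3), of v c] by (simp add: whit_def M_act)

lemma whit_vectorspace: "vectorspace cfield (M\<lparr>carrier := whit\<rparr>)"
  by (rule vectorspace_restrict[OF S.vectorspace_axioms])
    (use whit_zero whit_add whit_smult in \<open>auto simp: whit_def\<close>)

lemma whit_C_mod: "alg_module n Q \<phi> C (M\<lparr>carrier := whit\<rparr>)"
  unfolding alg_module_def
proof (intro conjI ballI allI)
  show "vectorspace cfield (M\<lparr>carrier := whit\<rparr>)" by (rule whit_vectorspace)
  fix a assume a: "a \<in> C"
  show "act (M\<lparr>carrier := whit\<rparr>) a \<in> module_hom cfield (M\<lparr>carrier := whit\<rparr>) (M\<lparr>carrier := whit\<rparr>)"
    using whit_C[OF a] C_closed[OF a] by (auto simp: module_hom_iff M_act whit_def)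
qed (auto simp: whit_def M_act)

end

context localized begin

text \<open>Commuting with \<open>W\<close> is enough if the \<open>t i\<close> act trivially on the source and on the image, for then their
  inverses do so as well, and these elements generate \<open>C\<close>.\<close>

lemma C_commute:
  assumes X: "alg_module n Q \<phi> C X" and Y: "alg_module n Q \<phi> C Y" and f: "f \<in> module_hom cfield X Y"
    and W: "\<And>w v. w \<in> W_alg n Q \<phi> \<Longrightarrow> v \<in> carrier X \<Longrightarrow> f (act X w v) = act Y w (f v)"
    and tX: "\<And>i v. i \<in> {1..n} \<Longrightarrow> v \<in> carrier X \<Longrightarrow> act X (t i) v = v"
    and tY: "\<And>i v. i \<in> {1..n} \<Longrightarrow> v \<in> carrier X \<Longrightarrow> act Y (t i) (f v) = f v"
    and c: "c \<in> C" and v: "v \<in> carrier X"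
  shows "f (act X c v) = act Y c (f v)"
proof -
  interpret f: linear_op X Y f
    using alg_moduleD(1)[OF X] alg_moduleD(1)[OF Y] f by (simp add: linear_op_def linear_op_axioms_def)
  note Xa = alg_moduleD[OF X] and Ya = alg_moduleD[OF Y]
  note Xc = linear_op.closed[OF Xa(2)] and Yc = linear_op.closed[OF Ya(2)]
  let ?K = "{c \<in> C. \<forall>v \<in> carrier X. f (act X c v) = act Y c (f v)}"
  have K: "generate_ring Q H \<subseteq> ?K" if H: "H \<subseteq> ?K" for H
  proof
    have minus: "\<ominus> c \<in> ?K" if c: "c \<in> ?K" for c
    proof -
      have m: "\<ominus> c = const (- 1) \<otimes> c" using c by (simp add: const_minus const_one l_minus)
      have "f (act X (const (- 1) \<otimes> c) v) = act Y (const (- 1) \<otimes> c) (f v)" if "v \<in> carrier X" for v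
        using c that by (simp add: Xa(4,6) Ya(4,6) C_ring Xc Yc f.smult)
      moreover have "\<ominus> c \<in> C" using c C_ring(6) by blast
      ultimately show ?thesis unfolding m by blast
    qed
    fix x assume "x \<in> generate_ring Q H"
    then show "x \<in> ?K"
    proof induction
      case one
      then show ?case by (simp add: C_ring Xa(5) Ya(5))
    next
      case (incl h)
      then show ?case using H by blast
    next
      case (a_inv h)
      then show ?case using minus by blast
    next
      case (eng_add h1 h2)
      then show ?case by (simp add: C_ring Xa(3) Ya(3) Xc f.add)
    next
      case (eng_mult h1 h2)
      then show ?case by (simp add: C_ring Xa(4) Ya(4) Xc)
    qed
  qed
  have inv_fix: "act N (inv (t i)) v = v"
    if N: "alg_module n Q \<phi> C N" and i: "i \<in> {1..n}" and v: "v \<in> carrier N" "act N (t i) v = v"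
    for N :: "('q, 'z) rep" and i v
  proof -
    have "act N (inv (t i)) v = act N (inv (t i) \<otimes> t i) v"
      using alg_moduleD(4)[OF N C_t(2)[OF i] C_t(1)[OF i] v(1)] v(2) by simp
    then show ?thesis using t_unit[OF i] alg_moduleD(5)[OF N v(1)] by simp
  qed
  have gens: "range const \<union> {gen (mat_unit n 0 i) | i. i \<in> {1..n}} \<union>
      {inv (gen (mat_unit n 0 i)) | i. i \<in> {1..n}} \<subseteq> ?K"
  proof -
    have "const d \<in> ?K" for d by (simp add: C_ring Xa(6) Ya(6) f.smult)
    moreover have "t i \<in> ?K" if "i \<in> {1..n}" for i using that tX tY C_t(1) by simp
    moreover have "inv (t i) \<in> ?K" if "i \<in> {1..n}" for i
      using that inv_fix[OF X] inv_fix[OF Y] tX tY C_t(2) by simp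
    ultimately show ?thesis unfolding t_def by blast
  qed
  have "Um_S n Q \<phi> \<subseteq> ?K" unfolding Um_S_def by (rule K[OF gens])
  moreover have "W_alg n Q \<phi> \<subseteq> ?K" using W W_C by blast
  ultimately have "Um_S_W n Q \<phi> \<subseteq> ?K" unfolding Um_S_W_def by (intro K) blast
  then show ?thesis using c v unfolding Um_S_W_eq by blast
qed

text \<open>A map that commutes with an invertible operator commutes with its inverse.\<close>

lemma Q_commute:
  assumes X: "alg_module n Q \<phi> (carrier Q) X" and Y: "alg_module n Q \<phi> (carrier Q) Y"
    and f: "f \<in> module_hom cfield X Y"
    and gen: "\<And>x v. x \<in> sl n \<Longrightarrow> v \<in> carrier X \<Longrightarrow> f (act X (gen x) v) = act Y (gen x) (f v)"
    and q: "q \<in> carrier Q" and v: "v \<in> carrier X"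
  shows "f (act X q v) = act Y q (f v)"
proof -
  interpret f: linear_op X Y f
    using alg_moduleD(1)[OF X] alg_moduleD(1)[OF Y] f by (simp add: linear_op_def linear_op_axioms_def)
  note Xa = alg_moduleD[OF X] and Ya = alg_moduleD[OF Y]
  note Xc = linear_op.closed[OF Xa(2)] and Yc = linear_op.closed[OF Ya(2)]
  have "\<forall>v \<in> carrier X. f (act X q v) = act Y q (f v)"
    using q
  proof (induction q rule: Q_induct)
    case (inv_t i)
    show ?case
    proof
      fix v assume v: "v \<in> carrier X"
      let ?w = "act X (inv (t i)) v"
      have w: "?w \<in> carrier X" using inv_t v by (simp add: Xc)
      have "v = act X (t i) ?w"
        using Xa(4)[of "t i" "inv (t i)" v] inv_t v t_unit[OF inv_t] by (simp add: Xa(5))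
      then have "f v = act Y (t i) (f ?w)"
        using gen[OF t_sl[OF inv_t] w] by (simp add: t_def)
      then have "act Y (inv (t i)) (f v) = act Y (inv (t i) \<otimes> t i) (f ?w)"
        using Ya(4)[of "inv (t i)" "t i" "f ?w"] inv_t w by simp
      then show "f ?w = act Y (inv (t i)) (f v)"
        using t_unit[OF inv_t] w by (simp add: Ya(5))
    qed
  qed (simp_all add: Xa(3,4,6) Ya(3,4,6) Xc f.add f.smult gen)
  then show ?thesis using v by blast
qed

lemma H1D:
  assumes "M \<in> H1 n"
  shows "sl_module n M"
    and "i \<in> {1..n} \<Longrightarrow> v \<in> carrier M \<Longrightarrow>
      \<exists>k. ((\<lambda>w. act M (mat_unit n 0 i) w \<ominus>\<^bsub>M\<^esub> w) ^^ k) v = \<zero>\<^bsub>M\<^esub>"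
    and "vectorspace.fin_dim cfield (M\<lparr>carrier := wh n M\<rparr>)"
  using assms by (auto simp: H1_def)

text \<open>A locally unipotent operator is bijective: it is injective on the kernel of every power of
  \<open>T - 1\<close>, and \<open>v = T (v - u)\<close> if \<open>T v - v = T u\<close>.\<close>

lemma H1_bij:
  assumes M: "M \<in> H1 n" and i: "i \<in> {1..n}"
  shows "bij_betw (act M (mat_unit n 0 i)) (carrier M) (carrier M)"
proof -
  let ?T = "act M (mat_unit n 0 i)" and ?D = "\<lambda>w. act M (mat_unit n 0 i) w \<ominus>\<^bsub>M\<^esub> w"
  interpret T: linear_op M M ?T using sl_moduleD(2)[OF H1D(1)[OF M] t_sl[OF i]] .
  have Dc: "?D v \<in> carrier M" if "v \<in> carrier M" for v using that by simp
  have inj: "v = \<zero>\<^bsub>M\<^esub>" if v: "v \<in> carrier M" "?T v = \<zero>\<^bsub>M\<^esub>" for v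
  proof -
    \<comment> \<open>On the kernel of \<open>T\<close> the operator \<open>T - 1\<close> is \<open>-1\<close>, which is nilpotent only on zero.\<close>
    have pow: "(?D ^^ k) v = v \<or> (?D ^^ k) v = \<ominus>\<^bsub>M\<^esub> v" for k
      by (induction k) (use v in \<open>auto simp: T.neg T.M.M.minus_eq\<close>)
    obtain k where "(?D ^^ k) v = \<zero>\<^bsub>M\<^esub>" using H1D(2)[OF M i v(1)] ..
    then have "v = \<zero>\<^bsub>M\<^esub> \<or> \<ominus>\<^bsub>M\<^esub> v = \<zero>\<^bsub>M\<^esub>" using pow[of k] by (auto dest: sym)
    then show ?thesis using T.M.M.r_neg[OF v(1)] T.M.M.r_zero[OF v(1)] by auto
  qed
  have surj: "v \<in> carrier M \<Longrightarrow> (?D ^^ k) v = \<zero>\<^bsub>M\<^esub> \<Longrightarrow> \<exists>u \<in> carrier M. ?T u = v" for k v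
  proof (induction k arbitrary: v)
    case 0
    then show ?case using T.zero by auto
  next
    case (Suc k)
    have "(?D ^^ k) (?D v) = \<zero>\<^bsub>M\<^esub>" using Suc.prems(2) by (simp only: funpow_Suc_right o_apply)
    then obtain u where u: "u \<in> carrier M" "?T u = ?D v" using Suc.IH[OF Dc[OF Suc.prems(1)]] by blast
    have "?T (v \<ominus>\<^bsub>M\<^esub> u) = ?T v \<ominus>\<^bsub>M\<^esub> (?T v \<ominus>\<^bsub>M\<^esub> v)" using u Suc.prems(1) by (simp add: T.diff)
    also have "\<dots> = v"
      using Suc.prems(1) by (simp add: T.M.M.minus_eq T.M.M.minus_add T.M.M.r_neg T.M.M.r_neg2 T.M.M.a_ac)
    finally show ?case using u Suc.prems(1) by (intro bexI[of _ "v \<ominus>\<^bsub>M\<^esub> u"]) auto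
  qed
  show ?thesis
    unfolding bij_betw_def
  proof
    show "inj_on ?T (carrier M)"
    proof (rule inj_onI)
      fix v w assume vw: "v \<in> carrier M" "w \<in> carrier M" "?T v = ?T w"
      then have "?T (v \<ominus>\<^bsub>M\<^esub> w) = \<zero>\<^bsub>M\<^esub>" by (simp add: T.diff)
      then have "v \<ominus>\<^bsub>M\<^esub> w = \<zero>\<^bsub>M\<^esub>" using inj vw by simp
      then show "v = w" using vw by simp
    qed
    show "?T ` carrier M = carrier M"
    proof
      show "carrier M \<subseteq> ?T ` carrier M" using surj H1D(2)[OF M i] by blast
    qed auto
  qed
qed

lemma loc_module_simps [simp]:
  "carrier (loc_module n Q \<phi> M) = carrier M" "add (loc_module n Q \<phi> M) = add M"
  "\<zero>\<^bsub>loc_module n Q \<phi> M\<^esub> = \<zero>\<^bsub>M\<^esub>" "smult (loc_module n Q \<phi> M) = smult M"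
  by (simp_all add: loc_module_def)

lemma loc_module:
  assumes M: "M \<in> H1 n"
  shows "alg_module n Q \<phi> (carrier Q) (loc_module n Q \<phi> M)"
    and "x \<in> sl n \<Longrightarrow> v \<in> carrier M \<Longrightarrow> act (loc_module n Q \<phi> M) (gen x) v = act M x v"
proof -
  interpret localized_rep n Q \<phi> M
    by unfold_locales (use H1D(1)[OF M] H1_bij[OF M] in auto)
  let ?P = "\<lambda>\<alpha>. alg_module n Q \<phi> (carrier Q) (with_act M \<alpha>) \<and>
     (\<forall>x \<in> sl n. \<forall>v \<in> carrier M. \<alpha> (q_gen n \<phi> x) v = act M x v)"
  have P: "?P (SOME \<alpha>. ?P \<alpha>)" by (rule someI_ex[OF ex_loc_action])
  then show "alg_module n Q \<phi> (carrier Q) (loc_module n Q \<phi> M)" by (simp add: loc_module_def)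
  show "x \<in> sl n \<Longrightarrow> v \<in> carrier M \<Longrightarrow> act (loc_module n Q \<phi> M) (gen x) v = act M x v"
    using P by (simp add: loc_module_def)
qed

lemma loc_minus: "a_minus (loc_module n Q \<phi> M) = a_minus M"
  by (rule a_minus_cong) simp_all

lemma loc_unipotent:
  assumes M: "M \<in> H1 n"
  shows "unipotent_module n Q \<phi> (loc_module n Q \<phi> M)"
proof unfold_locales
  show "alg_module n Q \<phi> (carrier Q) (loc_module n Q \<phi> M)" by (rule loc_module(1)[OF M])
  fix i v assume i: "i \<in> {1..n}" and v: "v \<in> carrier (loc_module n Q \<phi> M)"
  then have v: "v \<in> carrier M" by simp
  interpret T: linear_op M M "act M (mat_unit n 0 i)" using sl_moduleD(2)[OF H1D(1)[OF M] t_sl[OF i]] .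
  have "((\<lambda>w. act (loc_module n Q \<phi> M) (t i) w \<ominus>\<^bsub>M\<^esub> w) ^^ k) v =
      ((\<lambda>w. act M (mat_unit n 0 i) w \<ominus>\<^bsub>M\<^esub> w) ^^ k) v \<and>
      ((\<lambda>w. act M (mat_unit n 0 i) w \<ominus>\<^bsub>M\<^esub> w) ^^ k) v \<in> carrier M" for k
    by (induction k) (use v i loc_module(2)[OF M t_sl[OF i]] in \<open>auto simp: t_def\<close>)
  then show "\<exists>k. ((\<lambda>w. act (loc_module n Q \<phi> M) (t i) w \<ominus>\<^bsub>loc_module n Q \<phi> M\<^esub> w) ^^ k) v = \<zero>\<^bsub>loc_module n Q \<phi> M\<^esub>"
    using H1D(2)[OF M i v] by (simp add: loc_minus)
qed

lemma wh_whit: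
  assumes M: "M \<in> H1 n"
  shows "unipotent_module.whit n \<phi> (loc_module n Q \<phi> M) = wh n M"
  unfolding unipotent_module.whit_def[OF loc_unipotent[OF M]] wh_def
  using loc_module(2)[OF M t_sl] by (auto simp: t_def)

lemma F_obj_simps [simp]:
  "carrier (F_obj n Q \<phi> M) = wh n M" "add (F_obj n Q \<phi> M) = add M"
  "\<zero>\<^bsub>F_obj n Q \<phi> M\<^esub> = \<zero>\<^bsub>M\<^esub>" "smult (F_obj n Q \<phi> M) = smult M"
  "act (F_obj n Q \<phi> M) = act (loc_module n Q \<phi> M)"
  by (simp_all add: F_obj_def)

lemma wh_closed: "v \<in> wh n M \<Longrightarrow> v \<in> carrier M"
  by (simp add: wh_def)

lemma F_obj_C_mod:
  assumes M: "M \<in> H1 n"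
  shows "alg_module n Q \<phi> C (F_obj n Q \<phi> M)"
  using unipotent_module.whit_C_mod[OF loc_unipotent[OF M]] by (simp add: wh_whit[OF M] F_obj_def)

lemma F_obj_W_mod:
  assumes M: "M \<in> H1 n"
  shows "F_obj n Q \<phi> M \<in> W_mod n Q \<phi>"
proof -
  have C: "alg_module n Q \<phi> C (F_obj n Q \<phi> M)" by (rule F_obj_C_mod[OF M])
  note vs = alg_moduleD(1)[OF C]
  have "vectorspace cfield (M\<lparr>carrier := wh n M\<rparr>)"
    by (rule vectorspace_cong[OF _ _ _ _ vs]) simp_all
  moreover have "(\<lambda>v. v) \<in> module_hom cfield (M\<lparr>carrier := wh n M\<rparr>) (F_obj n Q \<phi> M)"
    by (simp add: module_hom_iff)
  ultimately have "vectorspace.fin_dim cfield (F_obj n Q \<phi> M)"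
    using fin_dim_surj[OF _ vs] H1D(3)[OF M] by fastforce
  then show ?thesis using alg_module_mono[OF C] W_C by (auto simp: W_mod_def)
qed

lemma rep_homD:
  assumes "f \<in> rep_hom X M N"
  shows "f \<in> module_hom cfield M N" "f \<in> extensional (carrier M)"
    "x \<in> X \<Longrightarrow> v \<in> carrier M \<Longrightarrow> f (act M x v) = act N x (f v)"
    "v \<in> carrier M \<Longrightarrow> f v \<in> carrier N"
  using assms by (auto simp: rep_hom_def module_hom_iff)

lemma hom_loc_module:
  assumes M: "M \<in> H1 n" and N: "N \<in> H1 n" and f: "f \<in> rep_hom (sl n) M N"
    and q: "q \<in> carrier Q" and v: "v \<in> carrier M"
  shows "f (act (loc_module n Q \<phi> M) q v) = act (loc_module n Q \<phi> N) q (f v)"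
proof (rule Q_commute[OF loc_module(1)[OF M] loc_module(1)[OF N] _ _ q])
  show "f \<in> module_hom cfield (loc_module n Q \<phi> M) (loc_module n Q \<phi> N)"
    using rep_homD(1)[OF f] by (simp add: module_hom_iff)
  fix x v assume "x \<in> sl n" "v \<in> carrier (loc_module n Q \<phi> M)"
  then show "f (act (loc_module n Q \<phi> M) (gen x) v) = act (loc_module n Q \<phi> N) (gen x) (f v)"
    using rep_homD[OF f] by (simp add: loc_module(2)[OF M] loc_module(2)[OF N])
qed (use v in simp)

lemma hom_wh: "f \<in> rep_hom (sl n) M N \<Longrightarrow> v \<in> wh n M \<Longrightarrow> f v \<in> wh n N"
  using rep_homD(3,4)[of f "sl n" M N] t_sl unfolding wh_def
  by (smt (verit) mem_Collect_eq)

lemma F_mor_hom: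
  assumes M: "M \<in> H1 n" and N: "N \<in> H1 n" and f: "f \<in> rep_hom (sl n) M N"
  shows "F_mor n M N f \<in> rep_hom (W_alg n Q \<phi>) (F_obj n Q \<phi> M) (F_obj n Q \<phi> N)"
proof -
  note W = alg_moduleD(2)[OF F_obj_C_mod[OF M]]
  have cl: "act (loc_module n Q \<phi> M) c v \<in> wh n M" if "c \<in> C" "v \<in> wh n M" for c v
    using linear_op.closed[OF W[OF that(1)], of v] that(2) by simp
  have add: "v \<oplus>\<^bsub>M\<^esub> w \<in> wh n M" "c \<odot>\<^bsub>M\<^esub> v \<in> wh n M" if "v \<in> wh n M" "w \<in> wh n M" for v w c
    using unipotent_module.whit_add[OF loc_unipotent[OF M]] unipotent_module.whit_smult[OF loc_unipotent[OF M]]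
      that by (simp_all add: wh_whit[OF M])
  show ?thesis
    unfolding rep_hom_def module_hom_iff F_mor_def
    using rep_homD(1)[OF f] hom_wh[OF f] add cl[OF W_C] hom_loc_module[OF M N f C_closed[OF W_C]]
    by (auto simp: module_hom_iff wh_closed)
qed

theorem F_functor:
  "is_functor (sl n) (H1 n :: (complex mat, 'm) rep set) (W_alg n Q \<phi>) (W_mod n Q \<phi>)
    (F_obj n Q \<phi>) (F_mor n)"
  unfolding is_functor_def
proof (intro conjI ballI)
  fix M :: "(complex mat, 'm) rep" assume "M \<in> H1 n"
  then show "F_obj n Q \<phi> M \<in> W_mod n Q \<phi>" by (rule F_obj_W_mod)
  show "F_mor n M M (\<lambda>v \<in> carrier M. v) = (\<lambda>v \<in> carrier (F_obj n Q \<phi> M). v)"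
    by (auto simp: F_mor_def fun_eq_iff wh_closed)
next
  fix L M N :: "(complex mat, 'm) rep" and f g
  assume f: "f \<in> rep_hom (sl n) L M"
  show "F_mor n L N (compose (carrier L) g f) =
      compose (carrier (F_obj n Q \<phi> L)) (F_mor n M N g) (F_mor n L M f)"
    using hom_wh[OF f] by (auto simp: F_mor_def fun_eq_iff compose_def wh_closed)
qed (rule F_mor_hom)

end

section \<open>The functor G\<close>

context localized begin

lemma triv_ext_simps [simp]:
  "carrier (triv_ext n Q \<phi> V) = carrier V" "add (triv_ext n Q \<phi> V) = add V"
  "\<zero>\<^bsub>triv_ext n Q \<phi> V\<^esub> = \<zero>\<^bsub>V\<^esub>" "smult (triv_ext n Q \<phi> V) = smult V"
  by (simp_all add: triv_ext_def)

text \<open>The augmentation provides the extension that \<open>triv_ext\<close> selects.\<close>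

lemma triv_ext:
  assumes V: "alg_module n Q \<phi> (W_alg n Q \<phi>) V"
  shows "alg_module n Q \<phi> C (triv_ext n Q \<phi> V)"
    and "w \<in> W_alg n Q \<phi> \<Longrightarrow> v \<in> carrier V \<Longrightarrow> act (triv_ext n Q \<phi> V) w v = act V w v"
    and "i \<in> {1..n} \<Longrightarrow> v \<in> carrier V \<Longrightarrow> act (triv_ext n Q \<phi> V) (t i) v = v"
proof -
  let ?P = "\<lambda>\<beta>. alg_module n Q \<phi> (Um_S_W n Q \<phi>) (with_act V \<beta>) \<and>
     (\<forall>w \<in> W_alg n Q \<phi>. \<forall>v \<in> carrier V. \<beta> w v = act V w v) \<and>
     (\<forall>i \<in> {1..n}. \<forall>v \<in> carrier V. \<beta> (q_gen n \<phi> (mat_unit n 0 i)) v = v)"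
  note Va = alg_moduleD[OF V]
  have "alg_module n Q \<phi> C (with_act V (\<lambda>c. act V (aug c)))"
    unfolding alg_module_def
  proof (intro conjI ballI allI)
    show "vectorspace cfield (with_act V (\<lambda>c. act V (aug c)))"
      by (rule vectorspace_cong[OF _ _ _ _ Va(1)]) simp_all
    fix a assume a: "a \<in> C"
    show "act (with_act V (\<lambda>c. act V (aug c))) a \<in>
        module_hom cfield (with_act V (\<lambda>c. act V (aug c))) (with_act V (\<lambda>c. act V (aug c)))"
      using linear_op.hom[OF Va(2)[OF aug_closed[OF a]]] by (simp add: module_hom_iff)
  qed (simp_all add: aug_add aug_mult aug_closed Va aug_W W_ring)
  then have "?P (\<lambda>c. act V (aug c))"
    using Va(5) by (simp add: Um_S_W_eq aug_W aug_t flip: t_def)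
  then have P: "?P (SOME \<beta>. ?P \<beta>)" by (rule someI[of ?P])
  then show "alg_module n Q \<phi> C (triv_ext n Q \<phi> V)"
    and "w \<in> W_alg n Q \<phi> \<Longrightarrow> v \<in> carrier V \<Longrightarrow> act (triv_ext n Q \<phi> V) w v = act V w v"
    and "i \<in> {1..n} \<Longrightarrow> v \<in> carrier V \<Longrightarrow> act (triv_ext n Q \<phi> V) (t i) v = v"
    by (simp_all add: triv_ext_def Um_S_W_eq t_def)
qed

end

locale whittaker_module = localized n Q \<phi>
  for n :: nat and Q :: "'q ring" (structure) and \<phi> :: "env \<Rightarrow> 'q" +
  fixes V :: "('q, 'v) rep"
  assumes V_W_mod: "V \<in> W_mod n Q \<phi>"
begin

lemma V_mod_W: "alg_module n Q \<phi> (W_alg n Q \<phi>) V" and V_fin_dim: "vectorspace.fin_dim cfield V"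
  using V_W_mod by (simp_all add: W_mod_def)

abbreviation "EV \<equiv> triv_ext n Q \<phi> V"

sublocale tensor_product n Q \<phi> EV
  by unfold_locales (rule triv_ext(1)[OF V_mod_W])

lemma G_obj_T: "G_obj n Q \<phi> V = with_act T (\<lambda>x. act T (gen x))"
  by (simp add: G_obj_def Let_def Um_S_W_eq)

text \<open>On the induced module the \<open>t i\<close> act through conjugation on the left factor, because
  \<open>t q \<otimes> v = (t q t\<^sup>-\<^sup>1) t \<otimes> v\<close> and \<open>t\<close> fixes \<open>v\<close>. So they inherit local unipotence from \<open>Q\<close>.\<close>

lemma tens_t:
  assumes "i \<in> {1..n}" "q \<in> carrier Q" "v \<in> carrier V"
  shows "act T (t i) (tens q v) = tens (conj i q) v"
proof -
  have "t i \<otimes> q = conj i q \<otimes> t i"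
    using conj_eq_iff[OF assms(1,2) conj_closed[OF assms(1,2)]] by simp
  then show ?thesis
    using assms tens_balanced[of "conj i q" "t i" v] C_t(1) triv_ext(3)[OF V_mod_W]
    by (simp add: act_T_tens)
qed

lemma T_nilp:
  assumes i: "i \<in> {1..n}" and x: "x \<in> carrier T"
  shows "\<exists>k. ((\<lambda>w. act T (t i) w \<ominus>\<^bsub>T\<^esub> w) ^^ k) x = \<zero>\<^bsub>T\<^esub>"
proof -
  let ?D = "\<lambda>w. act T (t i) w \<ominus>\<^bsub>T\<^esub> w"
  have cl: "(?D ^^ k) x \<in> carrier T" if "x \<in> carrier T" for x k
    by (induction k) (use that i in \<open>auto simp: act_T_closed\<close>)
  have add_pow: "(?D ^^ k) (x \<oplus>\<^bsub>T\<^esub> y) = (?D ^^ k) x \<oplus>\<^bsub>T\<^esub> (?D ^^ k) y" if "x \<in> carrier T" "y \<in> carrier T" for x y k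
    by (induction k)
      (use that i cl in \<open>simp_all add: act_T_add act_T_closed TG.minus_eq TG.minus_add TG.a_ac\<close>)
  have zero: "(?D ^^ k) \<zero>\<^bsub>T\<^esub> = \<zero>\<^bsub>T\<^esub>" for k
    using add_pow[of "\<zero>\<^bsub>T\<^esub>" "\<zero>\<^bsub>T\<^esub>" k] cl[of "\<zero>\<^bsub>T\<^esub>" k] by (simp add: TG.add.l_cancel_one')
  have mono: "(?D ^^ (k + l)) x = \<zero>\<^bsub>T\<^esub>" if "(?D ^^ k) x = \<zero>\<^bsub>T\<^esub>" for x k l
  proof -
    have "(?D ^^ (l + k)) x = (?D ^^ l) ((?D ^^ k) x)" by (simp only: funpow_add o_apply)
    then show ?thesis unfolding that zero by (simp only: add.commute)
  qed
  show ?thesis using x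
  proof (induction x rule: T_induct)
    case (tens q v)
    then have v: "v \<in> carrier V" by simp
    have D1: "?D (tens q v) = tens (conj_diff i q) v" if q: "q \<in> carrier Q" for q
    proof -
      have "tens q v \<oplus>\<^bsub>T\<^esub> tens (conj_diff i q) v = tens (conj i q) v"
        using q i v tens_add_left[of q "conj_diff i q" v] by (simp add: add_diff_cancel)
      then show ?thesis
        using q i v TG.add_diff_cancel(1)[of "tens q v" "tens (conj_diff i q) v"]
        by (simp add: tens_t tens_closed)
    qed
    have pow: "(?D ^^ k) (tens q v) = tens ((conj_diff i ^^ k) q) v" for k
      by (induction k) (use D1 conj_diff_pow_closed[OF i tens(1)] in auto)
    obtain k where "(conj_diff i ^^ k) q = \<zero>" using conj_diff_nilp[OF i tens(1)] ..
    then have "(?D ^^ k) (tens q v) = \<zero>\<^bsub>T\<^esub>" using pow[of k] tens_zero_left[OF tens(2)] by simp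
    then show ?case ..
  next
    case (add x y)
    then obtain k l where "(?D ^^ k) x = \<zero>\<^bsub>T\<^esub>" "(?D ^^ l) y = \<zero>\<^bsub>T\<^esub>" by blast
    then have "(?D ^^ (k + l)) x = \<zero>\<^bsub>T\<^esub>" "(?D ^^ (k + l)) y = \<zero>\<^bsub>T\<^esub>"
      using mono[of k x l] mono[of l y k] by (simp_all add: ac_simps)
    then have "(?D ^^ (k + l)) (x \<oplus>\<^bsub>T\<^esub> y) = \<zero>\<^bsub>T\<^esub>"
      using add_pow[OF add.hyps] by simp
    then show ?case ..
  qed
qed

sublocale U: unipotent_module n Q \<phi> T
  by unfold_locales (rule T_mod, rule T_nilp)

lemma tens_one_whit: "v \<in> carrier V \<Longrightarrow> tens \<one> v \<in> U.whit"
  using tens_t[of _ \<one> v] by (simp add: U.whit_def tens_closed conj_eq_iff)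
    (metis C_conj C_ring(4) atLeastAtMost_iff One_nat_def)

lemma tens_C: "c \<in> C \<Longrightarrow> v \<in> carrier V \<Longrightarrow> tens c v = tens \<one> (act EV c v)"
  using tens_balanced[of \<one> c v] by simp

text \<open>The constant term of \<open>Q\<close> induces a map on the tensor product that splits \<open>v \<mapsto> 1 \<otimes> v\<close>.\<close>

lemma ex_coinvariant:
  "\<exists>f. (\<forall>x \<in> carrier T. f x \<in> carrier V) \<and>
    (\<forall>x \<in> carrier T. \<forall>y \<in> carrier T. f (x \<oplus>\<^bsub>T\<^esub> y) = f x \<oplus>\<^bsub>V\<^esub> f y) \<and>
    (\<forall>q \<in> carrier Q. \<forall>v \<in> carrier V. f (tens q v) = act EV (const_term q) v)"
proof -
  have ct: "const_term q \<in> C" if "q \<in> carrier Q" for q using const_term_closed[OF that] .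
  obtain f where "\<And>x. x \<in> carrier T \<Longrightarrow> f x \<in> carrier EV"
    "\<And>x y. x \<in> carrier T \<Longrightarrow> y \<in> carrier T \<Longrightarrow> f (x \<oplus>\<^bsub>T\<^esub> y) = f x \<oplus>\<^bsub>EV\<^esub> f y"
    "\<And>q v. q \<in> carrier Q \<Longrightarrow> v \<in> carrier EV \<Longrightarrow> f (tens q v) = act EV (const_term q) v"
  proof (rule tensor_universal[of EV "\<lambda>q. act EV (const_term q)"])
    show "abelian_group EV" by (rule vectorspace_abelian_group[OF V.vectorspace_axioms])
  qed (use ct V_act in \<open>auto simp: const_term_add const_term_mult\<close>)
  then show ?thesis by (intro exI[of _ f]) auto
qed

definition coinv :: "('q \<times> 'v \<Rightarrow>\<^sub>0 int) set \<Rightarrow> 'v" where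
  "coinv = (SOME f. (\<forall>x \<in> carrier T. f x \<in> carrier V) \<and>
    (\<forall>x \<in> carrier T. \<forall>y \<in> carrier T. f (x \<oplus>\<^bsub>T\<^esub> y) = f x \<oplus>\<^bsub>V\<^esub> f y) \<and>
    (\<forall>q \<in> carrier Q. \<forall>v \<in> carrier V. f (tens q v) = act EV (const_term q) v))"

lemma coinv_closed: "x \<in> carrier T \<Longrightarrow> coinv x \<in> carrier V"
  and coinv_tens_C: "c \<in> C \<Longrightarrow> v \<in> carrier V \<Longrightarrow> coinv (tens c v) = act EV c v"
  using someI_ex[OF ex_coinvariant] unfolding coinv_def[symmetric] by (auto simp: const_term_C)

lemma coinv_tens_one: "v \<in> carrier V \<Longrightarrow> coinv (tens \<one> v) = v"
  using coinv_tens_C[of \<one> v] V_act(7) by (simp add: C_ring)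

lemma h_span_tens: "s \<in> QS.H_span {1..n} \<Longrightarrow> v \<in> carrier V \<Longrightarrow> tens s v \<in> U.S.H_span {1..n}"
proof (induction rule: QS.H_span.induct)
  case zero
  then show ?case using U.S.H_span.zero[of "{1..n}"] by (simp add: tens_zero_left)
next
  case (step i y s)
  have s: "s \<in> carrier Q" using QS.H_span_closed[OF step(3)] by simp
  have "tens (h i \<otimes> y \<oplus> s) v = act T (h i) (tens y v) \<oplus>\<^bsub>T\<^esub> tens s v"
    using step s by (simp add: tens_add_left act_T_tens)
  moreover have "act T (h i) (tens y v) \<oplus>\<^bsub>T\<^esub> tens s v \<in> U.S.H_span {1..n}"
    using step by (intro U.S.H_span.step) (auto simp: tens_closed)
  ultimately show ?case by simp
qed

lemma T_decompose:
  assumes "x \<in> carrier T"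
  shows "\<exists>v \<in> carrier V. \<exists>s \<in> U.S.H_span {1..n}. x = tens \<one> v \<oplus>\<^bsub>T\<^esub> s"
  using assms
proof (induction x rule: T_induct)
  case (tens q v)
  then have v: "v \<in> carrier V" by simp
  obtain s where s: "const_term q \<in> C" "s \<in> QS.H_span {1..n}" "q = const_term q \<oplus> s"
    using const_term[OF tens(1)] .
  have sc: "s \<in> carrier Q" using QS.H_span_closed[OF s(2)] by simp
  have "tens q v = tens (const_term q \<oplus> s) v" using s(3) by simp
  also have "\<dots> = tens \<one> (act EV (const_term q) v) \<oplus>\<^bsub>T\<^esub> tens s v"
    using s(1) sc v by (simp add: tens_add_left tens_C)
  finally show ?case
    using h_span_tens[OF s(2) v] V_act(1)[OF s(1)] v by auto
next
  case (add x y)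
  then obtain v w s r where *: "v \<in> carrier V" "w \<in> carrier V" "s \<in> U.S.H_span {1..n}"
    "r \<in> U.S.H_span {1..n}" "x = tens \<one> v \<oplus>\<^bsub>T\<^esub> s" "y = tens \<one> w \<oplus>\<^bsub>T\<^esub> r" by blast
  have cl: "s \<in> carrier T" "r \<in> carrier T" using * U.S.H_span_closed by blast+
  have "x \<oplus>\<^bsub>T\<^esub> y = tens \<one> (v \<oplus>\<^bsub>V\<^esub> w) \<oplus>\<^bsub>T\<^esub> (s \<oplus>\<^bsub>T\<^esub> r)"
    using * cl tens_add_right[of \<one> v w] by (simp add: tens_closed TG.a_ac)
  moreover have "s \<oplus>\<^bsub>T\<^esub> r \<in> U.S.H_span {1..n}" using * U.S.H_span_add by blast
  moreover have "v \<oplus>\<^bsub>V\<^esub> w \<in> carrier V" using V.M.a_closed[of v w] * by simp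
  ultimately show ?case by blast
qed

text \<open>By \<open>T_decompose\<close>, an invariant vector is some \<open>1 \<otimes> v\<close> up to an invariant vector in the span of the ranges
  of the \<open>h i\<close>, and there is no nonzero vector of the latter kind.\<close>

theorem whit_T: "U.whit = tens \<one> ` carrier V"
proof
  show "tens \<one> ` carrier V \<subseteq> U.whit" using tens_one_whit by blast
  show "U.whit \<subseteq> tens \<one> ` carrier V"
  proof
    fix x assume x: "x \<in> U.whit"
    then have xc: "x \<in> carrier T" by (simp add: U.whit_def)
    obtain v s where vs: "v \<in> carrier V" "s \<in> U.S.H_span {1..n}" "x = tens \<one> v \<oplus>\<^bsub>T\<^esub> s"
      using T_decompose[OF xc] by blast
    have cl: "s \<in> carrier T" "tens \<one> v \<in> carrier T" using vs U.S.H_span_closed tens_closed by auto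
    have "s = x \<ominus>\<^bsub>T\<^esub> tens \<one> v" using vs cl by (simp add: TG.add_diff_cancel)
    also have "\<dots> = x \<oplus>\<^bsub>T\<^esub> act T (const (- 1)) (tens \<one> v)"
      using cl vectorspace_smult_simps(5,8)[OF T_vectorspace, of "tens \<one> v"] vectorspace_smult_simps(8)[OF T_vectorspace, of "tens \<one> v" 1]
      by (simp add: TG.minus_eq smult_T)
    also have "\<dots> \<in> U.whit"
      using U.whit_add[OF x] U.whit_smult[OF tens_one_whit[OF vs(1)], of "- 1"] by (simp add: smult_T)
    \<comment> \<open>Being invariant and in the span of the ranges of the \<open>h i\<close>, the remainder vanishes.\<close>
    finally have "s = \<zero>\<^bsub>T\<^esub>" using U.S.inv_inter_H_span[of s] vs(2) U.whit_inv_on by simp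
    then show "x \<in> tens \<one> ` carrier V" using vs cl by simp
  qed
qed

lemma G_obj_simps [simp]:
  "carrier (G_obj n Q \<phi> V) = carrier T" "add (G_obj n Q \<phi> V) = add T" "\<zero>\<^bsub>G_obj n Q \<phi> V\<^esub> = \<zero>\<^bsub>T\<^esub>"
  "smult (G_obj n Q \<phi> V) = smult T" "act (G_obj n Q \<phi> V) x = act T (gen x)"
  by (simp_all add: G_obj_T)

lemma G_obj_minus [simp]: "a_minus (G_obj n Q \<phi> V) = a_minus T"
  by (rule a_minus_cong) simp_all

lemma wh_G_obj: "wh n (G_obj n Q \<phi> V) = U.whit"
  by (simp add: wh_def U.whit_def t_def)

theorem G_obj_H1: "G_obj n Q \<phi> V \<in> H1 n"
proof -
  note Ta = U.M_act
  have minus: "act T (gen (lie_bracket x y)) v = act T (gen x) (act T (gen y) v) \<ominus>\<^bsub>T\<^esub> act T (gen y) (act T (gen x) v)"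
    if x: "x \<in> sl n" and y: "y \<in> sl n" and v: "v \<in> carrier T" for x y v
  proof -
    have "act T (gen x) (act T (gen y) v) = act T (gen y) (act T (gen x) v) \<oplus>\<^bsub>T\<^esub> act T (gen (lie_bracket x y)) v"
      using gen_bracket[OF x y] x y v sl_bracket[OF x y]
      by (simp add: U.act_act act_T_plus a_comm flip: act_T_plus)
    then show ?thesis
      using x y v sl_bracket[OF x y]
        TG.add_diff_cancel(1)[of "act T (gen y) (act T (gen x) v)" "act T (gen (lie_bracket x y)) v"]
      by (simp add: act_T_closed)
  qed
  have vs: "vectorspace cfield (G_obj n Q \<phi> V)"
    by (rule vectorspace_cong[OF _ _ _ _ T_vectorspace]) simp_all
  have "sl_module n (G_obj n Q \<phi> V)"
    unfolding sl_module_def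
    using vs linear_op.hom[OF U.M_op] minus
    by (auto simp: module_hom_iff gen_add gen_smult act_T_plus act_T_mult act_T_closed smult_T)
  moreover have "\<exists>k. ((\<lambda>w. act (G_obj n Q \<phi> V) (mat_unit n 0 i) w \<ominus>\<^bsub>G_obj n Q \<phi> V\<^esub> w) ^^ k) v = \<zero>\<^bsub>G_obj n Q \<phi> V\<^esub>"
    if "i \<in> {1..n}" "v \<in> carrier (G_obj n Q \<phi> V)" for i v
    using T_nilp that by (simp add: t_def)
  moreover have "vectorspace.fin_dim cfield ((G_obj n Q \<phi> V)\<lparr>carrier := wh n (G_obj n Q \<phi> V)\<rparr>)"
  proof (rule fin_dim_surj[OF alg_moduleD(1)[OF V_mod_W] _ _ _ V_fin_dim])
    show "vectorspace cfield ((G_obj n Q \<phi> V)\<lparr>carrier := wh n (G_obj n Q \<phi> V)\<rparr>)"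
      by (rule vectorspace_cong[OF _ _ _ _ U.whit_vectorspace]) (simp_all add: wh_G_obj)
    have "tens \<one> (c \<odot>\<^bsub>V\<^esub> v) = c \<odot>\<^bsub>T\<^esub> tens \<one> v" if "v \<in> carrier V" for c v
      using that tens_C[OF C_ring(3), of v c] V_act(8)[of v c] by (simp add: smult_T act_T_tens)
    then show "tens \<one> \<in> module_hom cfield V ((G_obj n Q \<phi> V)\<lparr>carrier := wh n (G_obj n Q \<phi> V)\<rparr>)"
      using tens_one_whit tens_add_right[of \<one>] by (auto simp: module_hom_iff wh_G_obj)
    show "tens \<one> ` carrier V = carrier ((G_obj n Q \<phi> V)\<lparr>carrier := wh n (G_obj n Q \<phi> V)\<rparr>)"
      by (simp add: wh_G_obj whit_T)
  qed
  ultimately show ?thesis by (auto simp: H1_def)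
qed

end

lemma rep_homI:
  assumes "\<And>v. v \<in> carrier M \<Longrightarrow> f v \<in> carrier N"
    and "\<And>v w. v \<in> carrier M \<Longrightarrow> w \<in> carrier M \<Longrightarrow> f (v \<oplus>\<^bsub>M\<^esub> w) = f v \<oplus>\<^bsub>N\<^esub> f w"
    and "\<And>c v. v \<in> carrier M \<Longrightarrow> f (c \<odot>\<^bsub>M\<^esub> v) = c \<odot>\<^bsub>N\<^esub> f v"
    and "\<And>x v. x \<in> X \<Longrightarrow> v \<in> carrier M \<Longrightarrow> f (act M x v) = act N x (f v)"
    and "f \<in> extensional (carrier M)"
  shows "f \<in> rep_hom X M N"
  using assms by (auto simp: rep_hom_def module_hom_iff)

lemma rep_hom_compose:
  assumes f: "f \<in> rep_hom X L M" and g: "g \<in> rep_hom X M N"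
    and L: "vectorspace cfield L" "\<And>x v. x \<in> X \<Longrightarrow> v \<in> carrier L \<Longrightarrow> act L x v \<in> carrier L"
  shows "compose (carrier L) g f \<in> rep_hom X L N"
proof -
  interpret L: vectorspace cfield L by fact
  have f': "\<And>v. v \<in> carrier L \<Longrightarrow> f v \<in> carrier M"
    "\<And>v w. v \<in> carrier L \<Longrightarrow> w \<in> carrier L \<Longrightarrow> f (v \<oplus>\<^bsub>L\<^esub> w) = f v \<oplus>\<^bsub>M\<^esub> f w"
    "\<And>c v. v \<in> carrier L \<Longrightarrow> f (c \<odot>\<^bsub>L\<^esub> v) = c \<odot>\<^bsub>M\<^esub> f v"
    using f by (auto simp: rep_hom_def module_hom_iff)
  have g': "\<And>v. v \<in> carrier M \<Longrightarrow> g v \<in> carrier N"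
    "\<And>v w. v \<in> carrier M \<Longrightarrow> w \<in> carrier M \<Longrightarrow> g (v \<oplus>\<^bsub>M\<^esub> w) = g v \<oplus>\<^bsub>N\<^esub> g w"
    "\<And>c v. v \<in> carrier M \<Longrightarrow> g (c \<odot>\<^bsub>M\<^esub> v) = c \<odot>\<^bsub>N\<^esub> g v"
    using g by (auto simp: rep_hom_def module_hom_iff)
  have a: "f (act L x v) = act M x (f v)" "g (act M x (f v)) = act N x (g (f v))"
    if "x \<in> X" "v \<in> carrier L" for x v
    using f g f' that by (auto simp: rep_hom_def)
  show ?thesis
    by (rule rep_homI)
      (simp_all add: compose_def f' g' a L(2) vectorspace_smult_simps(1)[OF L(1)])
qed

context localized begin

lemma W_modD:
  assumes "V \<in> W_mod n Q \<phi>"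
  shows "vectorspace cfield V" "w \<in> W_alg n Q \<phi> \<Longrightarrow> v \<in> carrier V \<Longrightarrow> act V w v \<in> carrier V"
  using alg_moduleD(1)[of n Q \<phi> "W_alg n Q \<phi>" V] linear_op.closed[OF alg_moduleD(2)[of n Q \<phi> "W_alg n Q \<phi>" V]] assms
  by (auto simp: W_mod_def)

lemma H1_closed:
  assumes "M \<in> H1 n"
  shows "vectorspace cfield M" "x \<in> sl n \<Longrightarrow> v \<in> carrier M \<Longrightarrow> act M x v \<in> carrier M"
  using sl_moduleD(1)[OF H1D(1)[OF assms]] linear_op.closed[OF sl_moduleD(2)[OF H1D(1)[OF assms]]]
  by auto

lemma whittaker_moduleI: "V \<in> W_mod n Q \<phi> \<Longrightarrow> whittaker_module n Q \<phi> V"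
  by unfold_locales

end

locale whittaker_morphism = X: whittaker_module n Q \<phi> V + Y: whittaker_module n Q \<phi> V'
  for n :: nat and Q :: "'q ring" (structure) and \<phi> :: "env \<Rightarrow> 'q"
    and V :: "('q, 'v) rep" and V' :: "('q, 'w) rep" +
  fixes f :: "'v \<Rightarrow> 'w"
  assumes f_hom: "f \<in> rep_hom (W_alg n Q \<phi>) V V'"
begin

sublocale tensor_map n Q \<phi> "triv_ext n Q \<phi> V" "triv_ext n Q \<phi> V'" "\<lambda>q. q" f
proof unfold_locales
  note f = X.rep_homD[OF f_hom]
  show "v \<in> carrier X.EV \<Longrightarrow> f v \<in> carrier Y.EV" for v using f(4) by simp
  show "v \<in> carrier X.EV \<Longrightarrow> w \<in> carrier X.EV \<Longrightarrow> f (v \<oplus>\<^bsub>X.EV\<^esub> w) = f v \<oplus>\<^bsub>Y.EV\<^esub> f w" for v w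
    using f(1) by (simp add: module_hom_iff)
  have hom: "f \<in> module_hom cfield X.EV Y.EV" using f(1) by (simp add: module_hom_iff)
  fix c v assume c: "c \<in> X.C" and v: "v \<in> carrier X.EV"
  show "f (act X.EV c v) = act Y.EV c (f v)"
  proof (rule X.C_commute[OF X.V_mod Y.V_mod hom _ _ _ c v])
    fix w v assume w: "w \<in> W_alg n Q \<phi>" and v: "v \<in> carrier X.EV"
    then show "f (act X.EV w v) = act Y.EV w (f v)"
      using X.triv_ext(2)[OF X.V_mod_W w, of v] X.triv_ext(2)[OF Y.V_mod_W w, of "f v"] f(3)[OF w] f(4) by simp
  next
    fix i v assume "i \<in> {1..n}" "v \<in> carrier X.EV"
    then show "act X.EV (X.t i) v = v" "act Y.EV (X.t i) (f v) = f v"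
      using X.triv_ext(3)[OF X.V_mod_W] X.triv_ext(3)[OF Y.V_mod_W] f(4) by simp_all
  qed
qed simp_all

lemma G_mor_induced: "G_mor n Q \<phi> V V' f = restrict induced (carrier X.T)"
  by (rule ext) (simp add: G_mor_def induced_def X.Um_S_W_eq)

lemma induced_act: "a \<in> carrier Q \<Longrightarrow> x \<in> carrier X.T \<Longrightarrow> induced (act X.T a x) = act Y.T a (induced x)"
proof (rule X.additive_ext[of "\<lambda>x. induced (act X.T a x)" Y.T "\<lambda>x. act Y.T a (induced x)"])
  fix q v assume "a \<in> carrier Q" "q \<in> carrier Q" "v \<in> carrier X.EV"
  then show "induced (act X.T a (X.tens q v)) = act Y.T a (induced (X.tens q v))"
    using induced_tens[of q v] induced_tens[of "a \<otimes> q" v] f_closed[of v] by (simp add: X.act_T_tens Y.act_T_tens)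
qed (simp_all add: induced_closed induced_add X.act_T_closed X.act_T_add Y.act_T_add Y.act_T_closed)

lemma G_mor_hom: "G_mor n Q \<phi> V V' f \<in> rep_hom (sl n) (G_obj n Q \<phi> V) (G_obj n Q \<phi> V')"
  unfolding G_mor_induced
  by (rule rep_homI)
    (simp_all add: induced_closed induced_add induced_act X.act_T_closed X.smult_T Y.smult_T)

lemma G_mor_tens: "q \<in> carrier Q \<Longrightarrow> v \<in> carrier V \<Longrightarrow> G_mor n Q \<phi> V V' f (X.tens q v) = Y.tens q (f v)"
  unfolding G_mor_induced using induced_tens[of q v] X.tens_closed[of q v] by simp

lemma G_mor_closed: "x \<in> carrier X.T \<Longrightarrow> G_mor n Q \<phi> V V' f x \<in> carrier Y.T"
  and G_mor_add: "x \<in> carrier X.T \<Longrightarrow> y \<in> carrier X.T \<Longrightarrow>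
    G_mor n Q \<phi> V V' f (x \<oplus>\<^bsub>X.T\<^esub> y) = G_mor n Q \<phi> V V' f x \<oplus>\<^bsub>Y.T\<^esub> G_mor n Q \<phi> V V' f y"
  unfolding G_mor_induced by (simp_all add: induced_closed induced_add)

end

context localized begin

lemma whittaker_morphismI:
  "V \<in> W_mod n Q \<phi> \<Longrightarrow> V' \<in> W_mod n Q \<phi> \<Longrightarrow> f \<in> rep_hom (W_alg n Q \<phi>) V V' \<Longrightarrow>
    whittaker_morphism n Q \<phi> V V' f"
  by unfold_locales

lemma id_hom:
  assumes "vectorspace cfield M" "\<And>x v. x \<in> X \<Longrightarrow> v \<in> carrier M \<Longrightarrow> act M x v \<in> carrier M"
  shows "(\<lambda>v \<in> carrier M. v) \<in> rep_hom X M M"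
proof -
  interpret vectorspace cfield M by fact
  show ?thesis by (rule rep_homI) (simp_all add: assms(2) vectorspace_smult_simps(1)[OF assms(1)])
qed

lemma G_mor_id:
  assumes V: "V \<in> W_mod n Q \<phi>"
  shows "G_mor n Q \<phi> V V (\<lambda>v \<in> carrier V. v) = (\<lambda>x \<in> carrier (G_obj n Q \<phi> V). x)"
proof -
  interpret whittaker_morphism n Q \<phi> V V "\<lambda>v \<in> carrier V. v"
    by (rule whittaker_morphismI[OF V V id_hom[OF W_modD[OF V]]])
  have "G_mor n Q \<phi> V V (\<lambda>v \<in> carrier V. v) x = x" if "x \<in> carrier X.T" for x
    using X.additive_ext[of "G_mor n Q \<phi> V V (\<lambda>v \<in> carrier V. v)" X.T "\<lambda>x. x", OF _ _ _ _ that]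
    by (simp add: G_mor_closed G_mor_add G_mor_tens)
  then show ?thesis by (auto simp: fun_eq_iff G_mor_induced)
qed

lemma G_mor_compose:
  assumes L: "L \<in> W_mod n Q \<phi>" and M: "M \<in> W_mod n Q \<phi>" and N: "N \<in> W_mod n Q \<phi>"
    and f: "f \<in> rep_hom (W_alg n Q \<phi>) L M" and g: "g \<in> rep_hom (W_alg n Q \<phi>) M N"
  shows "G_mor n Q \<phi> L N (compose (carrier L) g f) =
    compose (carrier (G_obj n Q \<phi> L)) (G_mor n Q \<phi> M N g) (G_mor n Q \<phi> L M f)"
proof -
  interpret f: whittaker_morphism n Q \<phi> L M f by (rule whittaker_morphismI[OF L M f])
  interpret g: whittaker_morphism n Q \<phi> M N g by (rule whittaker_morphismI[OF M N g])
  interpret gf: whittaker_morphism n Q \<phi> L N "compose (carrier L) g f"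
    by (rule whittaker_morphismI[OF L N rep_hom_compose[OF f g W_modD[OF L]]])
  have "G_mor n Q \<phi> L N (compose (carrier L) g f) x = G_mor n Q \<phi> M N g (G_mor n Q \<phi> L M f x)"
    if "x \<in> carrier f.X.T" for x
  proof (rule f.X.additive_ext[OF _ _ _ _ that])
    fix q v assume q: "q \<in> carrier Q" and "v \<in> carrier f.X.EV"
    then have v: "v \<in> carrier L" "f v \<in> carrier M" using f.f_closed[of v] by simp_all
    then show "G_mor n Q \<phi> L N (compose (carrier L) g f) (f.X.tens q v) =
        G_mor n Q \<phi> M N g (G_mor n Q \<phi> L M f (f.X.tens q v))"
      unfolding gf.G_mor_tens[OF q v(1)] f.G_mor_tens[OF q v(1)] g.G_mor_tens[OF q v(2)]
      by (simp add: compose_def)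
  qed (simp_all add: f.G_mor_closed f.G_mor_add g.G_mor_add gf.G_mor_closed gf.G_mor_add)
  moreover have "G_mor n Q \<phi> L N (compose (carrier L) g f) x = undefined" if "x \<notin> carrier f.X.T" for x
    unfolding gf.G_mor_induced using that by simp
  ultimately show ?thesis by (intro ext) (simp add: compose_def)
qed

theorem G_functor:
  "is_functor (W_alg n Q \<phi>) (W_mod n Q \<phi> :: ('q, 'v) rep set) (sl n) (H1 n) (G_obj n Q \<phi>) (G_mor n Q \<phi>)"
  unfolding is_functor_def
  using whittaker_module.G_obj_H1[OF whittaker_moduleI] whittaker_morphism.G_mor_hom[OF whittaker_morphismI]
    G_mor_id G_mor_compose by blast

end

section \<open>The two natural isomorphisms\<close>

context whittaker_module begin

lemma F_G_act:
  assumes "q \<in> carrier Q" "x \<in> carrier T"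
  shows "act (loc_module n Q \<phi> (G_obj n Q \<phi> V)) q x = act T q x"
proof -
  have "(\<lambda>x. x) (act T q x) = act (loc_module n Q \<phi> (G_obj n Q \<phi> V)) q ((\<lambda>x. x) x)"
  proof (rule Q_commute[OF T_mod loc_module(1)[OF G_obj_H1] _ _ assms])
    show "(\<lambda>x. x) \<in> module_hom cfield T (loc_module n Q \<phi> (G_obj n Q \<phi> V))"
      by (simp add: module_hom_iff)
  qed (simp add: loc_module(2)[OF G_obj_H1])
  then show ?thesis by simp
qed

definition unit_iso :: "('q \<times> 'v \<Rightarrow>\<^sub>0 int) set \<Rightarrow> 'v" where
  "unit_iso = restrict coinv (wh n (G_obj n Q \<phi> V))"

lemma unit_iso_tens: "v \<in> carrier V \<Longrightarrow> unit_iso (tens \<one> v) = v"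
  using tens_one_whit[of v] by (simp add: unit_iso_def wh_G_obj coinv_tens_one)

lemma wh_G_E:
  assumes "x \<in> wh n (G_obj n Q \<phi> V)"
  obtains v where "v \<in> carrier V" "x = tens \<one> v"
  using assms by (auto simp: wh_G_obj whit_T)

lemma tens_one_add: "v \<in> carrier V \<Longrightarrow> w \<in> carrier V \<Longrightarrow> tens \<one> v \<oplus>\<^bsub>T\<^esub> tens \<one> w = tens \<one> (v \<oplus>\<^bsub>V\<^esub> w)"
  using tens_add_right[of \<one> v w] by simp

lemma tens_one_smult: "v \<in> carrier V \<Longrightarrow> c \<odot>\<^bsub>T\<^esub> tens \<one> v = tens \<one> (c \<odot>\<^bsub>V\<^esub> v)"
  using tens_C[OF C_ring(3), of v c] V_act(8)[of v c] by (simp add: smult_T act_T_tens)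

lemma tens_one_W: "w \<in> W_alg n Q \<phi> \<Longrightarrow> v \<in> carrier V \<Longrightarrow> act T w (tens \<one> v) = tens \<one> (act V w v)"
  using tens_C[OF W_C, of w v] triv_ext(2)[OF V_mod_W, of w v] C_closed[OF W_C, of w] by (simp add: act_T_tens)

lemma unit_iso: "unit_iso \<in> rep_iso (W_alg n Q \<phi>) (F_obj n Q \<phi> (G_obj n Q \<phi> V)) V"
proof -
  note vs = W_modD[OF V_W_mod]
  interpret V0: vectorspace cfield V by (rule vs)
  note sm = vectorspace_smult_simps(1)[OF vs(1)]
  have "unit_iso \<in> rep_hom (W_alg n Q \<phi>) (F_obj n Q \<phi> (G_obj n Q \<phi> V)) V"
  proof (rule rep_homI)
    fix v assume "v \<in> carrier (F_obj n Q \<phi> (G_obj n Q \<phi> V))"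
    then obtain a where a: "a \<in> carrier V" "v = tens \<one> a" using wh_G_E by auto
    show "unit_iso v \<in> carrier V" using a by (simp add: unit_iso_tens)
    show "unit_iso (c \<odot>\<^bsub>F_obj n Q \<phi> (G_obj n Q \<phi> V)\<^esub> v) = c \<odot>\<^bsub>V\<^esub> unit_iso v" for c
      using a sm by (simp add: unit_iso_tens tens_one_smult)
    show "unit_iso (act (F_obj n Q \<phi> (G_obj n Q \<phi> V)) w v) = act V w (unit_iso v)" if w: "w \<in> W_alg n Q \<phi>" for w
      using a vs(2)[OF w a(1)] w C_closed[OF W_C[OF w]] by (simp add: F_G_act tens_closed tens_one_W unit_iso_tens)
    fix w assume "w \<in> carrier (F_obj n Q \<phi> (G_obj n Q \<phi> V))"
    then obtain b where b: "b \<in> carrier V" "w = tens \<one> b" using wh_G_E by auto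
    show "unit_iso (v \<oplus>\<^bsub>F_obj n Q \<phi> (G_obj n Q \<phi> V)\<^esub> w) = unit_iso v \<oplus>\<^bsub>V\<^esub> unit_iso w"
      using a b by (simp add: tens_one_add unit_iso_tens)
  qed (simp add: unit_iso_def)
  moreover have "bij_betw unit_iso (wh n (G_obj n Q \<phi> V)) (carrier V)"
    by (rule bij_betw_byWitness[where f' = "tens \<one>"])
      (auto simp: unit_iso_tens wh_G_obj tens_one_whit elim!: wh_G_E[unfolded wh_G_obj])
  ultimately show ?thesis by (simp add: rep_iso_def)
qed

end

locale counit = localized n Q \<phi>
  for n :: nat and Q :: "'q ring" (structure) and \<phi> :: "env \<Rightarrow> 'q" +
  fixes M :: "(complex mat, 'm) rep"
  assumes M_H1: "M \<in> H1 n"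
begin

abbreviation "LM \<equiv> loc_module n Q \<phi> M"

sublocale whittaker_module n Q \<phi> "F_obj n Q \<phi> M"
  by (rule whittaker_moduleI[OF F_obj_W_mod[OF M_H1]])

sublocale L: unipotent_module n Q \<phi> LM
  by (rule loc_unipotent[OF M_H1])

text \<open>On the Whittaker vectors the algebra \<open>C\<close> acts in two ways, through the trivial extension and through the
  localization. They agree by \<open>C_commute\<close>, which makes \<open>q \<otimes> v \<mapsto> q v\<close> balanced.\<close>

lemma EV_act:
  assumes c: "c \<in> C" and v: "v \<in> wh n M"
  shows "act EV c v = act LM c v"
proof -
  have "(\<lambda>v. v) (act EV c v) = act LM c ((\<lambda>v. v) v)"
  proof (rule C_commute[OF V_mod _ _ _ _ _ c])
    show "alg_module n Q \<phi> C LM" by (rule alg_module_mono[OF L.Q_mod]) auto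
    show "(\<lambda>v. v) \<in> module_hom cfield EV LM" by (auto simp: module_hom_iff wh_closed)
    show "act EV w v = act LM w v" if "w \<in> W_alg n Q \<phi>" "v \<in> carrier EV" for w v
      using triv_ext(2)[OF V_mod_W that(1)] that by simp
    show "act EV (t i) v = v" if "i \<in> {1..n}" "v \<in> carrier EV" for i v
      using triv_ext(3)[OF V_mod_W that(1)] that by simp
    show "act LM (t i) v = v" if "i \<in> {1..n}" "v \<in> carrier EV" for i v
      using that loc_module(2)[OF M_H1 t_sl[OF that(1)]] by (simp add: wh_def t_def)
  qed (use v in simp)
  then show ?thesis by simp
qed

lemma ex_counit:
  "\<exists>f. (\<forall>x \<in> carrier T. f x \<in> carrier M) \<and>
    (\<forall>x \<in> carrier T. \<forall>y \<in> carrier T. f (x \<oplus>\<^bsub>T\<^esub> y) = f x \<oplus>\<^bsub>M\<^esub> f y) \<and>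
    (\<forall>q \<in> carrier Q. \<forall>v \<in> wh n M. f (tens q v) = act LM q v)"
proof -
  obtain f where "\<And>x. x \<in> carrier T \<Longrightarrow> f x \<in> carrier LM"
    "\<And>x y. x \<in> carrier T \<Longrightarrow> y \<in> carrier T \<Longrightarrow> f (x \<oplus>\<^bsub>T\<^esub> y) = f x \<oplus>\<^bsub>LM\<^esub> f y"
    "\<And>q v. q \<in> carrier Q \<Longrightarrow> v \<in> carrier EV \<Longrightarrow> f (tens q v) = act LM q v"
  proof (rule tensor_universal[of LM "act LM"])
    show "abelian_group LM" by (rule vectorspace_abelian_group[OF L.S.vectorspace_axioms])
    fix a c v assume "a \<in> carrier Q" "c \<in> C" "v \<in> carrier EV"
    then show "act LM (a \<otimes> c) v = act LM a (act EV c v)"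
      by (simp add: EV_act L.M_act wh_closed)
  qed (use L.M_act in \<open>auto simp: wh_closed\<close>)
  then show ?thesis by (intro exI[of _ f]) auto
qed

definition eps0 :: "('q \<times> 'm \<Rightarrow>\<^sub>0 int) set \<Rightarrow> 'm" where
  "eps0 = (SOME f. (\<forall>x \<in> carrier T. f x \<in> carrier M) \<and>
    (\<forall>x \<in> carrier T. \<forall>y \<in> carrier T. f (x \<oplus>\<^bsub>T\<^esub> y) = f x \<oplus>\<^bsub>M\<^esub> f y) \<and>
    (\<forall>q \<in> carrier Q. \<forall>v \<in> wh n M. f (tens q v) = act LM q v))"

definition eps :: "('q \<times> 'm \<Rightarrow>\<^sub>0 int) set \<Rightarrow> 'm" where
  "eps = restrict eps0 (carrier T)"

lemma eps_closed: "x \<in> carrier T \<Longrightarrow> eps x \<in> carrier M"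
  and eps_add: "x \<in> carrier T \<Longrightarrow> y \<in> carrier T \<Longrightarrow> eps (x \<oplus>\<^bsub>T\<^esub> y) = eps x \<oplus>\<^bsub>M\<^esub> eps y"
  and eps_tens: "q \<in> carrier Q \<Longrightarrow> v \<in> wh n M \<Longrightarrow> eps (tens q v) = act LM q v"
  using someI_ex[OF ex_counit] tens_closed unfolding eps0_def[symmetric] by (auto simp: eps_def)

lemma eps_act: "a \<in> carrier Q \<Longrightarrow> x \<in> carrier T \<Longrightarrow> eps (act T a x) = act LM a (eps x)"
proof (rule additive_ext[of "\<lambda>x. eps (act T a x)" M "\<lambda>x. act LM a (eps x)"])
  fix q v assume "a \<in> carrier Q" "q \<in> carrier Q" "v \<in> carrier EV"
  then show "eps (act T a (tens q v)) = act LM a (eps (tens q v))"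
    by (simp add: act_T_tens eps_tens L.M_act wh_closed)
next
  fix x y assume "a \<in> carrier Q" "x \<in> carrier T" "y \<in> carrier T"
  then show "act LM a (eps (x \<oplus>\<^bsub>T\<^esub> y)) = act LM a (eps x) \<oplus>\<^bsub>M\<^esub> act LM a (eps y)"
    using L.M_act(2)[of a "eps x" "eps y"] by (simp add: eps_add eps_closed)
qed (simp_all add: eps_closed eps_add act_T_closed act_T_add)

lemma eps_smult: "x \<in> carrier T \<Longrightarrow> eps (c \<odot>\<^bsub>T\<^esub> x) = c \<odot>\<^bsub>M\<^esub> eps x"
  using L.M_act(8)[of "eps x" c] by (simp add: smult_T eps_act eps_closed)

text \<open>Surjectivity holds because a module in \<open>H1 n\<close> is generated by its Whittaker vectors.\<close>

lemma eps_surj: "eps ` carrier T = carrier M"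
proof
  show "eps ` carrier T \<subseteq> carrier M" using eps_closed by blast
  have "carrier LM \<subseteq> eps ` carrier T"
  proof (rule L.S.inv_generates)
    show "L.S.inv_on {1..n} \<subseteq> eps ` carrier T"
    proof
      fix v assume "v \<in> L.S.inv_on {1..n}"
      then have v: "v \<in> wh n M" using wh_whit[OF M_H1] L.whit_inv_on by simp
      then have "eps (tens \<one> v) = v" using L.M_act(7)[of v] by (simp add: eps_tens wh_closed)
      then show "v \<in> eps ` carrier T" using tens_closed[of \<one> v] v by (metis F_obj_simps(1) imageI one_closed triv_ext_simps(1))
    qed
    show "eps ` carrier T \<subseteq> carrier LM" using eps_closed by auto
  next
    fix v w assume "v \<in> eps ` carrier T" "w \<in> eps ` carrier T"
    then obtain x y where xy: "x \<in> carrier T" "y \<in> carrier T" "v = eps x" "w = eps y" by blast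
    then have "v \<oplus>\<^bsub>LM\<^esub> w = eps (x \<oplus>\<^bsub>T\<^esub> y)" by (simp add: eps_add)
    then show "v \<oplus>\<^bsub>LM\<^esub> w \<in> eps ` carrier T" using xy TG.a_closed by blast
  next
    fix c v assume "v \<in> eps ` carrier T"
    then obtain x where x: "x \<in> carrier T" "v = eps x" by blast
    then have "c \<odot>\<^bsub>LM\<^esub> v = eps (c \<odot>\<^bsub>T\<^esub> x)" by (simp add: eps_smult)
    then show "c \<odot>\<^bsub>LM\<^esub> v \<in> eps ` carrier T" using x act_T_closed[OF const_closed] smult_T by simp
  next
    fix i v assume i: "i \<in> {1..n}" and "v \<in> eps ` carrier T"
    then obtain x where x: "x \<in> carrier T" "v = eps x" by blast
    then have "act LM (h i) v = eps (act T (h i) x)" using i by (simp add: eps_act)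
    then show "act LM (h i) v \<in> eps ` carrier T" using x i act_T_closed by simp
  qed
  then show "carrier M \<subseteq> eps ` carrier T" by simp
qed

text \<open>The kernel contains no Whittaker vector except zero, because the Whittaker vectors of the induced
  module are the \<open>1 \<otimes> v\<close>.\<close>

lemma eps_ker: "x \<in> carrier T \<Longrightarrow> eps x = \<zero>\<^bsub>M\<^esub> \<Longrightarrow> x = \<zero>\<^bsub>T\<^esub>"
proof -
  let ?K = "{x \<in> carrier T. eps x = \<zero>\<^bsub>M\<^esub>}"
  interpret M: vectorspace cfield M by (rule H1_closed(1)[OF M_H1])
  have diff: "eps (x \<ominus>\<^bsub>T\<^esub> y) = \<zero>\<^bsub>M\<^esub>" if "x \<in> ?K" "y \<in> ?K" for x y
  proof -
    have xy: "x \<in> carrier T" "y \<in> carrier T" "eps x = \<zero>\<^bsub>M\<^esub>" "eps y = \<zero>\<^bsub>M\<^esub>" using that by auto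
    have "eps ((x \<ominus>\<^bsub>T\<^esub> y) \<oplus>\<^bsub>T\<^esub> y) = eps (x \<ominus>\<^bsub>T\<^esub> y) \<oplus>\<^bsub>M\<^esub> eps y" using xy by (intro eps_add) auto
    then show ?thesis using xy eps_closed[of "x \<ominus>\<^bsub>T\<^esub> y"] TG.add_diff_cancel(2)[of x y] by simp
  qed
  have "?K \<subseteq> {\<zero>\<^bsub>T\<^esub>}"
  proof (rule U.S.inv_meets)
    fix i x assume i: "i \<in> {1..n}" and x: "x \<in> ?K"
    then have "act T (t i) x \<in> ?K"
      using L.M_act(4)[of "t i"] by (simp add: act_T_closed eps_act)
    from diff[OF this x] show "act T (t i) x \<ominus>\<^bsub>T\<^esub> x \<in> ?K"
      using x i act_T_closed[OF t_closed(1)[OF i]] by simp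
  next
    show "?K \<inter> U.S.inv_on {1..n} \<subseteq> {\<zero>\<^bsub>T\<^esub>}"
    proof
      fix x assume x: "x \<in> ?K \<inter> U.S.inv_on {1..n}"
      then obtain v where v: "v \<in> wh n M" "x = tens \<one> v" using U.whit_inv_on whit_T by auto
      then have "v = \<zero>\<^bsub>M\<^esub>" using x L.M_act(7)[of v] by (simp add: eps_tens wh_closed)
      then show "x \<in> {\<zero>\<^bsub>T\<^esub>}" using v tens_zero_right[of \<one>] by simp
    qed
  qed auto
  then show "x \<in> carrier T \<Longrightarrow> eps x = \<zero>\<^bsub>M\<^esub> \<Longrightarrow> x = \<zero>\<^bsub>T\<^esub>" by blast
qed

lemma eps_iso: "eps \<in> rep_iso (sl n) (G_obj n Q \<phi> (F_obj n Q \<phi> M)) M"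
proof -
  interpret M: vectorspace cfield M by (rule H1_closed(1)[OF M_H1])
  have "eps \<in> rep_hom (sl n) (G_obj n Q \<phi> (F_obj n Q \<phi> M)) M"
    by (rule rep_homI)
      (simp_all add: eps_closed eps_add eps_smult eps_act loc_module(2)[OF M_H1], simp add: eps_def)
  moreover have "inj_on eps (carrier T)"
  proof (rule inj_onI)
    fix x y assume xy: "x \<in> carrier T" "y \<in> carrier T" "eps x = eps y"
    have "eps (x \<ominus>\<^bsub>T\<^esub> y) \<oplus>\<^bsub>M\<^esub> eps y = eps x"
      using eps_add[of "x \<ominus>\<^bsub>T\<^esub> y" y] xy TG.add_diff_cancel(2)[of x y] by simp
    then have "eps (x \<ominus>\<^bsub>T\<^esub> y) = \<zero>\<^bsub>M\<^esub>"
      using xy eps_closed[of y] eps_closed[of "x \<ominus>\<^bsub>T\<^esub> y"] 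
      by (simp add: M.M.add.r_cancel_one M.M.add.r_cancel_one')
    then have "x \<ominus>\<^bsub>T\<^esub> y = \<zero>\<^bsub>T\<^esub>" using eps_ker xy by simp
    then show "x = y" using xy by simp
  qed
  ultimately show ?thesis using eps_surj by (simp add: rep_iso_def bij_betw_def)
qed

end

context localized begin

theorem unit_nat_iso:
  "nat_iso (W_alg n Q \<phi>) (W_mod n Q \<phi> :: ('q, 'v) rep set) (W_alg n Q \<phi>)
    (\<lambda>V. F_obj n Q \<phi> (G_obj n Q \<phi> V))
    (\<lambda>V V' f. F_mor n (G_obj n Q \<phi> V) (G_obj n Q \<phi> V') (G_mor n Q \<phi> V V' f))
    (\<lambda>V. V) (\<lambda>V V' f. f)"
  unfolding nat_iso_def
proof (intro exI[of _ "whittaker_module.unit_iso n Q \<phi>"] conjI ballI)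
  show "whittaker_module.unit_iso n Q \<phi> V \<in> rep_iso (W_alg n Q \<phi>) (F_obj n Q \<phi> (G_obj n Q \<phi> V)) V"
    if "V \<in> W_mod n Q \<phi>" for V :: "('q, 'v) rep"
    by (rule whittaker_module.unit_iso[OF whittaker_moduleI[OF that]])
  fix V V' :: "('q, 'v) rep" and f
  assume V: "V \<in> W_mod n Q \<phi>" and V': "V' \<in> W_mod n Q \<phi>" and f: "f \<in> rep_hom (W_alg n Q \<phi>) V V'"
  interpret whittaker_morphism n Q \<phi> V V' f by (rule whittaker_morphismI[OF V V' f])
  have "Y.unit_iso (F_mor n (G_obj n Q \<phi> V) (G_obj n Q \<phi> V') (G_mor n Q \<phi> V V' f) x) = f (X.unit_iso x)"
    if x: "x \<in> wh n (G_obj n Q \<phi> V)" for x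
  proof -
    obtain v where v: "v \<in> carrier V" "x = X.tens \<one> v" using X.wh_G_E[OF x] .
    then show ?thesis using x rep_homD(4)[OF f v(1)]
      by (simp add: F_mor_def G_mor_tens X.unit_iso_tens Y.unit_iso_tens)
  qed
  then show "compose (carrier (F_obj n Q \<phi> (G_obj n Q \<phi> V))) Y.unit_iso
      (F_mor n (G_obj n Q \<phi> V) (G_obj n Q \<phi> V') (G_mor n Q \<phi> V V' f)) =
    compose (carrier (F_obj n Q \<phi> (G_obj n Q \<phi> V))) f X.unit_iso"
    by (simp add: compose_def fun_eq_iff restrict_def)
qed

theorem counit_nat_iso:
  "nat_iso (sl n) (H1 n :: (complex mat, 'm) rep set) (sl n)
    (\<lambda>M. G_obj n Q \<phi> (F_obj n Q \<phi> M))
    (\<lambda>M N f. G_mor n Q \<phi> (F_obj n Q \<phi> M) (F_obj n Q \<phi> N) (F_mor n M N f))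
    (\<lambda>M. M) (\<lambda>M N f. f)"
  unfolding nat_iso_def
proof (intro exI[of _ "counit.eps n Q \<phi>"] conjI ballI)
  have cu: "counit n Q \<phi> M" if "M \<in> H1 n" for M :: "(complex mat, 'm) rep"
    by unfold_locales (rule that)
  show "counit.eps n Q \<phi> M \<in> rep_iso (sl n) (G_obj n Q \<phi> (F_obj n Q \<phi> M)) M"
    if "M \<in> H1 n" for M :: "(complex mat, 'm) rep"
    by (rule counit.eps_iso[OF cu[OF that]])
  fix M N :: "(complex mat, 'm) rep" and f
  assume M: "M \<in> H1 n" and N: "N \<in> H1 n" and f: "f \<in> rep_hom (sl n) M N"
  interpret M: counit n Q \<phi> M by (rule cu[OF M])
  interpret N: counit n Q \<phi> N by (rule cu[OF N])
  interpret whittaker_morphism n Q \<phi> "F_obj n Q \<phi> M" "F_obj n Q \<phi> N" "F_mor n M N f"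
    by (rule whittaker_morphismI[OF F_obj_W_mod[OF M] F_obj_W_mod[OF N] F_mor_hom[OF M N f]])
  have "N.eps (G_mor n Q \<phi> (F_obj n Q \<phi> M) (F_obj n Q \<phi> N) (F_mor n M N f) x) = f (M.eps x)"
    if x: "x \<in> carrier M.T" for x
  proof (rule M.additive_ext[OF _ _ _ _ x, of _ N])
    fix q v assume q: "q \<in> carrier Q" and v: "v \<in> carrier M.EV"
    then show "N.eps (G_mor n Q \<phi> (F_obj n Q \<phi> M) (F_obj n Q \<phi> N) (F_mor n M N f) (M.tens q v)) =
        f (M.eps (M.tens q v))"
      unfolding G_mor_tens[OF q v[unfolded triv_ext_simps]]
      using q v hom_wh[OF f, of v] hom_loc_module[OF M N f q, of v]
      by (simp add: F_mor_def M.eps_tens N.eps_tens wh_closed)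
  next
    fix x y assume "x \<in> carrier M.T" "y \<in> carrier M.T"
    then show "f (M.eps (x \<oplus>\<^bsub>M.T\<^esub> y)) = f (M.eps x) \<oplus>\<^bsub>N\<^esub> f (M.eps y)"
      using rep_homD(1)[OF f] by (simp add: M.eps_add M.eps_closed module_hom_iff)
  qed (simp_all add: G_mor_closed G_mor_add N.eps_closed N.eps_add)
  then show "compose (carrier (G_obj n Q \<phi> (F_obj n Q \<phi> M))) N.eps
      (G_mor n Q \<phi> (F_obj n Q \<phi> M) (F_obj n Q \<phi> N) (F_mor n M N f)) =
    compose (carrier (G_obj n Q \<phi> (F_obj n Q \<phi> M))) f M.eps"
    by (simp add: compose_def fun_eq_iff restrict_def)
qed

end

section \<open>Equivalence on a fixed carrier type\<close>

text \<open>A copy of a module whose carrier lies in another type, so that \<open>G\<close> can take values on the type that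
  carries its arguments.\<close>

definition transport :: "('a \<Rightarrow> 'b) \<Rightarrow> ('x, 'a) rep \<Rightarrow> ('x, 'b) rep" where
  "transport \<iota> M = (let j = inv_into (carrier M) \<iota> in
     \<lparr>carrier = \<iota> ` carrier M, monoid.mult = undefined, one = undefined, ring.zero = \<iota> \<zero>\<^bsub>M\<^esub>,
      add = (\<lambda>a b. \<iota> (j a \<oplus>\<^bsub>M\<^esub> j b)), smult = (\<lambda>c a. \<iota> (c \<odot>\<^bsub>M\<^esub> j a)),
      act = (\<lambda>x a. \<iota> (act M x (j a)))\<rparr>)"

locale transported =
  fixes \<iota> :: "'a \<Rightarrow> 'b" and M :: "(complex mat, 'a) rep" and n :: nat
  assumes inj: "inj_on \<iota> (carrier M)" and M_H1: "M \<in> H1 n"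
begin

abbreviation "N \<equiv> transport \<iota> M"
abbreviation "j \<equiv> inv_into (carrier M) \<iota>"

lemma sl_mod: "sl_module n M" and wh_fin: "vectorspace.fin_dim cfield (M\<lparr>carrier := wh n M\<rparr>)"
  and nil: "i \<in> {1..n} \<Longrightarrow> v \<in> carrier M \<Longrightarrow>
      \<exists>k. ((\<lambda>w. act M (mat_unit n 0 i) w \<ominus>\<^bsub>M\<^esub> w) ^^ k) v = \<zero>\<^bsub>M\<^esub>"
  using M_H1 by (auto simp: H1_def)

sublocale M: sl_rep n M by (rule sl_rep.intro[OF sl_mod])

lemma j [simp]: "v \<in> carrier M \<Longrightarrow> j (\<iota> v) = v"
  using inj by (rule inv_into_f_f)

lemma N_carrier [simp]: "carrier N = \<iota> ` carrier M"
  and N_zero [simp]: "\<zero>\<^bsub>N\<^esub> = \<iota> \<zero>\<^bsub>M\<^esub>"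
  by (simp_all add: transport_def Let_def)

lemma N_ops [simp]:
  "v \<in> carrier M \<Longrightarrow> w \<in> carrier M \<Longrightarrow> \<iota> v \<oplus>\<^bsub>N\<^esub> \<iota> w = \<iota> (v \<oplus>\<^bsub>M\<^esub> w)"
  "v \<in> carrier M \<Longrightarrow> c \<odot>\<^bsub>N\<^esub> \<iota> v = \<iota> (c \<odot>\<^bsub>M\<^esub> v)"
  "v \<in> carrier M \<Longrightarrow> act N x (\<iota> v) = \<iota> (act M x v)"
  by (simp_all add: transport_def Let_def)

lemma N_vectorspace: "vectorspace cfield N"
proof (rule vectorspaceI)
  show "abelian_group N"
  proof (rule abelian_groupI)
    fix a assume "a \<in> carrier N"
    then obtain v where v: "v \<in> carrier M" "a = \<iota> v" by auto
    then have "\<iota> (\<ominus>\<^bsub>M\<^esub> v) \<oplus>\<^bsub>N\<^esub> a = \<zero>\<^bsub>N\<^esub>" by (simp add: M.M.l_neg)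
    then show "\<exists>b \<in> carrier N. b \<oplus>\<^bsub>N\<^esub> a = \<zero>\<^bsub>N\<^esub>" using v by auto
  qed (auto simp: M.M.a_ac)
qed (auto simp: M.sm)

sublocale \<iota>: linear_op M N \<iota>
  by (auto simp: linear_op_def linear_op_axioms_def M.vectorspace_axioms N_vectorspace module_hom_iff)

lemma wh_N: "wh n N = \<iota> ` wh n M"
proof -
  have "\<iota> v \<in> wh n N \<longleftrightarrow> v \<in> wh n M" if v: "v \<in> carrier M" for v
  proof -
    have "\<iota> (act M (mat_unit n 0 i) v) = \<iota> v \<longleftrightarrow> act M (mat_unit n 0 i) v = v" if "i \<in> {1..n}" for i
      using inj_on_eq_iff[OF inj _ v, of "act M (mat_unit n 0 i) v"] M.act_simps(1)[OF mat_unit_sl[of 0 n i] v] that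
      by auto
    then show ?thesis using v by (auto simp: wh_def)
  qed
  then show ?thesis by (auto simp: wh_def)
qed

lemma N_H1: "N \<in> H1 n"
proof -
  note mod = sl_moduleD(3-5)[OF sl_mod]
  have "sl_module n N"
    unfolding sl_module_def
    by (auto simp: N_vectorspace module_hom_iff M.act_simps mod M.sm sl_bracket \<iota>.diff[symmetric])
  moreover have "\<exists>k. ((\<lambda>w. act N (mat_unit n 0 i) w \<ominus>\<^bsub>N\<^esub> w) ^^ k) a = \<zero>\<^bsub>N\<^esub>"
    if i: "i \<in> {1..n}" and a: "a \<in> carrier N" for i a
  proof -
    obtain v where v: "v \<in> carrier M" "a = \<iota> v" using a by auto
    have sl: "mat_unit n 0 i \<in> sl n" using i by (intro mat_unit_sl) auto
    have "((\<lambda>w. act N (mat_unit n 0 i) w \<ominus>\<^bsub>N\<^esub> w) ^^ k) a =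
        \<iota> (((\<lambda>w. act M (mat_unit n 0 i) w \<ominus>\<^bsub>M\<^esub> w) ^^ k) v) \<and>
        ((\<lambda>w. act M (mat_unit n 0 i) w \<ominus>\<^bsub>M\<^esub> w) ^^ k) v \<in> carrier M" for k
      by (induction k) (auto simp: v M.act_simps(1)[OF sl] \<iota>.diff)
    then show ?thesis using nil[OF i v(1)] by (metis N_zero)
  qed
  moreover have "vectorspace.fin_dim cfield (N\<lparr>carrier := wh n N\<rparr>)"
  proof (rule fin_dim_surj[OF _ _ _ _ wh_fin])
    have wh: "\<zero>\<^bsub>M\<^esub> \<in> wh n M" "v \<in> wh n M \<Longrightarrow> w \<in> wh n M \<Longrightarrow> v \<oplus>\<^bsub>M\<^esub> w \<in> wh n M"
      "v \<in> wh n M \<Longrightarrow> c \<odot>\<^bsub>M\<^esub> v \<in> wh n M" "wh n M \<subseteq> carrier M" for v w c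
      using M.act_simps[OF mat_unit_sl[of 0 n]] by (auto simp: wh_def M.sm)
    show "vectorspace cfield (M\<lparr>carrier := wh n M\<rparr>)"
      by (rule vectorspace_restrict[OF M.vectorspace_axioms]) (use wh in auto)
    show "vectorspace cfield (N\<lparr>carrier := wh n N\<rparr>)"
      by (rule vectorspace_restrict[OF N_vectorspace]) (use wh in \<open>auto simp: wh_N subset_iff\<close>)
    show "\<iota> \<in> module_hom cfield (M\<lparr>carrier := wh n M\<rparr>) (N\<lparr>carrier := wh n N\<rparr>)"
      using wh by (auto simp: module_hom_iff wh_N subset_iff)
  qed (simp add: wh_N)
  ultimately show ?thesis by (auto simp: H1_def)
qed

definition "into = restrict \<iota> (carrier M)"
definition "back = restrict j (carrier N)"

lemma into_back [simp]: "v \<in> carrier M \<Longrightarrow> back (into v) = v" "a \<in> carrier N \<Longrightarrow> into (back a) = a"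
  by (auto simp: into_def back_def)

lemma into_hom: "into \<in> rep_hom (sl n) M N"
  by (rule rep_homI) (auto simp: into_def M.act_simps M.sm)

lemma back_apply: "v \<in> carrier M \<Longrightarrow> back (\<iota> v) = v"
  by (simp add: back_def)

lemma back_hom: "back \<in> rep_hom (sl n) N M"
proof (rule rep_homI)
  show "back \<in> extensional (carrier N)" unfolding back_def by (rule restrict_extensional)
qed (auto simp: back_apply M.act_simps M.sm)

lemma back_closed: "a \<in> carrier N \<Longrightarrow> back a \<in> carrier M"
  and into_closed: "v \<in> carrier M \<Longrightarrow> into v \<in> carrier N"
  by (auto simp: into_def back_def)

end

context whittaker_module begin

text \<open>Every element of the induced module is a finite sum of monomials in the \<open>h i\<close> applied to vectors
  \<open>1 \<otimes> v\<close>. A nonzero complex space is infinite, so these finite data are no more than the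
  vectors of \<open>V\<close>.\<close>

lemma induced_module_embeds: "\<exists>\<iota> :: ('q \<times> 'v \<Rightarrow>\<^sub>0 int) set \<Rightarrow> 'v. inj_on \<iota> (carrier T)"
proof (cases "carrier V = {\<zero>\<^bsub>V\<^esub>}")
  case True
  have "x = \<zero>\<^bsub>T\<^esub>" if "x \<in> carrier T" for x
    using that by (induction x rule: T_induct) (use True tens_zero_right in auto)
  then show ?thesis by (intro exI[of _ "\<lambda>_. undefined"] inj_onI) metis
next
  case False
  interpret V0: vectorspace cfield V by (rule W_modD(1)[OF V_W_mod])
  note sm = vectorspace_smult_simps[OF V0.vectorspace_axioms]
  obtain v where v: "v \<in> carrier V" "v \<noteq> \<zero>\<^bsub>V\<^esub>" using False V0.M.zero_closed by blast
  have "inj (\<lambda>c. c \<odot>\<^bsub>V\<^esub> v)"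
  proof (rule injI, rule ccontr)
    fix c d assume cd: "c \<odot>\<^bsub>V\<^esub> v = d \<odot>\<^bsub>V\<^esub> v" "c \<noteq> d"
    have "(c - d) \<odot>\<^bsub>V\<^esub> v = \<zero>\<^bsub>V\<^esub>"
      using sm(2)[OF v(1), of c "- d"] sm(8)[OF v(1), of d] sm(1)[OF v(1), of d] cd(1) by (simp add: V0.M.r_neg)
    then have "(inverse (c - d) * (c - d)) \<odot>\<^bsub>V\<^esub> v = \<zero>\<^bsub>V\<^esub>" by (simp only: sm(4)[OF v(1)] sm(7))
    then show False using cd(2) v sm(5) by simp
  qed
  then have "infinite (range (\<lambda>c. c \<odot>\<^bsub>V\<^esub> v))"
    using finite_imageD[of "\<lambda>c. c \<odot>\<^bsub>V\<^esub> v" UNIV] infinite_UNIV_char_0[where 'a = complex] by blast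
  moreover have "range (\<lambda>c. c \<odot>\<^bsub>V\<^esub> v) \<subseteq> carrier V" using sm(1)[OF v(1)] by blast
  ultimately have inf: "infinite (carrier V)" using finite_subset by blast
  \<comment> \<open>A list of pairs of an \<open>h\<close>-monomial, given by its word of indices, and a vector of \<open>V\<close> encodes
    the sum of the monomials applied to the \<open>1 \<otimes> v\<close>. The encoded sums are closed under all
    operations that \<open>inv_generates\<close> asks for.\<close>
  define hact where "hact w x = foldr (\<lambda>i. act T (h i)) w x" for w x
  define val where "val xs = foldr (\<lambda>(w, v) x. hact w (tens \<one> v) \<oplus>\<^bsub>T\<^esub> x) xs \<zero>\<^bsub>T\<^esub>" for xs
  let ?L = "lists ({w. set w \<subseteq> {1..n}} \<times> carrier V)"
  have hact: "set w \<subseteq> {1..n} \<Longrightarrow> x \<in> carrier T \<Longrightarrow> hact w x \<in> carrier T"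
    "set w \<subseteq> {1..n} \<Longrightarrow> x \<in> carrier T \<Longrightarrow> hact w (c \<odot>\<^bsub>T\<^esub> x) = c \<odot>\<^bsub>T\<^esub> hact w x" for w x c
    by (induction w) (auto simp: hact_def act_T_closed U.M_act(3))
  have val_closed: "xs \<in> ?L \<Longrightarrow> val xs \<in> carrier T" for xs
    by (induction xs) (auto simp: val_def hact tens_closed)
  have val_append: "xs \<in> ?L \<Longrightarrow> ys \<in> ?L \<Longrightarrow> val (xs @ ys) = val xs \<oplus>\<^bsub>T\<^esub> val ys" for xs ys
  proof (induction xs)
    case Nil
    then show ?case using val_closed by (simp add: val_def)
  next
    case (Cons p xs)
    obtain w v where p: "p = (w, v)" "set w \<subseteq> {1..n}" "v \<in> carrier V" using Cons.prems by (cases p) auto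
    then show ?case using Cons val_closed[of xs] val_closed[of ys] hact(1)[OF p(2) tens_closed[of \<one> v]]
      by (simp add: val_def TG.a_assoc)
  qed
  have vsT: "vectorspace cfield T" by (rule T_vectorspace)
  have "carrier T \<subseteq> val ` ?L"
  proof (rule U.S.inv_generates)
    show "U.S.inv_on {1..n} \<subseteq> val ` ?L"
    proof
      fix x assume "x \<in> U.S.inv_on {1..n}"
      then obtain v where v: "v \<in> carrier V" "x = tens \<one> v" using U.whit_inv_on whit_T by auto
      then have "x = val [([], v)]" by (simp add: val_def hact_def tens_closed)
      moreover have "[([], v)] \<in> ?L" using v by simp
      ultimately show "x \<in> val ` ?L" by blast
    qed
    show "val ` ?L \<subseteq> carrier T" using val_closed by blast
  next
    fix x y assume "x \<in> val ` ?L" "y \<in> val ` ?L"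
    then obtain xs ys where "xs \<in> ?L" "ys \<in> ?L" "x = val xs" "y = val ys" by blast
    then have "x \<oplus>\<^bsub>T\<^esub> y = val (xs @ ys)" "xs @ ys \<in> ?L" using val_append by auto
    then show "x \<oplus>\<^bsub>T\<^esub> y \<in> val ` ?L" by blast
  next
    fix c x assume "x \<in> val ` ?L"
    then obtain xs where xs: "xs \<in> ?L" "x = val xs" by blast
    have "xs \<in> ?L \<Longrightarrow> c \<odot>\<^bsub>T\<^esub> val xs = val (map (\<lambda>(w, v). (w, c \<odot>\<^bsub>V\<^esub> v)) xs)" for xs
    proof (induction xs)
      case Nil
      then show ?case using vectorspace_smult_simps(7)[OF vsT] by (simp add: val_def)
    next
      case (Cons p xs)
      obtain w v where p: "p = (w, v)" "set w \<subseteq> {1..n}" "v \<in> carrier V" using Cons.prems by (cases p) auto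
      then show ?case
        using Cons val_closed[of xs] hact[OF p(2) tens_closed[of \<one> v]] vectorspace_smult_simps(3)[OF vsT]
        by (simp add: val_def tens_one_smult[symmetric])
    qed
    moreover have "map (\<lambda>(w, v). (w, c \<odot>\<^bsub>V\<^esub> v)) xs \<in> ?L" using xs(1) by (induction xs) (auto simp: sm)
    ultimately show "c \<odot>\<^bsub>T\<^esub> x \<in> val ` ?L" using xs by blast
  next
    fix i x assume i: "i \<in> {1..n}" and "x \<in> val ` ?L"
    then obtain xs where xs: "xs \<in> ?L" "x = val xs" by blast
    have "xs \<in> ?L \<Longrightarrow> act T (h i) (val xs) = val (map (\<lambda>(w, v). (i # w, v)) xs)" for xs
    proof (induction xs)
      case Nil
      then show ?case using U.M_act(4) i by (simp add: val_def)
    next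
      case (Cons p xs)
      obtain w v where p: "p = (w, v)" "set w \<subseteq> {1..n}" "v \<in> carrier V" using Cons.prems by (cases p) auto
      then show ?case
        using Cons val_closed[of xs] hact(1)[OF p(2) tens_closed[of \<one> v]] act_T_add[of "h i"] i
        by (simp add: val_def hact_def)
    qed
    moreover have "map (\<lambda>(w, v). (i # w, v)) xs \<in> ?L" using xs(1) i by (induction xs) auto
    ultimately show "act T (h i) x \<in> val ` ?L" using xs by blast
  qed
  moreover have "?L \<subseteq> lists (UNIV \<times> carrier V)" by auto
  ultimately have "|carrier T| \<le>o |lists ((UNIV :: nat list set) \<times> carrier V)|"
    by (meson surj_imp_ordLeq image_mono order_trans)
  also have "|lists ((UNIV :: nat list set) \<times> carrier V)| =o |(UNIV :: nat list set) \<times> carrier V|"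
    using inf finite_cartesian_productD2[of "UNIV :: nat list set" "carrier V"] by (intro card_of_lists_infinite) auto
  also have "|(UNIV :: nat list set) \<times> carrier V| \<le>o |carrier V|"
  proof (rule card_of_Times_ordLeq_infinite[OF inf])
    have "infinite (UNIV :: nat list set)" by (rule infinite_UNIV_listI)
    then show "|UNIV :: nat list set| \<le>o |carrier V|"
      using infinite_iff_card_of_countable[of "UNIV :: nat list set" "carrier V"] inf by simp
  qed simp
  finally show ?thesis using card_of_ordLeq by (metis card_of_ordLeq)
qed

end

context localized begin

text \<open>\<open>F\<close> and the transported functor \<open>G\<close> are mutually inverse up to isomorphism, since
  transport changes \<open>G\<close> only by a natural isomorphism.\<close>

theorem equivalence:
  "equivalent_categories (sl n) (H1 n :: (complex mat, 'u) rep set) (W_alg n Q \<phi>) (W_mod n Q \<phi> :: ('q, 'u) rep set)"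
proof -
  let ?C = "H1 n :: (complex mat, 'u) rep set" and ?D = "W_mod n Q \<phi> :: ('q, 'u) rep set"
  let ?F = "F_obj n Q \<phi>" and ?G = "G_obj n Q \<phi> :: ('q, 'u) rep \<Rightarrow> _" and ?W = "W_alg n Q \<phi>"
  define emb :: "('q, 'u) rep \<Rightarrow> ('q \<times> 'u \<Rightarrow>\<^sub>0 int) set \<Rightarrow> 'u"
    where "emb V = (SOME \<iota>. inj_on \<iota> (carrier (?G V)))" for V
  have G_H1: "?G V \<in> H1 n" if "V \<in> ?D" for V
    by (rule whittaker_module.G_obj_H1[OF whittaker_moduleI[OF that]])
  have tr: "transported (emb V) (?G V) n" if V: "V \<in> ?D" for V
  proof
    have "\<exists>\<iota> :: _ \<Rightarrow> 'u. inj_on \<iota> (carrier (?G V))"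
      using whittaker_module.induced_module_embeds[OF whittaker_moduleI[OF V]]
        whittaker_module.G_obj_simps(1)[OF whittaker_moduleI[OF V]] by simp
    then show "inj_on (emb V) (carrier (?G V))" unfolding emb_def by (rule someI_ex)
  qed (rule G_H1[OF V])
  define Go where "Go V = transport (emb V) (?G V)" for V
  define to where "to V = transported.into (emb V) (?G V)" for V
  define fr where "fr V = transported.back (emb V) (?G V)" for V
  note trD = transported.into_back[OF tr] transported.into_hom[OF tr] transported.back_hom[OF tr]
    transported.back_closed[OF tr] transported.into_closed[OF tr] transported.N_H1[OF tr]
  note T = trD[folded Go_def to_def fr_def]
  define Gm where "Gm V V' f = compose (carrier (Go V)) (to V')
      (compose (carrier (Go V)) (G_mor n Q \<phi> V V' f) (fr V))" for V V' f
  have Gmor: "G_mor n Q \<phi> V V' f \<in> rep_hom (sl n) (?G V) (?G V')"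
    if "V \<in> ?D" "V' \<in> ?D" "f \<in> rep_hom ?W V V'" for V V' f
    by (rule whittaker_morphism.G_mor_hom[OF whittaker_morphismI[OF that]])
  have Gm_hom: "Gm V V' f \<in> rep_hom (sl n) (Go V) (Go V')"
    if "V \<in> ?D" "V' \<in> ?D" "f \<in> rep_hom ?W V V'" for V V' f
    unfolding Gm_def
    by (rule rep_hom_compose[OF rep_hom_compose[OF T(4)[OF that(1)] Gmor[OF that]] T(3)[OF that(2)]])
      (rule H1_closed[OF T(7)[OF that(1)]]; assumption)+
  have Gm_apply: "Gm V V' f a = to V' (G_mor n Q \<phi> V V' f (fr V a))" if "a \<in> carrier (Go V)" for V V' f a
    using that by (simp add: Gm_def compose_def)
  have fr_Gm: "fr V' (Gm V V' f a) = G_mor n Q \<phi> V V' f (fr V a)"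
    if "V \<in> ?D" "V' \<in> ?D" "f \<in> rep_hom ?W V V'" "a \<in> carrier (Go V)" for V V' f a
    using T(1)[OF that(2)] T(5)[OF that(1,4)] rep_homD(4)[OF Gmor[OF that(1-3)]] that(4) by (simp add: Gm_apply)
  have F1: "is_functor (sl n) ?C ?W ?D ?F (F_mor n)" by (rule F_functor)
  have G1: "is_functor ?W ?D (sl n) ?C Go Gm"
    unfolding is_functor_def
  proof (intro conjI ballI)
    fix V assume V: "V \<in> ?D"
    show "Go V \<in> H1 n" by (rule T(7)[OF V])
    show "Gm V V (\<lambda>v \<in> carrier V. v) = (\<lambda>v \<in> carrier (Go V). v)"
    proof
      fix a show "Gm V V (\<lambda>v \<in> carrier V. v) a = (\<lambda>v \<in> carrier (Go V). v) a"
        using T(2)[OF V] T(5)[OF V] by (simp add: Gm_def compose_def G_mor_id[OF V])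
    qed
  next
    fix V V' f assume "V \<in> ?D" "V' \<in> ?D" "f \<in> rep_hom ?W V V'"
    then show "Gm V V' f \<in> rep_hom (sl n) (Go V) (Go V')" by (rule Gm_hom)
  next
    fix L M N f g
    assume L: "L \<in> ?D" and M: "M \<in> ?D" and N: "N \<in> ?D" and f: "f \<in> rep_hom ?W L M" and g: "g \<in> rep_hom ?W M N"
    show "Gm L N (compose (carrier L) g f) = compose (carrier (Go L)) (Gm M N g) (Gm L M f)"
    proof
      fix a
      show "Gm L N (compose (carrier L) g f) a = compose (carrier (Go L)) (Gm M N g) (Gm L M f) a"
      proof (cases "a \<in> carrier (Go L)")
        case True
        have "G_mor n Q \<phi> L N (compose (carrier L) g f) (fr L a) = G_mor n Q \<phi> M N g (G_mor n Q \<phi> L M f (fr L a))"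
          unfolding G_mor_compose[OF L M N f g] using T(5)[OF L True] by (simp only: compose_eq)
        moreover have "Gm L M f a \<in> carrier (Go M)" using rep_homD(4)[OF Gm_hom[OF L M f] True] .
        ultimately show ?thesis using True fr_Gm[OF L M f True] by (simp only: compose_eq Gm_apply)
      next
        case False
        then show ?thesis by (simp only: Gm_def compose_def restrict_apply if_False)
      qed
    qed
  qed
  have N1: "nat_iso ?W ?D ?W (\<lambda>V. ?F (Go V)) (\<lambda>V V' f. F_mor n (Go V) (Go V') (Gm V V' f)) (\<lambda>V. V) (\<lambda>V V' f. f)"
  proof -
    obtain \<eta> where \<eta>: "\<And>V. V \<in> ?D \<Longrightarrow> \<eta> V \<in> rep_iso ?W (?F (?G V)) V"
      "\<And>V V' f. V \<in> ?D \<Longrightarrow> V' \<in> ?D \<Longrightarrow> f \<in> rep_hom ?W V V' \<Longrightarrow>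
        compose (carrier (?F (?G V))) (\<eta> V') (F_mor n (?G V) (?G V') (G_mor n Q \<phi> V V' f)) =
        compose (carrier (?F (?G V))) f (\<eta> V)"
      using unit_nat_iso[where 'v = 'u] unfolding nat_iso_def by blast
    define \<theta> where "\<theta> V = compose (wh n (Go V)) (\<eta> V) (F_mor n (Go V) (?G V) (fr V))" for V
    have frw: "fr V a \<in> wh n (?G V)" if "V \<in> ?D" "a \<in> wh n (Go V)" for V a
      using hom_wh[OF T(4)[OF that(1)] that(2)] .
    have tow: "to V a \<in> wh n (Go V)" if "V \<in> ?D" "a \<in> wh n (?G V)" for V a
      using hom_wh[OF T(3)[OF that(1)] that(2)] .
    have \<theta>_apply: "\<theta> V a = \<eta> V (fr V a)" if "a \<in> wh n (Go V)" for V a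
      using that by (simp add: \<theta>_def compose_eq F_mor_def)
    have "\<theta> V \<in> rep_iso ?W (?F (Go V)) V" if V: "V \<in> ?D" for V
    proof -
      have "\<theta> V \<in> rep_hom ?W (?F (Go V)) V"
        unfolding \<theta>_def
        using rep_hom_compose[OF F_mor_hom[OF T(7)[OF V] G_H1[OF V] T(4)[OF V]], of "\<eta> V" V] \<eta>(1)[OF V]
          W_modD[OF F_obj_W_mod[OF T(7)[OF V]]]
        by (simp add: rep_iso_def)
      moreover have "bij_betw (fr V) (wh n (Go V)) (wh n (?G V))"
        by (rule bij_betw_byWitness[where f' = "to V"])
          (use frw tow V T(1,2) in \<open>auto simp: wh_closed\<close>)
      then have "bij_betw (\<eta> V \<circ> fr V) (wh n (Go V)) (carrier V)"
        using \<eta>(1)[OF V] bij_betw_trans by (fastforce simp: rep_iso_def)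
      then have "bij_betw (\<theta> V) (wh n (Go V)) (carrier V)"
        using bij_betw_cong[of "wh n (Go V)" "\<theta> V" "\<eta> V \<circ> fr V"] \<theta>_apply by simp
      ultimately show ?thesis by (simp add: rep_iso_def)
    qed
    moreover have "compose (carrier (?F (Go V))) (\<theta> V') (F_mor n (Go V) (Go V') (Gm V V' f)) =
        compose (carrier (?F (Go V))) f (\<theta> V)"
      if V: "V \<in> ?D" and V': "V' \<in> ?D" and f: "f \<in> rep_hom ?W V V'" for V V' f
    proof -
      have "\<theta> V' (Gm V V' f a) = f (\<theta> V a)" if a: "a \<in> wh n (Go V)" for a
      proof -
        have ac: "a \<in> carrier (Go V)" using a by (rule wh_closed)
        have "\<theta> V' (Gm V V' f a) = \<eta> V' (G_mor n Q \<phi> V V' f (fr V a))"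
          using \<theta>_apply[OF hom_wh[OF Gm_hom[OF V V' f] a]] fr_Gm[OF V V' f ac] by simp
        also have "\<dots> = f (\<eta> V (fr V a))"
          using fun_cong[OF \<eta>(2)[OF V V' f], of "fr V a"] frw[OF V a] by (simp add: compose_eq F_mor_def)
        finally show ?thesis using \<theta>_apply[OF a] by simp
      qed
      then show ?thesis by (simp add: fun_eq_iff compose_def F_mor_def)
    qed
    ultimately show ?thesis unfolding nat_iso_def by blast
  qed
  have N2: "nat_iso (sl n) ?C (sl n) (\<lambda>M. Go (?F M)) (\<lambda>M N f. Gm (?F M) (?F N) (F_mor n M N f)) (\<lambda>M. M) (\<lambda>M N f. f)"
  proof -
    obtain \<epsilon> where \<epsilon>: "\<And>M. M \<in> ?C \<Longrightarrow> \<epsilon> M \<in> rep_iso (sl n) (?G (?F M)) M"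
      "\<And>M N f. M \<in> ?C \<Longrightarrow> N \<in> ?C \<Longrightarrow> f \<in> rep_hom (sl n) M N \<Longrightarrow>
        compose (carrier (?G (?F M))) (\<epsilon> N) (G_mor n Q \<phi> (?F M) (?F N) (F_mor n M N f)) =
        compose (carrier (?G (?F M))) f (\<epsilon> M)"
      using counit_nat_iso[where 'm = 'u] unfolding nat_iso_def by blast
    define \<theta> where "\<theta> M = compose (carrier (Go (?F M))) (\<epsilon> M) (fr (?F M))" for M
    have \<theta>_apply: "\<theta> M a = \<epsilon> M (fr (?F M) a)" if "a \<in> carrier (Go (?F M))" for M a
      using that by (simp add: \<theta>_def compose_eq)
    have FD: "?F M \<in> ?D" if "M \<in> ?C" for M using F_obj_W_mod[OF that] .
    have "\<theta> M \<in> rep_iso (sl n) (Go (?F M)) M" if M: "M \<in> ?C" for M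
    proof -
      note V = FD[OF M]
      have "\<theta> M \<in> rep_hom (sl n) (Go (?F M)) M"
        unfolding \<theta>_def using rep_hom_compose[OF T(4)[OF V], of "\<epsilon> M" M] \<epsilon>(1)[OF M] H1_closed[OF T(7)[OF V]]
        by (simp add: rep_iso_def)
      moreover have "bij_betw (fr (?F M)) (carrier (Go (?F M))) (carrier (?G (?F M)))"
        by (rule bij_betw_byWitness[where f' = "to (?F M)"]) (use T(1,2,5,6) V in auto)
      then have "bij_betw (\<epsilon> M \<circ> fr (?F M)) (carrier (Go (?F M))) (carrier M)"
        using \<epsilon>(1)[OF M] bij_betw_trans by (fastforce simp: rep_iso_def)
      then have "bij_betw (\<theta> M) (carrier (Go (?F M))) (carrier M)"
        using bij_betw_cong[of "carrier (Go (?F M))" "\<theta> M" "\<epsilon> M \<circ> fr (?F M)"] \<theta>_apply by simp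
      ultimately show ?thesis by (simp add: rep_iso_def)
    qed
    moreover have "compose (carrier (Go (?F M))) (\<theta> N) (Gm (?F M) (?F N) (F_mor n M N f)) =
        compose (carrier (Go (?F M))) f (\<theta> M)"
      if M: "M \<in> ?C" and N: "N \<in> ?C" and f: "f \<in> rep_hom (sl n) M N" for M N f
    proof -
      note V = FD[OF M] FD[OF N] and Ff = F_mor_hom[OF M N f]
      have "\<theta> N (Gm (?F M) (?F N) (F_mor n M N f) a) = f (\<theta> M a)" if a: "a \<in> carrier (Go (?F M))" for a
      proof -
        have "\<theta> N (Gm (?F M) (?F N) (F_mor n M N f) a) =
            \<epsilon> N (G_mor n Q \<phi> (?F M) (?F N) (F_mor n M N f) (fr (?F M) a))"
          using \<theta>_apply[OF rep_homD(4)[OF Gm_hom[OF V Ff] a]] fr_Gm[OF V Ff a] by simp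
        also have "\<dots> = f (\<epsilon> M (fr (?F M) a))"
          using fun_cong[OF \<epsilon>(2)[OF M N f], of "fr (?F M) a"] T(5)[OF V(1) a] by (simp only: compose_eq)
        finally show ?thesis using \<theta>_apply[OF a] by simp
      qed
      then show ?thesis by (simp add: fun_eq_iff compose_def)
    qed
    ultimately show ?thesis unfolding nat_iso_def by blast
  qed
  show ?thesis unfolding equivalent_categories_def using F1 G1 N1 N2 by blast
qed

end

theorem proposition10:
  fixes n :: nat and Q :: "'q ring" and \<phi> :: "env \<Rightarrow> 'q"
  assumes "n \<ge> 2"
    and "is_localization (U_alg n) (ore_set n) Q \<phi>"
  shows "is_functor (sl n) (H1 n :: (complex mat, 'm) rep set) (W_alg n Q \<phi>) (W_mod n Q \<phi>)
           (F_obj n Q \<phi>) (F_mor n) \<and>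
         is_functor (W_alg n Q \<phi>) (W_mod n Q \<phi> :: ('q, 'v) rep set) (sl n) (H1 n)
           (G_obj n Q \<phi>) (G_mor n Q \<phi>) \<and>
         nat_iso (W_alg n Q \<phi>) (W_mod n Q \<phi> :: ('q, 'v) rep set) (W_alg n Q \<phi>)
           (\<lambda>V. F_obj n Q \<phi> (G_obj n Q \<phi> V))
           (\<lambda>V V' f. F_mor n (G_obj n Q \<phi> V) (G_obj n Q \<phi> V') (G_mor n Q \<phi> V V' f))
           (\<lambda>V. V) (\<lambda>V V' f. f) \<and>
         nat_iso (sl n) (H1 n :: (complex mat, 'm) rep set) (sl n)
           (\<lambda>M. G_obj n Q \<phi> (F_obj n Q \<phi> M))
           (\<lambda>M N f. G_mor n Q \<phi> (F_obj n Q \<phi> M) (F_obj n Q \<phi> N) (F_mor n M N f))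
           (\<lambda>M. M) (\<lambda>M N f. f) \<and>
         equivalent_categories (sl n) (H1 n :: (complex mat, 'u) rep set)
           (W_alg n Q \<phi>) (W_mod n Q \<phi> :: ('q, 'u) rep set)"
proof -
  interpret localized n Q \<phi> by unfold_locales (rule assms(2))
  show ?thesis by (intro conjI F_functor G_functor unit_nat_iso counit_nat_iso equivalence)
qed

end
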